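(* Let $(u_n)$ be a bounded sequence in $L^2(\mathbb{T}^d)$ and let $r\in\{1,\dots,d-1\}$. Suppose that the following condition holds: there exists a sequence of positive reals $(h_n)$ tending to zero such that $$\limsup_{n\to\infty}\sum_{|l|>R/h_n}|\widehat{u_n}(l)|^2\to0\quad\text{as }R\to\infty,$$ and every accumulation point $\mu_0\in\mathcal{M}_+(\mathbb{T}^d\times\mathbb{R}^d)$ of the sequence of Wigner distributions $(w_{u_n}^{h_n})$ satisfies $$\mu_0\Big(\mathbb{T}^d\times\bigcup_{j<r}\Omega_j\Big)=0.$$ Let $\nu\in L^\infty(\mathbb{T};L^1(\mathbb{T}^d))$ be a weak-$*$ accumulation point of $(|e^{it\Delta}u_n|^2)$, with Fourier coefficients $\widehat\nu(l,s)$, $(l,s)\in\mathbb{Z}^d\times\mathbb{Z}$. Then $$\Vert\widehat\nu\Vert_{l^{d+1-r}(\mathbb{Z}^{d+1})}<\infty.$$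
   Context: $\mathbb{T}^d:=\mathbb{R}^d/2\pi\mathbb{Z}^d$ and $\mathbb{T}:=\mathbb{R}/2\pi\mathbb{Z}$. For $u\in L^2(\mathbb{T}^d)$, $u(x)=\sum_{k\in\mathbb{Z}^d}\widehat u(k)e^{ik\cdot x}$, $e^{it\Delta}u(x)=\sum_{k\in\mathbb{Z}^d}\widehat u(k)e^{i(k\cdot x-|k|^2t)}$ is the solution of $i\partial_t\psi+\Delta\psi=0$, $\psi(\cdot,0)=u$; it is $2\pi$-periodic in $t$. $\mathcal{M}_+(X)$ denotes the set of positive Radon measures on $X$. Weak-$*$ accumulation points: $\nu\in L^\infty(\mathbb{T};\mathcal{M}_+(\mathbb{T}^d))$ is a weak-$*$ accumulation point of $(|e^{it\Delta}u_n|^2)$ if there is a subsequence $(u_{n'})$ such that $$\lim_{n'\to\infty}\int_{\mathbb{T}\times\mathbb{T}^d}\phi(t)a(x)|e^{it\Delta}u_{n'}(x)|^2\,dt\,dx=\int_{\mathbb{T}}\int_{\mathbb{T}^d}\phi(t)a(x)\,\nu(dx,t)\,dt$$ for every $\phi\in L^1(\mathbb{T})$ and every $a\in C(\mathbb{T}^d)$. (It is a known result of Bourgain that every such $\nu$ belongs to $L^\infty(\mathbb{T};L^1(\mathbb{T}^d))$.) Its Fourier coefficients are those for which $\nu(x,t)=\sum_{(l,s)}\widehat\nu(l,s)e^{i(l\cdot x+st)}$. Resonant vectors: for $\xi\in\mathbb{R}^d$ let $\Lambda_\xi:=\{k\in\mathbb{Z}^d:k\cdot\xi=0\}$, and for $j=0,\dots,d$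 let $\Omega_j:=\{\xi\in\mathbb{R}^d:\operatorname{rk}\Lambda_\xi=d-j\}$, where $\operatorname{rk}$ is the rank of a submodule of $\mathbb{Z}^d$. Wigner distributions: for $u\in L^2(\mathbb{T}^d)$ and $h>0$, $w_u^h$ is the distribution on $\mathbb{T}^d\times\mathbb{R}^d$ defined by testing the semiclassical Weyl quantization against $u$: for $a\in C_c^\infty(\mathbb{T}^d\times\mathbb{R}^d)$, $$\langle w_u^h,a\rangle=\langle u,\mathrm{Op}_h(a)u\rangle_{L^2(\mathbb{T}^d)}=\sum_{k,j\in\mathbb{Z}^d}\widehat u(k)\overline{\widehat u(j)}\,\widehat a\big(j-k,\tfrac h2(k+j)\big),$$ where $\widehat a(l,\xi)=(2\pi)^{-d}\int_{\mathbb{T}^d}a(x,\xi)e^{-il\cdot x}\,dx$ (up to an irrelevant positive multiplicative normalization constant). If $(u_n)$ is bounded in $L^2(\mathbb{T}^d)$ and $h_n\to0^+$, then $(w_{u_n}^{h_n})$ is bounded in the space of distributions and its accumulation points (limits of subsequences in the sense of distributions) are finite positive Radon measures $\mu_0\in\mathcal{M}_+(\mathbb{T}^d\times\mathbb{R}^d)$. *)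

theory Defs
  imports "HOL-Analysis.Analysis"
begin

text \<open>
  Conventions. The dimension is \<open>d = CARD('d)\<close>. Measures and \<open>L\<^sup>p\<close> classes on the torus
  \<open>\<real>\<^sup>d / 2\<pi>\<int>\<^sup>d\<close> live on the fundamental cell \<open>[0, 2\<pi>)\<^sup>d\<close>, which the quotient map sends
  bijectively and Borel-isomorphically onto the torus; the values of an \<open>L\<^sup>p\<close> function outside the
  cell are irrelevant. Continuity and smoothness on the torus do see the quotient topology, so
  continuous and smooth functions are \<open>2\<pi>\<int>\<^sup>d\<close>-periodic functions on all of \<open>\<real>\<^sup>d\<close>.
\<close>

definition torus_cell :: "(real^'d) set" where
  "torus_cell = {x. \<forall>i. 0 \<le> x $ i \<and> x $ i < 2 * pi}"

definition torus :: "(real^'d) measure" where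
  "torus = restrict_space lborel torus_cell"

definition circle :: "real measure" where
  "circle = restrict_space lborel {0..<2 * pi}"

definition real_vec :: "int^'d \<Rightarrow> real^'d" where
  "real_vec k = (\<chi> i. real_of_int (k $ i))"

definition torus_periodic :: "(real^'d \<Rightarrow> 'b) \<Rightarrow> bool" where
  "torus_periodic f \<longleftrightarrow> (\<forall>x k. f (x + (2 * pi) *\<^sub>R real_vec k) = f x)"


subsection \<open>Square-integrable functions and the Schroedinger flow\<close>

definition L2_torus :: "(real^'d \<Rightarrow> complex) set" where
  "L2_torus = {u \<in> borel_measurable torus. integrable torus (\<lambda>x. (cmod (u x))\<^sup>2)}"

definition L2_norm :: "(real^'d \<Rightarrow> complex) \<Rightarrow> real" where
  "L2_norm u = sqrt (LINT x|torus. (cmod (u x))\<^sup>2)"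

definition fourier_coeff :: "(real^'d \<Rightarrow> complex) \<Rightarrow> int^'d \<Rightarrow> complex" where
  "fourier_coeff u k =
     (LINT x|torus. u x * cis (- (real_vec k \<bullet> x))) / complex_of_real ((2 * pi) ^ CARD('d))"

text \<open>
  The series \<open>\<Sum>\<^sub>k u^(k) e\<^bsup>i(k\<cdot>x - |k|\<^sup>2 t)\<^esup>\<close> converges in \<open>L\<^sup>2\<close>, so
  \<open>e\<^bsup>it\<Delta>\<^esup>u\<close> is determined up to null sets. \<open>schroedinger_flow u \<psi>\<close> says that
  \<open>\<psi> t\<close> represents \<open>e\<^bsup>it\<Delta>\<^esup>u\<close> for every \<open>t\<close>, with joint measurability so that space-time
  integrals make sense. Each \<open>u\<close> in \<open>L\<^sup>2\<close> has such a \<open>\<psi>\<close>: the \<open>L\<^sup>2\<close> tails of the series do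
  not depend on \<open>t\<close>, so one fixed subsequence of partial sums converges almost everywhere for all
  \<open>t\<close>.
\<close>

definition schroedinger_flow ::
    "(real^'d \<Rightarrow> complex) \<Rightarrow> (real \<Rightarrow> real^'d \<Rightarrow> complex) \<Rightarrow> bool" where
  "schroedinger_flow u \<psi> \<longleftrightarrow>
     (\<lambda>(t, x). \<psi> t x) \<in> borel_measurable (circle \<Otimes>\<^sub>M torus) \<and>
     (\<forall>t. \<psi> t \<in> L2_torus \<and>
       ((\<lambda>F. L2_norm (\<lambda>x. \<psi> t x -
           (\<Sum>k\<in>F. fourier_coeff u k * cis (real_vec k \<bullet> x - (norm (real_vec k))\<^sup>2 * t))))
         \<longlongrightarrow> 0) (finite_subsets_at_top UNIV))"


subsection \<open>Weak-* accumulation points\<close>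

definition Linfty_measures :: "(real \<Rightarrow> (real^'d) measure) \<Rightarrow> bool" where
  "Linfty_measures \<nu> \<longleftrightarrow>
     (\<forall>t. sets (\<nu> t) = sets torus) \<and>
     (\<forall>A\<in>sets torus. (\<lambda>t. emeasure (\<nu> t) A) \<in> borel_measurable circle) \<and>
     (\<exists>C::real. AE t in circle. emeasure (\<nu> t) torus_cell \<le> ennreal C)"

definition Linfty_L1 :: "(real \<Rightarrow> real^'d \<Rightarrow> real) \<Rightarrow> bool" where
  "Linfty_L1 f \<longleftrightarrow>
     (\<lambda>(t, x). f t x) \<in> borel_measurable (circle \<Otimes>\<^sub>M torus) \<and>
     (\<exists>C. AE t in circle. integrable torus (f t) \<and> (LINT x|torus. \<bar>f t x\<bar>) \<le> C)"

definition weak_star_accumulation_point ::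
    "(nat \<Rightarrow> real^'d \<Rightarrow> complex) \<Rightarrow> (real \<Rightarrow> (real^'d) measure) \<Rightarrow> bool" where
  "weak_star_accumulation_point u \<nu> \<longleftrightarrow>
     Linfty_measures \<nu> \<and>
     (\<exists>\<sigma> \<psi>. strict_mono (\<sigma> :: nat \<Rightarrow> nat) \<and> (\<forall>n. schroedinger_flow (u n) (\<psi> n)) \<and>
       (\<forall>(\<phi> :: real \<Rightarrow> complex) (a :: real^'d \<Rightarrow> complex).
          integrable circle \<phi> \<and> continuous_on UNIV a \<and> torus_periodic a \<longrightarrow>
          (\<lambda>n. LINT (t, x)|(circle \<Otimes>\<^sub>M torus).
                 \<phi> t * a x * complex_of_real ((cmod (\<psi> (\<sigma> n) t x))\<^sup>2))
            \<longlonglongrightarrow> (LINT t|circle. \<phi> t * (LINT x|\<nu> t. a x))))"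

definition spacetime_fourier_coeff ::
    "(real \<Rightarrow> real^'d \<Rightarrow> real) \<Rightarrow> int^'d \<Rightarrow> int \<Rightarrow> complex" where
  "spacetime_fourier_coeff f l s =
     (LINT (t, x)|(circle \<Otimes>\<^sub>M torus).
        complex_of_real (f t x) * cis (- (real_vec l \<bullet> x + real_of_int s * t)))
     / complex_of_real ((2 * pi) ^ (CARD('d) + 1))"


subsection \<open>Resonant vectors\<close>

interpretation int_vec: module "(*s) :: int \<Rightarrow> int^'d \<Rightarrow> int^'d"
  by unfold_locales (simp_all add: vec_eq_iff algebra_simps)

text \<open>The cardinalities below are bounded by \<open>d\<close>, so the supremum is a maximum.\<close>

definition int_rank :: "(int^'d) set \<Rightarrow> nat" where
  "int_rank L = Sup {card B | B. B \<subseteq> L \<and> finite B \<and> int_vec.independent B}"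

definition resonance_module :: "real^'d \<Rightarrow> (int^'d) set" where
  "resonance_module \<xi> = {k. real_vec k \<bullet> \<xi> = 0}"

text \<open>Written additively to avoid truncated subtraction: \<open>rk \<Lambda>\<^sub>\<xi> = d - j\<close>, \<open>j \<le> d\<close>.\<close>

definition resonant_vectors :: "nat \<Rightarrow> (real^'d) set" where
  "resonant_vectors j = {\<xi>. int_rank (resonance_module \<xi>) + j = CARD('d)}"


subsection \<open>Wigner distributions\<close>

primrec times_differentiable ::
    "nat \<Rightarrow> ('a::real_normed_vector \<Rightarrow> 'b::real_normed_vector) \<Rightarrow> bool" where
  "times_differentiable 0 f \<longleftrightarrow> continuous_on UNIV f"
| "times_differentiable (Suc n) f \<longleftrightarrow>
     (\<forall>x. f differentiable (at x)) \<and>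
     (\<forall>v. times_differentiable n (\<lambda>x. frechet_derivative f (at x) v))"

definition smooth :: "('a::real_normed_vector \<Rightarrow> 'b::real_normed_vector) \<Rightarrow> bool" where
  "smooth f \<longleftrightarrow> (\<forall>n. times_differentiable n f)"

text \<open>\<open>C\<^sub>c\<^sup>\<infinity>(T\<^sup>d \<times> \<real>\<^sup>d)\<close>: the torus being compact, only the support in \<open>\<xi>\<close> is
  constrained.\<close>

definition test_functions :: "((real^'d) \<times> (real^'d) \<Rightarrow> complex) set" where
  "test_functions =
     {a. smooth a \<and> (\<forall>\<xi>. torus_periodic (\<lambda>x. a (x, \<xi>))) \<and>
         (\<exists>R. \<forall>x \<xi>. norm \<xi> > R \<longrightarrow> a (x, \<xi>) = 0)}"

definition wigner ::
    "real \<Rightarrow> (real^'d \<Rightarrow> complex) \<Rightarrow> ((real^'d) \<times> (real^'d) \<Rightarrow> complex) \<Rightarrow> complex" where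
  "wigner h u a =
     (\<Sum>\<^sub>\<infinity>(k, j). fourier_coeff u k * cnj (fourier_coeff u j) *
        fourier_coeff (\<lambda>x. a (x, (h / 2) *\<^sub>R real_vec (k + j))) (j - k))"

definition phase_space_radon_measure :: "((real^'d) \<times> (real^'d)) measure \<Rightarrow> bool" where
  "phase_space_radon_measure \<mu> \<longleftrightarrow>
     sets \<mu> = sets (torus \<Otimes>\<^sub>M borel) \<and>
     (\<forall>K. compact K \<longrightarrow> emeasure \<mu> (torus_cell \<times> K) < \<infinity>)"

definition wigner_accumulation_point ::
    "(nat \<Rightarrow> real) \<Rightarrow> (nat \<Rightarrow> real^'d \<Rightarrow> complex) \<Rightarrow> ((real^'d) \<times> (real^'d)) measure \<Rightarrow> bool" where
  "wigner_accumulation_point h u \<mu> \<longleftrightarrow>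
     phase_space_radon_measure \<mu> \<and>
     (\<exists>\<sigma>. strict_mono (\<sigma> :: nat \<Rightarrow> nat) \<and>
       (\<forall>a\<in>test_functions.
          (\<lambda>n. wigner (h (\<sigma> n)) (u (\<sigma> n)) a) \<longlonglongrightarrow> (LINT z|\<mu>. a z)))"

end

theory Submission
  imports Defs "HOL-Probability.Helly_Selection"
begin

text \<open>
  Write \<open>c\<^sub>k\<close> for the Fourier coefficients of \<open>u\<^sub>n\<close>, let \<open>Q\<close> bound their square sums, and put \<open>p = d + 1 - r\<close>. The
  Fourier coefficient of \<open>|e\<^bsup>it\<Delta>\<^esup>u\<^sub>n|\<^sup>2\<close> at frequency \<open>(l, s)\<close> is the sum of the products of \<open>c\<^sub>k\<close> with the
  conjugate of \<open>c\<^bsub>k - l\<^esub>\<close> over the lattice points \<open>k\<close> of the hyperplane \<open>2 k \<bullet> l = |l|\<^sup>2 - s\<close>, and the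
  coefficients of \<open>\<nu>\<close> are limits of such sums. It suffices to bound the sum of their \<open>p\<close>-th powers over any finite set
  of frequencies with \<open>l \<noteq> 0\<close> by \<open>(p - 1) Q ^ p\<close>, in the limit; for \<open>l = 0\<close> only the frequency \<open>(0, 0)\<close> contributes.

  The combinatorial core is \<open>autocorrelation_power_sum_le\<close>. Expand the \<open>p\<close>-th power over \<open>p\<close>-tuples of points of one
  hyperplane and suppose that the displacements \<open>l\<close> lie in a space \<open>V\<close> of dimension less than \<open>p\<close>. The hyperplane meets \<open>V\<close> in
  dimension at most \<open>p - 2\<close>, so, after projection to \<open>V\<close>, some point of the tuple lies in the affine hull \<open>A\<close> of its
  predecessors. By the arithmetic-geometric mean inequality the products of coefficients become squares, taken at the starting points of the
  predecessors and at the end point of the dependent one. For given predecessors, the translates \<open>A - l\<close> by different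
  \<open>l\<close> are disjoint, so that the sum over all \<open>l\<close> and all dependent points contributes only one factor \<open>Q\<close>.

  The space \<open>V\<close> comes from the hypothesis on semiclassical measures. For fixed \<open>l\<close>, a point \<open>k\<close> of size \<open>1 / h\<close> on the hyperplane
  satisfies \<open>h k \<bullet> l = O(h)\<close>; let \<open>V\<close> be spanned by the finitely many \<open>l\<close> in question that are almost orthogonal to
  \<open>h k\<close>. If its dimension is at least \<open>p\<close>, then \<open>h k\<close> is close to a vector orthogonal to \<open>p\<close> independent lattice vectors, that is, to an element
  of some \<open>\<Omega>\<^sub>j\<close> with \<open>j < r\<close>. Such modes carry little mass, by \<open>no_concentration_near_resonances\<close>. The space \<open>V\<close> must be the same
  for \<open>k\<close> and \<open>k - l\<close>; this is achieved by choosing the threshold for almost orthogonality, by the pigeonhole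
  principle, where few modes are close to it. The discarded modes, together with those beyond the scale \<open>1 / h\<close>, have small mass
  and hence little influence on the coefficients (\<open>flow_density_coefficient_approx\<close>).

  The hypothesis speaks about all semiclassical measures, so it can only be exploited once their existence is known; this
  is \<open>wigner_accumulation_point_exists\<close>. The Wigner distributions are compared with positive measures, obtained by averaging
  \<open>|\<Sum> c\<^sub>k e\<^bsup>ik\<cdot>x\<^esup>|\<^sup>2\<close> over all boxes of \<open>N\<close> by \<open>\<dots>\<close> by \<open>N\<close> modes, where \<open>N\<close> tends to infinity and
  \<open>h N\<close> to 0. Bounded sequences of positive measures on a bounded set have weakly convergent subsequences, by Helly selection on the
  line and a Cantor-type coding of the set by real numbers.
\<close>

section \<open>Autocorrelation of a weight along hyperplanes\<close>

text \<open>
  A pair \<open>m = (l, s)\<close> encodes a space-time frequency. The points of \<open>chords E m\<close> are the starting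
  points of the pairs \<open>(k, k - l)\<close> in \<open>E\<close> whose interference has this frequency: the equation is
  \<open>|k - l|\<^sup>2 - |k|\<^sup>2 = s\<close>, which confines \<open>k\<close> to a hyperplane orthogonal to \<open>l\<close>.
\<close>

definition chords :: "'a::real_inner set \<Rightarrow> 'a \<times> real \<Rightarrow> 'a set" where
  "chords E m = {k \<in> E. k - fst m \<in> E \<and> 2 * (k \<bullet> fst m) = fst m \<bullet> fst m - snd m}"

text \<open>
  The first point of a tuple is stored last, so that a tuple grows at its head, and this point
  selects the space \<open>V (last ks)\<close>. The transversal is the part of this space orthogonal to all differences of
  points of the tuple: the directions in which the projected tuple can still be translated off itself.
\<close>

definition transversal :: "('a::real_inner \<Rightarrow> 'a set) \<Rightarrow> 'a list \<Rightarrow> 'a set" where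
  "transversal V ks = {v \<in> V (last ks). \<forall>k\<in>set ks. v \<bullet> (k - last ks) = 0}"

text \<open>
  The points whose projection to \<open>V (last ks)\<close> lies in the affine hull of the projected tuple.
\<close>

definition flat :: "('a::real_inner \<Rightarrow> 'a set) \<Rightarrow> 'a list \<Rightarrow> 'a set" where
  "flat V ks = {k. \<forall>v\<in>transversal V ks. v \<bullet> (k - last ks) = 0}"

definition tuples :: "nat \<Rightarrow> 'a set \<Rightarrow> 'a list set" where
  "tuples i E = {ks. set ks \<subseteq> E \<and> length ks = i}"

lemma finite_tuples: "finite E \<Longrightarrow> finite (tuples i E)"
  unfolding tuples_def by (rule finite_lists_length_eq)

lemma tuples_0: "tuples 0 E = {[]}"
  by (auto simp: tuples_def)

lemma tuples_Suc: "tuples (Suc i) E = (\<lambda>(k, ks). k # ks) ` (E \<times> tuples i E)"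
  by (auto simp: tuples_def length_Suc_conv image_iff)

lemma sum_tuples_Suc:
  "(\<Sum>ks\<in>tuples (Suc i) E. f ks) = (\<Sum>ks\<in>tuples i E. \<Sum>k\<in>E. f (k # ks))" for f :: "'a list \<Rightarrow> real"
proof -
  have inj: "inj_on (\<lambda>(k, ks). k # ks) (E \<times> tuples i E)" by (auto simp: inj_on_def)
  have "(\<Sum>ks\<in>tuples (Suc i) E. f ks) = (\<Sum>(k, ks)\<in>E \<times> tuples i E. f (k # ks))"
    unfolding tuples_Suc by (subst sum.reindex[OF inj]) (simp add: case_prod_beta comp_def)
  also have "\<dots> = (\<Sum>k\<in>E. \<Sum>ks\<in>tuples i E. f (k # ks))"
    by (simp add: sum.cartesian_product)
  also have "\<dots> = (\<Sum>ks\<in>tuples i E. \<Sum>k\<in>E. f (k # ks))" by (rule sum.swap)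
  finally show ?thesis .
qed

lemma sum_tuples_prod_list:
  "(\<Sum>ks\<in>tuples i E. prod_list (map f ks)) = (\<Sum>k\<in>E. f k) ^ i" for f :: "'a \<Rightarrow> real"
proof (induction i)
  case (Suc i)
  have "(\<Sum>ks\<in>tuples (Suc i) E. prod_list (map f ks))
      = (\<Sum>ks\<in>tuples i E. (\<Sum>k\<in>E. f k) * prod_list (map f ks))"
    by (simp add: sum_tuples_Suc sum_distrib_right)
  also have "\<dots> = (\<Sum>k\<in>E. f k) * (\<Sum>ks\<in>tuples i E. prod_list (map f ks))"
    by (simp add: sum_distrib_left)
  finally show ?case using Suc by simp
qed (simp add: tuples_0)

lemma finite_chords: "finite E \<Longrightarrow> finite (chords E m)"
  by (simp add: chords_def)

lemma chords_subset: "chords E m \<subseteq> E"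
  by (auto simp: chords_def)

text \<open>
  Exchanging the two ends of a pair replaces the frequency by its opposite.
\<close>

lemma chords_reverse: "chords E (- m) = (\<lambda>k. k - fst m) ` chords E m"
proof -
  obtain l s where m: "m = (l, s)" by fastforce
  have "k \<in> (\<lambda>k. k - l) ` chords E (l, s)" if "k \<in> chords E (- l, - s)" for k
    by (rule image_eqI[of _ _ "k + l"])
      (use that in \<open>auto simp: chords_def inner_add_left inner_add_right inner_commute\<close>)
  then show ?thesis
    by (auto simp: chords_def m inner_diff_left inner_diff_right inner_commute)
qed

lemma subspace_transversal: "subspace (V (last ks)) \<Longrightarrow> subspace (transversal V ks)"
  by (auto simp: transversal_def subspace_def inner_left_distrib)

text \<open>
  All points of the tuple lie in one hyperplane orthogonal to the displacement.
\<close>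

lemma displacement_in_transversal:
  assumes "ks \<in> tuples i (chords E m)" "ks \<noteq> []" "\<forall>k\<in>chords E m. fst m \<in> V k"
  shows "fst m \<in> transversal V ks"
proof -
  have 1: "set ks \<subseteq> chords E m" "last ks \<in> chords E m"
    using assms last_in_set[of ks] by (auto simp: tuples_def)
  have "fst m \<bullet> (k - last ks) = 0" if "k \<in> set ks" for k
    using that 1 by (auto simp: chords_def inner_diff_right inner_commute subset_iff)
  with 1 assms(3) show ?thesis by (auto simp: transversal_def)
qed

text \<open>
  A transversal vector is orthogonal to the flat, so two different transversal translates of the
  flat are parallel and disjoint. This disjointness is what makes the sum over all displacements cheap.
\<close>

lemma flat_translate_unique:
  assumes V: "subspace (V (last ks))"
    and "l \<in> transversal V ks" "l' \<in> transversal V ks"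
    and "k \<in> flat V ks" "k' \<in> flat V ks" and eq: "k - l = k' - l'"
  shows "l = l'"
proof -
  have d: "l - l' \<in> transversal V ks"
    using subspace_transversal[of V ks] assms by (simp add: subspace_diff)
  have "l - l' = (k - last ks) - (k' - last ks)"
    using eq by (metis (no_types, lifting) add.commute add_diff_cancel_left' diff_add_cancel diff_diff_eq2)
  moreover have "(l - l') \<bullet> (k - last ks) = 0" "(l - l') \<bullet> (k' - last ks) = 0"
    using d assms(4,5) by (auto simp: flat_def)
  ultimately have "(l - l') \<bullet> (l - l') = 0" by (metis diff_0_right inner_diff_right)
  then show ?thesis by simp
qed

lemma dim_transversal_Cons:
  fixes V :: "'a::euclidean_space \<Rightarrow> 'a set"
  assumes V: "subspace (V (last ks))" and "ks \<noteq> []" and "k \<notin> flat V ks"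
  shows "dim (transversal V (k # ks)) < dim (transversal V ks)"
proof -
  have sub: "transversal V (k # ks) \<subseteq> transversal V ks"
    using assms(2) by (auto simp: transversal_def)
  obtain v where v: "v \<in> transversal V ks" "v \<bullet> (k - last ks) \<noteq> 0"
    using assms(3) by (auto simp: flat_def)
  have "v \<notin> transversal V (k # ks)" using v assms(2) by (auto simp: transversal_def)
  then have "transversal V (k # ks) \<noteq> transversal V ks" using v by auto
  moreover have "subspace (transversal V (k # ks))" "subspace (transversal V ks)"
    using subspace_transversal[of V "k # ks"] subspace_transversal[of V ks] V assms(2) by auto
  ultimately show ?thesis
    using sub subspace_dim_equal[of "transversal V (k # ks)" "transversal V ks"] dim_subset[OF sub]
    by fastforce
qed

text \<open>
  Every point of a generic tuple enlarges the flat of the points before it.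
\<close>

fun generic :: "('a::real_inner \<Rightarrow> 'a set) \<Rightarrow> 'a list \<Rightarrow> bool" where
  "generic V [] = True"
| "generic V [k] = True"
| "generic V (k # k' # ks) = (k \<notin> flat V (k' # ks) \<and> generic V (k' # ks))"

lemma generic_Cons: "ks \<noteq> [] \<Longrightarrow> generic V (k # ks) \<longleftrightarrow> k \<notin> flat V ks \<and> generic V ks"
  by (cases ks) auto

text \<open>
  Each new generic point uses up one dimension of the transversal. A transversal that still contains a
  displacement therefore bounds the length of a generic tuple.
\<close>

lemma generic_dim:
  fixes V :: "'a::euclidean_space \<Rightarrow> 'a set"
  assumes "generic V ks" "ks \<noteq> []" "subspace (V (last ks))" "dim (V (last ks)) < p"
  shows "dim (transversal V ks) + length ks \<le> p"
  using assms
proof (induction ks)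
  case (Cons k ks)
  show ?case
  proof (cases "ks = []")
    case True
    have "transversal V [k] \<subseteq> V k" by (auto simp: transversal_def)
    then have "dim (transversal V [k]) \<le> dim (V k)" by (rule dim_subset)
    then show ?thesis using Cons.prems True by auto
  next
    case False
    have "dim (transversal V (k # ks)) < dim (transversal V ks)"
      by (rule dim_transversal_Cons) (use Cons.prems False in \<open>auto simp: generic_Cons\<close>)
    moreover have "dim (transversal V ks) + length ks \<le> p"
      using Cons False by (auto simp: generic_Cons)
    ultimately show ?thesis by simp
  qed
qed auto

text \<open>
  Fix the tuple. If \<open>k\<close> lies in its flat, then \<open>k - fst m\<close> determines the displacement, by
  \<open>flat_translate_unique\<close>, and the hyperplane through the tuple then determines the frequency. So the
  sum over \<open>m\<close> and \<open>k\<close> together meets each point of \<open>E\<close> at most once.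
\<close>

lemma degenerate_sum_le:
  fixes E :: "'a::euclidean_space set" and g :: "'a \<Rightarrow> real"
  assumes E: "finite E" and M: "finite M" and i: "0 < i"
    and V: "\<And>k. k \<in> E \<Longrightarrow> subspace (V k)"
    and VM: "\<And>m k. m \<in> M \<Longrightarrow> k \<in> chords E m \<Longrightarrow> fst m \<in> V k"
  shows "(\<Sum>m\<in>M. \<Sum>ks\<in>tuples i (chords E m). \<Sum>k\<in>chords E m \<inter> flat V ks.
            prod_list (map (\<lambda>k. (g k)\<^sup>2) ks) * (g (k - fst m))\<^sup>2) \<le> (\<Sum>k\<in>E. (g k)\<^sup>2) ^ (i + 1)"
    (is "?L \<le> ?Q ^ _")
proof -
  let ?W = "\<lambda>ks. prod_list (map (\<lambda>k. (g k)\<^sup>2) ks)"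
  let ?P = "\<lambda>ks. {(m, k). m \<in> M \<and> ks \<in> tuples i (chords E m) \<and> k \<in> chords E m \<inter> flat V ks}"
  have sub: "tuples i (chords E m) \<subseteq> tuples i E" for m
    using chords_subset[of E m] by (auto simp: tuples_def)
  have restr: "(\<Sum>ks\<in>tuples i (chords E m). f ks)
      = (\<Sum>ks\<in>tuples i E. if ks \<in> tuples i (chords E m) then f ks else 0)" for m f
    using sub[of m] finite_tuples[OF E, of i] by (simp add: sum.inter_restrict[symmetric] Int_absorb1)
  have finP: "finite (?P ks)" for ks
    by (rule finite_subset[of _ "M \<times> E"]) (use E M chords_subset in \<open>auto simp: chords_def\<close>)
  have W0: "0 \<le> ?W ks" for ks by (induction ks) auto
  have "?L = (\<Sum>m\<in>M. \<Sum>ks\<in>tuples i E. if ks \<in> tuples i (chords E m) then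
            \<Sum>k\<in>chords E m \<inter> flat V ks. ?W ks * (g (k - fst m))\<^sup>2 else 0)"
    by (intro sum.cong refl restr)
  also have "\<dots> = (\<Sum>ks\<in>tuples i E. \<Sum>m\<in>M. if ks \<in> tuples i (chords E m) then
            \<Sum>k\<in>chords E m \<inter> flat V ks. ?W ks * (g (k - fst m))\<^sup>2 else 0)"
    by (rule sum.swap)
  also have "\<dots> = (\<Sum>ks\<in>tuples i E. ?W ks * (\<Sum>(m, k)\<in>?P ks. (g (k - fst m))\<^sup>2))"
  proof (rule sum.cong[OF refl])
    fix ks
    have "?P ks = Sigma {m \<in> M. ks \<in> tuples i (chords E m)} (\<lambda>m. chords E m \<inter> flat V ks)" by auto
    then have "(\<Sum>(m, k)\<in>?P ks. (g (k - fst m))\<^sup>2)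
        = (\<Sum>m\<in>{m \<in> M. ks \<in> tuples i (chords E m)}. \<Sum>k\<in>chords E m \<inter> flat V ks. (g (k - fst m))\<^sup>2)"
      using M finite_chords[OF E] by (simp add: sum.Sigma)
    then show "(\<Sum>m\<in>M. if ks \<in> tuples i (chords E m) then
            \<Sum>k\<in>chords E m \<inter> flat V ks. ?W ks * (g (k - fst m))\<^sup>2 else 0)
        = ?W ks * (\<Sum>(m, k)\<in>?P ks. (g (k - fst m))\<^sup>2)"
      using M by (auto simp: sum_distrib_left sum.inter_filter intro!: sum.cong)
  qed
  also have "\<dots> \<le> (\<Sum>ks\<in>tuples i E. ?W ks * ?Q)"
  proof (intro sum_mono mult_left_mono W0)
    fix ks assume ks: "ks \<in> tuples i E"
    then have ne: "ks \<noteq> []" using i by (auto simp: tuples_def)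
    then have last: "last ks \<in> E" using ks last_in_set[OF ne] by (auto simp: tuples_def)
    have inj: "inj_on (\<lambda>(m, k). k - fst m) (?P ks)"
    proof (rule inj_onI)
      fix a b assume a: "a \<in> ?P ks" and b: "b \<in> ?P ks"
        and ab: "(case a of (m, k) \<Rightarrow> k - fst m) = (case b of (m, k) \<Rightarrow> k - fst m)"
      obtain l s k l' s' k' where [simp]: "a = ((l, s), k)" "b = ((l', s'), k')"
        by (metis surj_pair)
      have 1: "(l, s) \<in> M" "ks \<in> tuples i (chords E (l, s))" "k \<in> chords E (l, s)" "k \<in> flat V ks"
        and 2: "(l', s') \<in> M" "ks \<in> tuples i (chords E (l', s'))" "k' \<in> chords E (l', s')" "k' \<in> flat V ks"
        and eq: "k - fst (l, s) = k' - fst (l', s')"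
        using a b ab by auto
      have "l \<in> transversal V ks" "l' \<in> transversal V ks"
        using displacement_in_transversal[OF 1(2) ne] displacement_in_transversal[OF 2(2) ne]
          VM[OF 1(1)] VM[OF 2(1)] by auto
      then have l: "l = l'"
        using flat_translate_unique[of V ks l l' k k'] V[OF last] 1(4) 2(4) eq by simp
      have "last ks \<in> chords E (l, s)" "last ks \<in> chords E (l', s')"
        using 1(2) 2(2) last_in_set[OF ne] by (auto simp: tuples_def)
      then have "s = s'" using l by (auto simp: chords_def)
      then show "a = b" using l eq by simp
    qed
    have "(\<Sum>(m, k)\<in>?P ks. (g (k - fst m))\<^sup>2) = (\<Sum>q\<in>(\<lambda>(m, k). k - fst m) ` ?P ks. (g q)\<^sup>2)"
      by (subst sum.reindex[OF inj]) (auto simp: case_prod_beta intro!: sum.cong)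
    also have "\<dots> \<le> ?Q"
      by (rule sum_mono2[OF E]) (auto simp: chords_def)
    finally show "(\<Sum>(m, k)\<in>?P ks. (g (k - fst m))\<^sup>2) \<le> ?Q" .
  qed
  also have "\<dots> = ?Q ^ (i + 1)"
    by (simp add: sum_distrib_right[symmetric] sum_tuples_prod_list)
  finally show ?thesis .
qed

text \<open>
  The arithmetic-geometric mean inequality splits the product over the tuple and \<open>k\<close> into a part with
  squares at the starting points of the tuple and at the end point of \<open>k\<close>, and the same part with the two ends exchanged.
  Both are instances of \<open>degenerate_sum_le\<close>, the second one for the opposite frequencies. Since the two
  ends must be on an equal footing, \<open>V\<close> has to agree at both.
\<close>

lemma degenerate_part_le:
  fixes E :: "'a::euclidean_space set" and g :: "'a \<Rightarrow> real"
  assumes E: "finite E" and M: "finite M" and i: "0 < i"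
    and V: "\<And>k. k \<in> E \<Longrightarrow> subspace (V k)"
    and VM: "\<And>m k. m \<in> M \<Longrightarrow> k \<in> chords E m \<Longrightarrow> fst m \<in> V k \<and> V (k - fst m) = V k"
  shows "(\<Sum>m\<in>M. \<Sum>ks\<in>tuples i (chords E m). \<Sum>k\<in>chords E m \<inter> flat V ks.
            prod_list (map (\<lambda>k. g k * g (k - fst m)) ks) * (g k * g (k - fst m)))
         \<le> (\<Sum>k\<in>E. (g k)\<^sup>2) ^ (i + 1)"
    (is "?L \<le> ?Q ^ _")
proof -
  let ?A = "\<lambda>m ks k. prod_list (map (\<lambda>k. (g k)\<^sup>2) ks) * (g (k - fst m))\<^sup>2"
  let ?B = "\<lambda>m ks k. prod_list (map (\<lambda>k. (g (k - fst m))\<^sup>2) ks) * (g k)\<^sup>2"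
  let ?S = "\<lambda>M f. \<Sum>m\<in>M. \<Sum>ks\<in>tuples i (chords E m). \<Sum>k\<in>chords E m \<inter> flat V ks. f m ks k"
  have amgm: "prod_list (map (\<lambda>k. g k * g (k - fst m)) ks) * (g k * g (k - fst m))
      \<le> (?A m ks k + ?B m ks k) / 2" for m ks k
  proof -
    have sq: "prod_list (map (\<lambda>k. (f k)\<^sup>2) ks) = (prod_list (map f ks))\<^sup>2" for f :: "'a \<Rightarrow> real"
      by (induction ks) (auto simp: power2_eq_square)
    have pr: "prod_list (map (\<lambda>k. g k * g (k - fst m)) ks)
        = prod_list (map g ks) * prod_list (map (\<lambda>k. g (k - fst m)) ks)"
      by (induction ks) auto
    have "0 \<le> (prod_list (map g ks) * g (k - fst m) - prod_list (map (\<lambda>k. g (k - fst m)) ks) * g k)\<^sup>2"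
      by simp
    then show ?thesis unfolding sq pr by (simp add: power2_eq_square algebra_simps)
  qed
  have Vq: "V (k - fst m) = V k" if "m \<in> M" "k \<in> chords E m" for m k
    using VM that by blast
  \<comment> \<open>Renaming every point to the other end of its pair turns the second part into the first one.\<close>
  have rev: "?S M ?B = ?S (uminus ` M) ?A"
  proof -
    have "?S (uminus ` M) ?A
        = (\<Sum>m\<in>M. \<Sum>ks\<in>tuples i (chords E (- m)). \<Sum>k\<in>chords E (- m) \<inter> flat V ks. ?A (- m) ks k)"
      by (subst sum.reindex) (auto simp: inj_on_def)
    also have "\<dots> = ?S M ?B"
    proof (rule sum.cong[OF refl])
      fix m assume m: "m \<in> M"
      let ?t = "\<lambda>k. k - fst m"
      have tup: "tuples i (chords E (- m)) = map ?t ` tuples i (chords E m)"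
      proof -
        have "ks \<in> map ?t ` tuples i (chords E m)" if "ks \<in> tuples i (?t ` chords E m)" for ks
        proof (rule image_eqI[of _ _ "map (\<lambda>k. k + fst m) ks"])
          show "ks = map ?t (map (\<lambda>k. k + fst m) ks)" by (simp add: comp_def)
          show "map (\<lambda>k. k + fst m) ks \<in> tuples i (chords E m)"
            using that by (auto simp: tuples_def subset_iff)
        qed
        then have "tuples i (?t ` chords E m) \<subseteq> map ?t ` tuples i (chords E m)" by blast
        moreover have "map ?t ` tuples i (chords E m) \<subseteq> tuples i (?t ` chords E m)"
          by (force simp: tuples_def)
        ultimately show ?thesis unfolding chords_reverse by blast
      qed
      have injm: "inj_on (map ?t) (tuples i (chords E m))"
        by (auto simp: inj_on_def inj_map_eq_map intro: map_inj_on)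
      have flat: "k - fst m \<in> flat V (map ?t ks) \<longleftrightarrow> k \<in> flat V ks"
        if "ks \<in> tuples i (chords E m)" for k ks
      proof -
        have ne: "ks \<noteq> []" using that i by (auto simp: tuples_def)
        then have "last ks \<in> chords E m" using that last_in_set[OF ne] by (auto simp: tuples_def)
        then have "V (last ks - fst m) = V (last ks)" using Vq[OF m] by simp
        then have "transversal V (map ?t ks) = transversal V ks"
          using ne by (simp add: transversal_def last_map)
        then show ?thesis using ne by (simp add: flat_def last_map)
      qed
      have "(\<Sum>ks\<in>tuples i (chords E (- m)). \<Sum>k\<in>chords E (- m) \<inter> flat V ks. ?A (- m) ks k)
          = (\<Sum>ks\<in>tuples i (chords E m). \<Sum>k\<in>chords E (- m) \<inter> flat V (map ?t ks). ?A (- m) (map ?t ks) k)"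
        unfolding tup by (subst sum.reindex[OF injm]) simp
      also have "\<dots> = (\<Sum>ks\<in>tuples i (chords E m). \<Sum>k\<in>chords E m \<inter> flat V ks. ?B m ks k)"
      proof (rule sum.cong[OF refl])
        fix ks assume ks: "ks \<in> tuples i (chords E m)"
        have "chords E (- m) \<inter> flat V (map ?t ks) = ?t ` (chords E m \<inter> flat V ks)"
          unfolding chords_reverse using flat[OF ks] by auto
        then show "(\<Sum>k\<in>chords E (- m) \<inter> flat V (map ?t ks). ?A (- m) (map ?t ks) k)
            = (\<Sum>k\<in>chords E m \<inter> flat V ks. ?B m ks k)"
          by (simp add: sum.reindex inj_on_def comp_def)
      qed
      finally show "(\<Sum>ks\<in>tuples i (chords E (- m)). \<Sum>k\<in>chords E (- m) \<inter> flat V ks. ?A (- m) ks k)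
          = (\<Sum>ks\<in>tuples i (chords E m). \<Sum>k\<in>chords E m \<inter> flat V ks. ?B m ks k)" .
    qed
    finally show ?thesis by simp
  qed
  have VM': "fst m \<in> V k" if mM: "m \<in> uminus ` M" and km: "k \<in> chords E m" for m k
  proof -
    obtain m' where m': "m' \<in> M" "m = - m'" using mM by blast
    then obtain k' where k': "k' \<in> chords E m'" "k = k' - fst m'"
      using km chords_reverse[of E m'] by auto
    have "fst m' \<in> V k" "k' \<in> E" using VM[OF m'(1) k'(1)] k' by (auto simp: chords_def)
    moreover have "k \<in> E" using km by (auto simp: chords_def)
    ultimately show ?thesis using V[of k] m' by (simp add: subspace_neg)
  qed
  have "?L \<le> ?S M (\<lambda>m ks k. (?A m ks k + ?B m ks k) / 2)"
    by (intro sum_mono amgm)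
  also have "\<dots> = (?S M ?A + ?S M ?B) / 2"
    by (simp add: sum_divide_distrib[symmetric] sum.distrib)
  also have "?S M ?A \<le> ?Q ^ (i + 1)"
    by (rule degenerate_sum_le) (use assms in auto)
  also have "?S M ?B \<le> ?Q ^ (i + 1)"
    unfolding rev by (rule degenerate_sum_le) (use assms VM' in auto)
  finally show ?thesis by simp
qed

text \<open>
  Multiply the sum over generic tuples by one more factor and sort the new point: either it keeps
  the tuple generic or it falls into the flat. In the latter case all remaining factors are estimated by \<open>Q\<close>.
\<close>

lemma power_sum_le_degenerate:
  fixes E :: "'a::euclidean_space set" and w :: "'a \<Rightarrow> real"
  assumes T: "finite T" and w: "\<And>k. k \<in> T \<Longrightarrow> 0 \<le> w k" and Q: "sum w T \<le> Q"
    and j: "1 \<le> j"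
  shows "(\<Sum>k\<in>T. w k) ^ j \<le>
           (\<Sum>ks\<in>{ks\<in>tuples j T. generic V ks}. prod_list (map w ks))
         + (\<Sum>i=1..<j. Q ^ (j - 1 - i) * (\<Sum>ks\<in>tuples i T. \<Sum>k\<in>T \<inter> flat V ks. prod_list (map w ks) * w k))"
  using j
proof (induction j rule: nat_induct_at_least)
  case base
  have "{ks\<in>tuples 1 T. generic V ks} = tuples 1 T" by (auto simp: tuples_def length_Suc_conv)
  then show ?case using sum_tuples_prod_list[of w 1 T] by simp
next
  case (Suc j)
  let ?S = "sum w T"
  let ?G = "\<lambda>j. \<Sum>ks\<in>{ks\<in>tuples j T. generic V ks}. prod_list (map w ks)"
  let ?D = "\<lambda>i. \<Sum>ks\<in>tuples i T. \<Sum>k\<in>T \<inter> flat V ks. prod_list (map w ks) * w k"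
  have S0: "0 \<le> ?S" by (rule sum_nonneg) (rule w)
  have W0: "0 \<le> prod_list (map w ks)" if "ks \<in> tuples i T" for ks i
    using that w by (auto simp: tuples_def subset_iff intro!: prod_list_nonneg)
  have D0: "0 \<le> ?D i" for i by (intro sum_nonneg mult_nonneg_nonneg) (use W0 w in auto)
  have fin: "finite (tuples j T)" using T by (rule finite_tuples)
  have ne: "ks \<noteq> []" if "ks \<in> tuples j T" for ks using that Suc by (auto simp: tuples_def)
  \<comment> \<open>Sort the additional point according to whether it lies in the flat of the tuple.\<close>
  have step: "?S * ?G j \<le> ?G (Suc j) + ?D j"
  proof -
    have "?S * ?G j = (\<Sum>ks\<in>{ks\<in>tuples j T. generic V ks}. \<Sum>k\<in>T. prod_list (map w ks) * w k)"
      by (simp add: sum_distrib_left sum_distrib_right mult.commute)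
    also have "\<dots> = (\<Sum>ks\<in>{ks\<in>tuples j T. generic V ks}.
        (\<Sum>k\<in>T \<inter> flat V ks. prod_list (map w ks) * w k) + (\<Sum>k\<in>T - flat V ks. prod_list (map w ks) * w k))"
    proof (rule sum.cong[OF refl])
      fix ks
      show "(\<Sum>k\<in>T. prod_list (map w ks) * w k)
          = (\<Sum>k\<in>T \<inter> flat V ks. prod_list (map w ks) * w k) + (\<Sum>k\<in>T - flat V ks. prod_list (map w ks) * w k)"
        using T by (rule sum.Int_Diff)
    qed
    also have "\<dots> = (\<Sum>ks\<in>{ks\<in>tuples j T. generic V ks}. \<Sum>k\<in>T \<inter> flat V ks. prod_list (map w ks) * w k)
        + (\<Sum>ks\<in>{ks\<in>tuples j T. generic V ks}. \<Sum>k\<in>T - flat V ks. prod_list (map w ks) * w k)"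
      by (rule sum.distrib)
    also have "(\<Sum>ks\<in>{ks\<in>tuples j T. generic V ks}. \<Sum>k\<in>T \<inter> flat V ks. prod_list (map w ks) * w k) \<le> ?D j"
      by (rule sum_mono2[OF fin]) (use W0 w in \<open>auto intro!: sum_nonneg mult_nonneg_nonneg\<close>)
    also have "(\<Sum>ks\<in>{ks\<in>tuples j T. generic V ks}. \<Sum>k\<in>T - flat V ks. prod_list (map w ks) * w k) = ?G (Suc j)"
    proof -
      have "?G (Suc j) = (\<Sum>ks\<in>tuples (Suc j) T. if generic V ks then prod_list (map w ks) else 0)"
        using T by (simp add: sum.inter_filter finite_tuples)
      also have "\<dots> = (\<Sum>ks\<in>tuples j T. if generic V ks then \<Sum>k\<in>T - flat V ks. prod_list (map w ks) * w k else 0)"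
        unfolding sum_tuples_Suc
      proof (rule sum.cong[OF refl])
        fix ks assume "ks \<in> tuples j T"
        then have "ks \<noteq> []" by (rule ne)
        then have "(\<Sum>k\<in>T. if generic V (k # ks) then prod_list (map w (k # ks)) else 0)
          = (\<Sum>k\<in>T. if k \<notin> flat V ks then (if generic V ks then prod_list (map w ks) * w k else 0) else 0)"
          by (intro sum.cong) (auto simp: generic_Cons)
        also have "\<dots> = (\<Sum>k\<in>T - flat V ks. if generic V ks then prod_list (map w ks) * w k else 0)"
          using T by (simp add: sum.inter_filter[symmetric] set_diff_eq)
        finally show "(\<Sum>k\<in>T. if generic V (k # ks) then prod_list (map w (k # ks)) else 0)
            = (if generic V ks then \<Sum>k\<in>T - flat V ks. prod_list (map w ks) * w k else 0)"
          by simp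
      qed
      finally show ?thesis using fin by (simp add: sum.inter_filter)
    qed
    finally show ?thesis by simp
  qed
  have "?S ^ Suc j = ?S * ?S ^ j" by simp
  also have "\<dots> \<le> ?S * (?G j + (\<Sum>i=1..<j. Q ^ (j - 1 - i) * ?D i))"
    by (rule mult_left_mono[OF Suc.IH S0])
  also have "\<dots> = ?S * ?G j + ?S * (\<Sum>i=1..<j. Q ^ (j - 1 - i) * ?D i)"
    by (simp add: algebra_simps)
  also have "\<dots> \<le> (?G (Suc j) + ?D j) + Q * (\<Sum>i=1..<j. Q ^ (j - 1 - i) * ?D i)"
    by (intro add_mono step mult_right_mono Q sum_nonneg mult_nonneg_nonneg zero_le_power D0)
      (use S0 Q in linarith)
  also have "Q * (\<Sum>i=1..<j. Q ^ (j - 1 - i) * ?D i) = (\<Sum>i=1..<j. Q ^ (j - i) * ?D i)"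
    unfolding sum_distrib_left[of Q "\<lambda>i. Q ^ (j - 1 - i) * ?D i"]
  proof (rule sum.cong[OF refl])
    fix i assume "i \<in> {1..<j}"
    then have "j - i = Suc (j - 1 - i)" by auto
    then show "Q * (Q ^ (j - 1 - i) * ?D i) = Q ^ (j - i) * ?D i" by simp
  qed
  also have "(?G (Suc j) + ?D j) + \<dots> = ?G (Suc j) + (\<Sum>i=1..<Suc j. Q ^ (Suc j - 1 - i) * ?D i)"
    using Suc by simp
  finally show ?case .
qed

text \<open>
  Since the displacement lies in the transversal, \<open>generic_dim\<close> leaves no generic tuple of length \<open>p\<close>
  on the hyperplane, so that only the \<open>p - 1\<close> degenerate terms of \<open>power_sum_le_degenerate\<close> remain. The
  bound does not depend on the number of frequencies.
\<close>

theorem autocorrelation_power_sum_le: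
  fixes E :: "'a::euclidean_space set" and g :: "'a \<Rightarrow> real"
  assumes E: "finite E" and M: "finite M" and p: "1 \<le> p" and g: "\<And>k. 0 \<le> g k"
    and M0: "\<And>m. m \<in> M \<Longrightarrow> fst m \<noteq> 0"
    and V: "\<And>k. k \<in> E \<Longrightarrow> subspace (V k) \<and> dim (V k) < p"
    and VM: "\<And>m k. m \<in> M \<Longrightarrow> k \<in> chords E m \<Longrightarrow> fst m \<in> V k \<and> V (k - fst m) = V k"
  shows "(\<Sum>m\<in>M. (\<Sum>k\<in>chords E m. g k * g (k - fst m)) ^ p) \<le> (real p - 1) * (\<Sum>k\<in>E. (g k)\<^sup>2) ^ p"
proof -
  let ?Q = "\<Sum>k\<in>E. (g k)\<^sup>2"
  let ?w = "\<lambda>m k. g k * g (k - fst m)"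
  let ?D = "\<lambda>i m. \<Sum>ks\<in>tuples i (chords E m). \<Sum>k\<in>chords E m \<inter> flat V ks. prod_list (map (?w m) ks) * ?w m k"
  have Q0: "0 \<le> ?Q" by (simp add: sum_nonneg)
  \<comment> \<open>Both ends of the pairs run through distinct points of \<open>E\<close>.\<close>
  have bd: "(\<Sum>k\<in>chords E m. ?w m k) \<le> ?Q" for m
  proof -
    have "(\<Sum>k\<in>chords E m. ?w m k) \<le> (\<Sum>k\<in>chords E m. ((g k)\<^sup>2 + (g (k - fst m))\<^sup>2) / 2)"
    proof (rule sum_mono)
      fix k
      have "0 \<le> (g k - g (k - fst m))\<^sup>2" by simp
      then show "?w m k \<le> ((g k)\<^sup>2 + (g (k - fst m))\<^sup>2) / 2"
        by (simp add: power2_eq_square algebra_simps)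
    qed
    also have "\<dots> = ((\<Sum>k\<in>chords E m. (g k)\<^sup>2) + (\<Sum>k\<in>chords E m. (g (k - fst m))\<^sup>2)) / 2"
      by (simp add: sum_divide_distrib[symmetric] sum.distrib)
    also have "(\<Sum>k\<in>chords E m. (g k)\<^sup>2) \<le> ?Q"
      by (rule sum_mono2[OF E chords_subset]) simp
    also have "(\<Sum>k\<in>chords E m. (g (k - fst m))\<^sup>2) = (\<Sum>k\<in>(\<lambda>k. k - fst m) ` chords E m. (g k)\<^sup>2)"
      by (simp add: sum.reindex inj_on_def)
    also have "\<dots> \<le> ?Q"
      by (rule sum_mono2[OF E]) (auto simp: chords_def)
    finally show ?thesis by simp
  qed
  have none: "{ks \<in> tuples p (chords E m). generic V ks} = {}" if m: "m \<in> M" for m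
  proof (rule ccontr)
    assume "{ks \<in> tuples p (chords E m). generic V ks} \<noteq> {}"
    then obtain ks where ks: "ks \<in> tuples p (chords E m)" "generic V ks" by blast
    then have ne: "ks \<noteq> []" using p by (auto simp: tuples_def)
    have "last ks \<in> E" using ks last_in_set[OF ne] chords_subset[of E m] by (auto simp: tuples_def)
    then have sub: "subspace (V (last ks))" "dim (V (last ks)) < p" using V by auto
    have "dim (transversal V ks) = 0"
      using generic_dim[OF ks(2) ne sub] ks by (simp add: tuples_def)
    moreover have "fst m \<in> transversal V ks"
      by (rule displacement_in_transversal[OF ks(1) ne]) (use VM m in blast)
    ultimately show False using M0[OF m] by auto
  qed
  have "(\<Sum>m\<in>M. (\<Sum>k\<in>chords E m. ?w m k) ^ p) \<le> (\<Sum>m\<in>M. \<Sum>i=1..<p. ?Q ^ (p - 1 - i) * ?D i m)"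
  proof (rule sum_mono)
    fix m assume m: "m \<in> M"
    show "(\<Sum>k\<in>chords E m. ?w m k) ^ p \<le> (\<Sum>i=1..<p. ?Q ^ (p - 1 - i) * ?D i m)"
      using power_sum_le_degenerate[of "chords E m" "?w m" ?Q p V, OF finite_chords[OF E] _ bd p]
        none[OF m] g by simp
  qed
  also have "\<dots> = (\<Sum>i=1..<p. ?Q ^ (p - 1 - i) * (\<Sum>m\<in>M. ?D i m))"
    by (subst sum.swap) (simp add: sum_distrib_left)
  also have "\<dots> \<le> (\<Sum>i=1..<p. ?Q ^ (p - 1 - i) * ?Q ^ (i + 1))"
    by (intro sum_mono mult_left_mono zero_le_power Q0 degenerate_part_le[OF E M])
      (use V VM in auto)
  also have "\<dots> = (\<Sum>i=1..<p. ?Q ^ p)"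
    by (rule sum.cong) (simp_all add: power_add[symmetric] del: power_Suc)
  also have "\<dots> = (real p - 1) * ?Q ^ p" using p by simp
  finally show ?thesis .
qed

section \<open>Weak compactness of measures on a bounded set\<close>

text \<open>
  The digits 0 and 2 place the code in the middle-thirds Cantor set, where close codes share their
  leading digits.
\<close>

definition ternary_code :: "(nat \<Rightarrow> 'a set) \<Rightarrow> 'a \<Rightarrow> real" where
  "ternary_code B x = (\<Sum>j. 2 * indicator (B j) x * (1 / 3) ^ Suc j)"

lemma ternary_summable: "summable (\<lambda>j. 2 * indicator (B j) x * (1 / 3 :: real) ^ Suc j)"
  by (rule summable_comparison_test'[of "\<lambda>j. 2 * (1 / 3 :: real) ^ Suc j" 0])
    (auto simp: summable_mult summable_Suc_iff summable_geometric indicator_def simp del: power_Suc)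

lemma ternary_code_bounds: "0 \<le> ternary_code B x" "ternary_code B x \<le> 1"
proof -
  show "0 \<le> ternary_code B x" unfolding ternary_code_def by (rule suminf_nonneg[OF ternary_summable]) auto
  have s: "(\<lambda>j. 2 * (1 / 3 :: real) ^ Suc j) sums 1"
    using sums_mult[OF geometric_sums[of "1/3 :: real"], of "2/3"] by simp
  have "ternary_code B x \<le> (\<Sum>j. 2 * (1 / 3 :: real) ^ Suc j)"
    unfolding ternary_code_def
    by (rule suminf_le[OF _ ternary_summable]) (use s in \<open>auto simp: indicator_def sums_iff\<close>)
  also have "\<dots> = 1" using s by (simp add: sums_iff)
  finally show "ternary_code B x \<le> 1" .
qed

text \<open>
  The first differing digit outweighs all later ones, which add up to at most half of it.
\<close>

lemma ternary_code_separates: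
  assumes "x \<in> B j" "y \<notin> B j" and agree: "\<And>i. i < j \<Longrightarrow> x \<in> B i \<longleftrightarrow> y \<in> B i"
  shows "(1 / 3) ^ Suc j \<le> ternary_code B x - ternary_code B y"
proof -
  define a where "a i = 2 * (indicator (B i) x - indicator (B i) y) * (1 / 3 :: real) ^ Suc i" for i
  have a: "a i = 2 * indicator (B i) x * (1 / 3) ^ Suc i - 2 * indicator (B i) y * (1 / 3) ^ Suc i" for i
    by (simp add: a_def algebra_simps)
  have sa: "summable a" unfolding a by (intro summable_diff ternary_summable)
  have "ternary_code B x - ternary_code B y = suminf a"
    unfolding ternary_code_def a by (rule suminf_diff) (rule ternary_summable)+
  also have "\<dots> = (\<Sum>i. a (i + Suc j)) + (\<Sum>i<Suc j. a i)"
    by (rule suminf_split_initial_segment[OF sa])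
  also have "(\<Sum>i<Suc j. a i) = 2 * (1 / 3) ^ Suc j"
  proof -
    have "(\<Sum>i<j. a i) = 0" by (rule sum.neutral) (use agree in \<open>auto simp: a_def indicator_def\<close>)
    then show ?thesis using assms by (simp add: a_def)
  qed
  finally have eq: "ternary_code B x - ternary_code B y = (\<Sum>i. a (i + Suc j)) + 2 * (1 / 3) ^ Suc j" .
  have s: "(\<lambda>i. 2 * (1 / 3 :: real) ^ Suc (i + Suc j)) sums (1 / 3) ^ Suc j"
    using sums_mult[OF geometric_sums[of "1/3 :: real"], of "2 * (1 / 3) ^ Suc (Suc j)"]
    by (simp add: power_add mult_ac)
  have "- (\<Sum>i. a (i + Suc j)) = (\<Sum>i. - a (i + Suc j))"
    using sa by (simp add: suminf_minus summable_iff_shift del: add_Suc_right)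
  also have "\<dots> \<le> (\<Sum>i. 2 * (1 / 3 :: real) ^ Suc (i + Suc j))"
  proof (rule suminf_le)
    show "- a (i + Suc j) \<le> 2 * (1 / 3) ^ Suc (i + Suc j)" for i
      by (auto simp: a_def indicator_def)
    show "summable (\<lambda>i. - a (i + Suc j))"
      using sa by (simp add: summable_minus_iff summable_iff_shift del: add_Suc_right)
  qed (use s in \<open>auto simp: sums_iff\<close>)
  also have "\<dots> = (1 / 3) ^ Suc j" using s by (simp add: sums_iff)
  finally show ?thesis using eq by simp
qed

lemma ternary_code_agree:
  assumes "\<bar>ternary_code B x - ternary_code B y\<bar> < (1 / 3) ^ J" and "j < J"
  shows "x \<in> B j \<longleftrightarrow> y \<in> B j"
proof (rule ccontr)
  let ?P = "\<lambda>j. \<not> (x \<in> B j \<longleftrightarrow> y \<in> B j)"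
  assume "?P j"
  define i where "i = (LEAST j. ?P j)"
  have i: "?P i" "i \<le> j" unfolding i_def using \<open>?P j\<close> by (rule LeastI, rule Least_le)
  have min: "x \<in> B k \<longleftrightarrow> y \<in> B k" if "k < i" for k
    using not_less_Least[of k ?P] that unfolding i_def by blast
  have "(1 / 3) ^ Suc i \<le> \<bar>ternary_code B x - ternary_code B y\<bar>"
  proof (cases "x \<in> B i")
    case True
    then have "(1 / 3) ^ Suc i \<le> ternary_code B x - ternary_code B y"
      by (intro ternary_code_separates) (use i min in auto)
    then show ?thesis by linarith
  next
    case False
    then have "(1 / 3) ^ Suc i \<le> ternary_code B y - ternary_code B x"
      by (intro ternary_code_separates) (use i min in auto)
    then show ?thesis by linarith
  qed
  moreover have "(1 / 3 :: real) ^ J \<le> (1 / 3) ^ Suc i"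
    by (rule power_decreasing) (use i assms(2) in auto)
  ultimately show False using assms(1) by linarith
qed

text \<open>
  A bounded set is totally bounded. Let the sets \<open>B j\<close> run through finite covers by balls of
  radius \<open>1 / (m + 1)\<close>, for all \<open>m\<close>. Points with close codes then lie in a common small ball, so the inverse of the
  code is uniformly continuous and extends to the whole line. In this way weak convergence in any dimension reduces to
  weak convergence on the line.
\<close>

lemma bounded_set_coding:
  fixes X :: "'a::euclidean_space set"
  assumes "bounded X"
  obtains code :: "'a \<Rightarrow> real" and decode :: "real \<Rightarrow> 'a"
  where "code \<in> borel_measurable borel" "\<And>x. code x \<in> {0..1}"
    "continuous_on UNIV decode" "\<And>x. x \<in> X \<Longrightarrow> decode (code x) = x"
proof -
  have "compact (closure X)" using assms by simp
  then have "\<exists>k. finite k \<and> closure X \<subseteq> (\<Union>x\<in>k. ball x (1 / real (Suc m)))" for m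
    unfolding compact_eq_totally_bounded by (metis of_nat_0_less_iff zero_less_Suc zero_less_divide_1_iff)
  then obtain c where c: "finite (c m)" "X \<subseteq> (\<Union>x\<in>c m. ball x (1 / real (Suc m)))" for m
    by (metis closure_subset order_trans)
  define \<B> where "\<B> m = (\<lambda>x. ball x (1 / real (Suc m))) ` c m" for m
  define U where "U = insert {} (\<Union>m. \<B> m)"
  have "countable U" using c unfolding U_def \<B>_def by (auto intro: countable_finite)
  then obtain B :: "nat \<Rightarrow> 'a set" where B: "range B = U"
    by (metis U_def insert_not_empty uncountable_def)
  have opn: "open (B j)" for j
    using rangeI[of B j] unfolding B U_def \<B>_def by auto
  let ?code = "ternary_code B"
  have meas: "?code \<in> borel_measurable borel"
    unfolding ternary_code_def using opn by (intro borel_measurable_suminf) measurable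
  have close: "\<exists>d>0. \<forall>x\<in>X. \<forall>y\<in>X. \<bar>?code x - ?code y\<bar> < d \<longrightarrow> dist x y < e" if "0 < e" for e
  proof -
    obtain m where m: "inverse (real (Suc m)) < e / 2" using reals_Archimedean[of "e / 2"] \<open>0 < e\<close> by auto
    have "finite (\<B> m)" "\<B> m \<subseteq> range B" using c B by (auto simp: \<B>_def U_def)
    then obtain S where S: "finite S" "\<B> m = B ` S" by (meson finite_subset_image)
    then obtain J where J: "\<And>j. j \<in> S \<Longrightarrow> j < J" using finite_nat_set_iff_bounded[of S] by blast
    have "dist x y < e" if xy: "x \<in> X" "y \<in> X" "\<bar>?code x - ?code y\<bar> < (1 / 3) ^ J" for x y
    proof -
      obtain z where z: "z \<in> c m" "x \<in> ball z (1 / real (Suc m))" using c(2) xy(1) by blast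
      then have "ball z (1 / real (Suc m)) \<in> B ` S" using S unfolding \<B>_def by auto
      then obtain j where j: "j \<in> S" "ball z (1 / real (Suc m)) = B j" by blast
      then have "y \<in> ball z (1 / real (Suc m))"
        using ternary_code_agree[OF xy(3) J[OF j(1)]] z by simp
      then have "dist x y < 1 / real (Suc m) + 1 / real (Suc m)"
        using z dist_triangle3[of x y z] by (simp add: dist_commute)
      then show ?thesis using m by (simp add: inverse_eq_divide)
    qed
    then show ?thesis by (intro exI[of _ "(1 / 3) ^ J"]) auto
  qed
  have inj: "inj_on ?code X"
  proof (rule inj_onI)
    fix x y assume xy: "x \<in> X" "y \<in> X" "?code x = ?code y"
    have "dist x y < e" if "0 < e" for e using close[OF that] xy by auto
    then show "x = y" by (metis dist_pos_lt less_irrefl)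
  qed
  have "uniformly_continuous_on (?code ` X) (inv_into X ?code)"
    unfolding uniformly_continuous_on_def
  proof (intro allI impI)
    fix e :: real assume "0 < e"
    then obtain d where d: "0 < d" "\<And>x y. x \<in> X \<Longrightarrow> y \<in> X \<Longrightarrow> \<bar>?code x - ?code y\<bar> < d \<Longrightarrow> dist x y < e"
      using close[of e] by blast
    then show "\<exists>d>0. \<forall>x\<in>?code ` X. \<forall>x'\<in>?code ` X. dist x' x < d \<longrightarrow>
        dist (inv_into X ?code x') (inv_into X ?code x) < e"
      using inj by (intro exI[of _ d]) (auto simp: inv_into_f_f dist_real_def)
  qed
  then obtain g where g: "uniformly_continuous_on (closure (?code ` X)) g"
      "\<And>x. x \<in> ?code ` X \<Longrightarrow> inv_into X ?code x = g x"
    by (rule uniformly_continuous_on_extension_on_closure) blast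
  obtain decode :: "real \<Rightarrow> 'a" where decode: "continuous_on UNIV decode" "\<And>x. x \<in> closure (?code ` X) \<Longrightarrow> decode x = g x"
    by (rule Dugundji[of "UNIV :: 'a set" UNIV "closure (?code ` X)" g])
      (use g in \<open>auto intro: uniformly_continuous_imp_continuous\<close>)
  have "decode (?code x) = x" if "x \<in> X" for x
    using decode(2)[of "?code x"] g(2)[of "?code x"] that inj closure_subset[of "?code ` X"]
    by (auto simp: inv_into_f_f)
  moreover have "?code x \<in> {0..1}" for x by (simp add: ternary_code_bounds)
  ultimately show ?thesis by (intro that[OF meas _ decode(1)])
qed

text \<open>
  Helly selection applied to the images of the measures under the code, after normalization to
  mass one; the limit is carried back by the decoding map. If the masses tend to zero, the limit is the null measure.
\<close>

theorem bounded_measures_converging_subsequence: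
  fixes m :: "nat \<Rightarrow> 'b measure" and G :: "nat \<Rightarrow> 'b \<Rightarrow> 'a::euclidean_space"
  assumes fin: "\<And>n. finite_measure (m n)" and mass: "\<And>n. measure (m n) (space (m n)) \<le> C"
    and G[measurable]: "\<And>n. G n \<in> borel_measurable (m n)"
    and GX: "\<And>n x. x \<in> space (m n) \<Longrightarrow> G n x \<in> X" and X: "bounded X"
  obtains \<sigma> :: "nat \<Rightarrow> nat" and \<mu> :: "'a measure"
  where "strict_mono \<sigma>" "sets \<mu> = sets borel" "finite_measure \<mu>"
    "\<And>\<phi> :: 'a \<Rightarrow> complex. continuous_on UNIV \<phi> \<Longrightarrow> bounded (range \<phi>) \<Longrightarrow>
       (\<lambda>n. LINT x|m (\<sigma> n). \<phi> (G (\<sigma> n) x)) \<longlonglongrightarrow> (LINT y|\<mu>. \<phi> y)"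
proof -
  define a where "a n = measure (m n) (space (m n))" for n
  have "bounded (range a)"
    unfolding bounded_iff by (rule exI[of _ C]) (use mass in \<open>auto simp: a_def\<close>)
  then obtain l s where s: "strict_mono (s :: nat \<Rightarrow> nat)" and al: "(a \<circ> s) \<longlonglongrightarrow> l"
    using bounded_imp_convergent_subsequence by blast
  have l0: "0 \<le> l" by (rule LIMSEQ_le_const[OF al]) (auto simp: a_def)
  show ?thesis
  proof (cases "l = 0")
    case True
    show ?thesis
    proof (rule that[OF s])
      show "sets (null_measure (borel :: 'a measure)) = sets borel" by simp
      show "finite_measure (null_measure (borel :: 'a measure))" by (rule finite_measureI) simp
      fix \<phi> :: "'a \<Rightarrow> complex" assume \<phi>: "continuous_on UNIV \<phi>" "bounded (range \<phi>)"
      then obtain B where B: "\<And>x. cmod (\<phi> x) \<le> B" by (auto simp: bounded_iff)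
      have [measurable]: "\<phi> \<in> borel_measurable borel" using \<phi>(1) by (rule borel_measurable_continuous_onI)
      have "cmod (LINT x|m n. \<phi> (G n x)) \<le> B * a n" for n
      proof -
        interpret finite_measure "m n" by (rule fin)
        have "integrable (m n) (\<lambda>x. \<phi> (G n x))"
          by (rule integrable_const_bound[of _ B]) (auto simp: B)
        then have "(LINT x|m n. cmod (\<phi> (G n x))) \<le> (LINT x|m n. B)"
          by (intro Bochner_Integration.integral_mono) (auto simp: B)
        with Bochner_Integration.integral_norm_bound[of "m n" "\<lambda>x. \<phi> (G n x)"]
        have "cmod (LINT x|m n. \<phi> (G n x)) \<le> (LINT x|m n. B)" by linarith
        then show ?thesis by (simp add: a_def mult.commute)
      qed
      then have bd: "\<forall>n. cmod (LINT x|m (s n). \<phi> (G (s n) x)) \<le> B * a (s n)" by simp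
      have a0: "(\<lambda>n. a (s n)) \<longlonglongrightarrow> 0" using al True by (simp add: comp_def)
      have "(\<lambda>n. LINT x|m (s n). \<phi> (G (s n) x)) \<longlonglongrightarrow> 0"
        using tendsto_mult_right_zero[OF a0, of B]
        by (rule Lim_null_comparison[OF always_eventually[OF bd]])
      then show "(\<lambda>n. LINT x|m (s n). \<phi> (G (s n) x)) \<longlonglongrightarrow> (LINT y|null_measure borel. \<phi> y)"
        by (simp add: integral_null_measure)
    qed
  next
    case False
    with l0 have l: "0 < l" by simp
    then have "eventually (\<lambda>n. 0 < (a \<circ> s) n) sequentially" by (rule order_tendstoD(1)[OF al])
    then obtain N where N: "\<And>n. N \<le> n \<Longrightarrow> 0 < a (s n)" by (auto simp: eventually_sequentially)
    \<comment> \<open>From index \<open>N\<close> on the masses are positive and can be normalized.\<close>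
    define s' where "s' n = s (n + N)" for n
    have s': "strict_mono s'" using s by (auto simp: s'_def strict_mono_def)
    have as': "0 < a (s' n)" for n using N by (simp add: s'_def)
    have al': "(\<lambda>n. a (s' n)) \<longlonglongrightarrow> l"
      using LIMSEQ_ignore_initial_segment[OF al, of N] by (simp add: s'_def)
    obtain code decode where code[measurable]: "code \<in> borel_measurable borel" and code01: "\<And>x. code x \<in> {0..1::real}"
      and decode: "continuous_on UNIV decode" and dc: "\<And>x. x \<in> X \<Longrightarrow> decode (code x) = x"
      using bounded_set_coding[OF X] by blast
    have [measurable]: "decode \<in> borel_measurable borel" using decode by (rule borel_measurable_continuous_onI)
    define P where "P n = density (distr (m (s' n)) borel (\<lambda>x. code (G (s' n) x))) (\<lambda>_. ennreal (1 / a (s' n)))" for n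
    have setsP: "sets (P n) = sets borel" for n by (simp add: P_def)
    have mP: "emeasure (P n) A = ennreal (1 / a (s' n)) * emeasure (m (s' n)) ((\<lambda>x. code (G (s' n) x)) -` A \<inter> space (m (s' n)))"
      if "A \<in> sets borel" for n A
      unfolding P_def using that by (simp add: emeasure_density_const emeasure_distr)
    have one: "emeasure (P n) {-1<..1} = 1" "emeasure (P n) UNIV = 1" for n
    proof -
      interpret finite_measure "m (s' n)" by (rule fin)
      have "(\<lambda>x. code (G (s' n) x)) -` {-1<..1} \<inter> space (m (s' n)) = space (m (s' n))"
        using code01 by (force intro: less_le_trans[of "-1" "0::real"])
      moreover have "ennreal (1 / a (s' n)) * emeasure (m (s' n)) (space (m (s' n))) = 1"
        using as'[of n] by (simp add: emeasure_eq_measure a_def ennreal_mult[symmetric])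
      ultimately show "emeasure (P n) {-1<..1} = 1" "emeasure (P n) UNIV = 1" by (simp_all add: mP)
    qed
    have rd: "real_distribution (P n)" for n
    proof -
      have "prob_space (P n)" by (rule prob_spaceI) (use one sets_eq_imp_space_eq[OF setsP] in simp)
      then show ?thesis by (simp add: real_distribution_def real_distribution_axioms_def setsP)
    qed
    have "tight P"
      unfolding tight_def
    proof (intro conjI allI impI)
      fix e :: real assume "0 < e"
      then show "\<exists>a b. a < b \<and> (\<forall>n. 1 - e < measure (P n) {a<..b})"
        using one by (intro exI[of _ "-1"] exI[of _ 1]) (auto simp: measure_def)
    qed (rule rd)
    from tight_imp_convergent_subsubsequence[OF this, of "\<lambda>n. n"] obtain r \<Lambda>
      where r: "strict_mono (r :: nat \<Rightarrow> nat)" and \<Lambda>: "real_distribution \<Lambda>" "weak_conv_m (P \<circ> (\<lambda>n. n) \<circ> r) \<Lambda>"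
      by (auto simp: strict_mono_def)
    interpret \<Lambda>: real_distribution \<Lambda> by (rule \<Lambda>)
    define \<mu> where "\<mu> = distr (density \<Lambda> (\<lambda>_. ennreal l)) borel decode"
    show ?thesis
    proof (rule that[of "s' \<circ> r" \<mu>])
      show "strict_mono (s' \<circ> r)" using s' r by (rule strict_mono_o)
      show "sets \<mu> = sets borel" by (simp add: \<mu>_def)
      show "finite_measure \<mu>"
      proof (rule finite_measureI)
        have "emeasure \<mu> (space \<mu>) = ennreal l * emeasure \<Lambda> UNIV"
          by (simp add: \<mu>_def emeasure_distr emeasure_density_const)
        then show "emeasure \<mu> (space \<mu>) \<noteq> \<infinity>" by (simp add: ennreal_mult_eq_top_iff)
      qed
      fix \<phi> :: "'a \<Rightarrow> complex" assume \<phi>: "continuous_on UNIV \<phi>" "bounded (range \<phi>)"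
      then obtain B where B: "\<And>x. cmod (\<phi> x) \<le> B" by (auto simp: bounded_iff)
      have [measurable]: "\<phi> \<in> borel_measurable borel" using \<phi>(1) by (rule borel_measurable_continuous_onI)
      have "(\<lambda>n. LINT x|(P \<circ> (\<lambda>n. n) \<circ> r) n. \<phi> (decode x)) \<longlonglongrightarrow> (LINT x|\<Lambda>. \<phi> (decode x))"
      proof (rule weak_conv_imp_integral_bdd_continuous_conv[OF _ \<Lambda>(1) \<Lambda>(2)])
        show "real_distribution ((P \<circ> (\<lambda>n. n) \<circ> r) n)" for n using rd by simp
        have "continuous_on UNIV (\<lambda>x. \<phi> (decode x))"
          by (rule continuous_on_compose2[OF \<phi>(1) decode]) simp
        then show "isCont (\<lambda>x. \<phi> (decode x)) x" for x by (simp add: continuous_on_eq_continuous_at)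
      qed (rule B)
      then have lim: "(\<lambda>n. LINT x|P (r n). \<phi> (decode x)) \<longlonglongrightarrow> (LINT x|\<Lambda>. \<phi> (decode x))" by simp
      have eq: "(LINT x|m (s' n). \<phi> (G (s' n) x)) = a (s' n) *\<^sub>R (LINT x|P n. \<phi> (decode x))" for n
      proof -
        have "(LINT x|P n. \<phi> (decode x)) = (LINT x|distr (m (s' n)) borel (\<lambda>x. code (G (s' n) x)). (1 / a (s' n)) *\<^sub>R \<phi> (decode x))"
          unfolding P_def by (rule integral_density) (use as'[of n] in auto)
        also have "\<dots> = (1 / a (s' n)) *\<^sub>R (LINT x|m (s' n). \<phi> (decode (code (G (s' n) x))))"
          by (subst integral_distr) auto
        also have "(LINT x|m (s' n). \<phi> (decode (code (G (s' n) x)))) = (LINT x|m (s' n). \<phi> (G (s' n) x))"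
          by (rule Bochner_Integration.integral_cong) (auto simp: dc GX)
        finally show ?thesis using as'[of n] by simp
      qed
      have "(\<lambda>n. a (s' (r n)) *\<^sub>R (LINT x|P (r n). \<phi> (decode x))) \<longlonglongrightarrow> l *\<^sub>R (LINT x|\<Lambda>. \<phi> (decode x))"
        by (intro tendsto_scaleR lim LIMSEQ_subseq_LIMSEQ[OF al' r, unfolded comp_def])
      also have "l *\<^sub>R (LINT x|\<Lambda>. \<phi> (decode x)) = (LINT y|\<mu>. \<phi> y)"
        unfolding \<mu>_def using l by (simp add: integral_distr integral_density)
      finally show "(\<lambda>n. LINT x|m ((s' \<circ> r) n). \<phi> (G ((s' \<circ> r) n) x)) \<longlonglongrightarrow> (LINT y|\<mu>. \<phi> y)"
        by (simp add: eq)
    qed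
  qed
qed

section \<open>Smooth functions and cutoffs around a subspace\<close>

lemma times_differentiable_SucD: "times_differentiable (Suc n) f \<Longrightarrow> times_differentiable n f"
proof (induction n arbitrary: f)
  case 0
  then show ?case by (auto intro!: differentiable_imp_continuous_on simp: differentiable_on_def differentiable_at_withinI)
qed auto

lemma times_differentiable_const: "times_differentiable n (\<lambda>x. c)"
  by (induction n arbitrary: c) auto

lemma times_differentiable_bounded_linear:
  assumes "bounded_linear f"
  shows "times_differentiable n f"
proof (cases n)
  case 0
  then show ?thesis using assms by (simp add: linear_continuous_on)
next
  case (Suc m)
  have "frechet_derivative f (at x) = f" for x
    using bounded_linear_imp_has_derivative[OF assms] by (metis frechet_derivative_at)
  then show ?thesis
    using assms Suc by (simp add: bounded_linear_imp_differentiable times_differentiable_const)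
qed

lemma times_differentiable_add:
  "times_differentiable n f \<Longrightarrow> times_differentiable n g \<Longrightarrow> times_differentiable n (\<lambda>x. f x + g x)"
proof (induction n arbitrary: f g)
  case (Suc n)
  then have "frechet_derivative (\<lambda>x. f x + g x) (at x)
      = (\<lambda>v. frechet_derivative f (at x) v + frechet_derivative g (at x) v)" for x
    by (intro frechet_derivative_at[symmetric] has_derivative_add)
      (auto simp: frechet_derivative_works[symmetric])
  then show ?case using Suc by (auto intro: differentiable_add)
qed (auto intro: continuous_on_add)

lemma times_differentiable_mult:
  fixes f g :: "'a::real_normed_vector \<Rightarrow> 'b::real_normed_algebra"
  shows "times_differentiable n f \<Longrightarrow> times_differentiable n g \<Longrightarrow> times_differentiable n (\<lambda>x. f x * g x)"
proof (induction n arbitrary: f g)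
  case (Suc n)
  then have "frechet_derivative (\<lambda>x. f x * g x) (at x)
      = (\<lambda>v. f x * frechet_derivative g (at x) v + frechet_derivative f (at x) v * g x)" for x
    by (intro frechet_derivative_at[symmetric] has_derivative_mult)
      (auto simp: frechet_derivative_works[symmetric])
  moreover have "times_differentiable n f" "times_differentiable n g"
    using Suc.prems by (auto intro: times_differentiable_SucD simp del: times_differentiable.simps)
  ultimately show ?case
    using Suc by (auto intro!: times_differentiable_add Suc.IH)
qed (auto intro: continuous_on_mult)

lemma times_differentiable_sum:
  assumes "finite A" "\<And>i. i \<in> A \<Longrightarrow> times_differentiable n (f i)"
  shows "times_differentiable n (\<lambda>x. \<Sum>i\<in>A. f i x)"
  using assms
  by (induction A rule: finite_induct) (auto intro: times_differentiable_add times_differentiable_const)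

lemma times_differentiable_of_real:
  "times_differentiable n f \<Longrightarrow> times_differentiable n (\<lambda>x. of_real (f x) :: 'b::{real_normed_algebra_1, real_normed_field})"
proof (induction n arbitrary: f)
  case (Suc n)
  then have "frechet_derivative (\<lambda>x. of_real (f x) :: 'b) (at x) = (\<lambda>v. of_real (frechet_derivative f (at x) v))" for x
    by (intro frechet_derivative_at[symmetric] has_derivative_of_real)
      (auto simp: frechet_derivative_works[symmetric])
  moreover have "(\<lambda>x. of_real (f x) :: 'b) differentiable at x" for x
    using Suc.prems has_derivative_of_real[of f _ "at x"] unfolding times_differentiable.simps differentiable_def by blast
  ultimately show ?case using Suc by auto
qed (auto intro: continuous_on_of_real)

text \<open>
  For \<open>p = 1\<close> this is the standard smooth function vanishing on the negative half-line. The
  polynomial factor in \<open>1 / t\<close> makes the family closed under differentiation, so that smoothness follows by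
  induction over all \<open>p\<close> at once.
\<close>

definition flat_bump :: "real poly \<Rightarrow> real \<Rightarrow> real" where
  "flat_bump p t = (if 0 < t then poly p (1 / t) * exp (- (1 / t)) else 0)"

lemma poly_times_exp_tendsto_0: "((\<lambda>y. poly p y * exp (- y)) \<longlongrightarrow> (0::real)) at_top"
proof -
  have "((\<lambda>y. \<Sum>i\<le>degree p. coeff p i * (y ^ i / exp y)) \<longlongrightarrow> (\<Sum>i\<le>degree p. coeff p i * 0)) at_top"
    by (intro tendsto_intros tendsto_power_div_exp_0)
  moreover have "poly p y * exp (- y) = (\<Sum>i\<le>degree p. coeff p i * (y ^ i / exp y))" for y :: real
    by (simp add: poly_altdef sum_distrib_right exp_minus divide_inverse mult.assoc)
  ultimately show ?thesis by simp
qed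

lemma flat_bump_tendsto_0: "(flat_bump p \<longlongrightarrow> 0) (at_right 0)"
proof -
  have "((\<lambda>t. poly p (1 / t) * exp (- (1 / t))) \<longlongrightarrow> 0) (at_right 0)"
    using filterlim_compose[OF poly_times_exp_tendsto_0 filterlim_inverse_at_top_right]
    by (simp add: inverse_eq_divide)
  then show ?thesis
    by (rule Lim_transform_eventually) (auto simp: flat_bump_def eventually_at_filter)
qed

text \<open>
  At \<open>t = 0\<close> the difference quotient is again a member of the family, and all members tend to 0
  from the right.
\<close>

lemma flat_bump_has_derivative:
  "(flat_bump p has_real_derivative flat_bump (monom 1 2 * (p - pderiv p)) t) (at t)"
proof -
  consider "t < 0" | "t = 0" | "0 < t" by linarith
  then show ?thesis
  proof cases
    case 1
    have "((\<lambda>_. 0) has_real_derivative 0) (at t)" by simp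
    then have "(flat_bump p has_real_derivative 0) (at t)"
      by (rule DERIV_cong_ev[OF refl _ refl, THEN iffD1, rotated])
        (use 1 in \<open>auto simp: flat_bump_def eventually_nhds intro!: exI[of _ "{..<0}"]\<close>)
    then show ?thesis using 1 by (simp add: flat_bump_def)
  next
    case 3
    have "((\<lambda>t. poly p (1 / t) * exp (- (1 / t))) has_real_derivative flat_bump (monom 1 2 * (p - pderiv p)) t) (at t)"
      using 3 by (auto intro!: derivative_eq_intros DERIV_chain2[OF poly_DERIV]
          simp: flat_bump_def poly_monom power2_eq_square field_simps)
    then show ?thesis
      by (rule DERIV_cong_ev[OF refl _ refl, THEN iffD1, rotated])
        (use 3 in \<open>auto simp: flat_bump_def eventually_nhds intro!: exI[of _ "{0<..}"]\<close>)
  next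
    case 2
    have eq: "(flat_bump p (0 + h) - flat_bump p 0) / h = flat_bump (monom 1 1 * p) h" for h
      by (simp add: flat_bump_def poly_monom)
    have "(flat_bump (monom 1 1 * p) \<longlongrightarrow> 0) (at 0)"
    proof (rule filterlim_split_at)
      show "(flat_bump (monom 1 1 * p) \<longlongrightarrow> 0) (at_left 0)"
        by (rule Lim_transform_eventually[OF tendsto_const])
          (auto simp: flat_bump_def eventually_at_filter)
    qed (rule flat_bump_tendsto_0)
    then have "(flat_bump p has_real_derivative 0) (at 0)"
      unfolding DERIV_def eq .
    then show ?thesis using 2 by (simp add: flat_bump_def)
  qed
qed

lemma times_differentiable_flat_bump_compose:
  assumes q: "\<And>n. times_differentiable n q"
  shows "times_differentiable n (\<lambda>x. flat_bump p (q x))"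
proof (induction n arbitrary: p)
  case 0
  have "continuous_on UNIV (flat_bump p)"
    by (intro continuous_at_imp_continuous_on ballI) (rule DERIV_isCont[OF flat_bump_has_derivative])
  then show ?case using q[of 0] by (simp add: continuous_on_compose2)
next
  case (Suc n)
  let ?p' = "monom 1 2 * (p - pderiv p)"
  have d: "((\<lambda>x. flat_bump p (q x)) has_derivative (\<lambda>v. frechet_derivative q (at x) v * flat_bump ?p' (q x))) (at x)" for x
  proof -
    have "(q has_derivative frechet_derivative q (at x)) (at x)"
      using q[of "Suc 0"] by (simp add: frechet_derivative_works[symmetric])
    from DERIV_compose_FDERIV[where g = q and x = x and s = UNIV, OF flat_bump_has_derivative this]
    show ?thesis by simp
  qed
  then have "frechet_derivative (\<lambda>x. flat_bump p (q x)) (at x)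
      = (\<lambda>v. frechet_derivative q (at x) v * flat_bump ?p' (q x))" for x
    by (metis frechet_derivative_at)
  moreover have "times_differentiable n (\<lambda>x. frechet_derivative q (at x) v)" for v
    using q[of "Suc n"] by simp
  ultimately show ?case
    using d Suc by (auto simp: differentiable_def intro!: times_differentiable_mult)
qed

text \<open>
  A bump supported in a ball intersected with a neighbourhood of the orthogonal complement of \<open>B\<close>. As
  \<open>K\<close> grows, the ellipsoids shrink to this complement, while the bump keeps a fixed lower bound on the
  ellipsoids of half the squared radius.
\<close>

definition ellipsoid_bump :: "real \<Rightarrow> real \<Rightarrow> (real^'d) set \<Rightarrow> real^'d \<Rightarrow> real" where
  "ellipsoid_bump R K B \<xi> = flat_bump 1 (R\<^sup>2 - ((norm \<xi>)\<^sup>2 + K * (\<Sum>l\<in>B. (\<xi> \<bullet> l)\<^sup>2)))"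

lemma ellipsoid_bump_test_function:
  fixes B :: "(real^'d) set"
  assumes B: "finite B" and K: "0 \<le> K" and R: "0 \<le> R"
  shows "(\<lambda>z :: (real^'d) \<times> (real^'d). complex_of_real (ellipsoid_bump R K B (snd z))) \<in> test_functions"
  unfolding test_functions_def
proof (intro CollectI conjI allI)
  show "smooth (\<lambda>z :: (real^'d) \<times> (real^'d). complex_of_real (ellipsoid_bump R K B (snd z)))"
    unfolding smooth_def ellipsoid_bump_def
  proof (intro allI times_differentiable_of_real times_differentiable_flat_bump_compose)
    fix n
    have lin: "times_differentiable n (\<lambda>z :: (real^'d) \<times> (real^'d). snd z \<bullet> l)" for l
      by (rule times_differentiable_bounded_linear)
        (intro bounded_linear_compose[OF bounded_linear_inner_left] bounded_linear_snd)
    have norm: "(norm (snd z))\<^sup>2 = (\<Sum>b\<in>Basis. (snd z \<bullet> b) * (snd z \<bullet> b))" for z :: "(real^'d) \<times> (real^'d)"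
      by (simp add: dot_square_norm[symmetric] euclidean_inner[of "snd z" "snd z"])
    have "times_differentiable n (\<lambda>z :: (real^'d) \<times> (real^'d). R\<^sup>2 + (- 1) *
        ((\<Sum>b\<in>Basis. (snd z \<bullet> b) * (snd z \<bullet> b)) + K * (\<Sum>l\<in>B. (snd z \<bullet> l) * (snd z \<bullet> l))))"
      by (intro times_differentiable_add times_differentiable_mult times_differentiable_const
          times_differentiable_sum lin B finite_Basis)
    moreover have "R\<^sup>2 + (- 1) * ((\<Sum>b\<in>Basis. (snd z \<bullet> b) * (snd z \<bullet> b)) + K * (\<Sum>l\<in>B. (snd z \<bullet> l) * (snd z \<bullet> l)))
        = R\<^sup>2 - ((norm (snd z))\<^sup>2 + K * (\<Sum>l\<in>B. (snd z \<bullet> l)\<^sup>2))" for z :: "(real^'d) \<times> (real^'d)"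
      unfolding norm unfolding power2_eq_square by simp
    ultimately show "times_differentiable n (\<lambda>z :: (real^'d) \<times> (real^'d). R\<^sup>2 - ((norm (snd z))\<^sup>2 + K * (\<Sum>l\<in>B. (snd z \<bullet> l)\<^sup>2)))"
      by (simp only:)
  qed
  show "torus_periodic (\<lambda>x. complex_of_real (ellipsoid_bump R K B (snd (x, \<xi>))))" for \<xi>
    by (simp add: torus_periodic_def)
  show "\<exists>R'. \<forall>x \<xi>. norm \<xi> > R' \<longrightarrow> complex_of_real (ellipsoid_bump R K B (snd (x :: real^'d, \<xi>))) = 0"
  proof (intro exI[of _ R] allI impI)
    fix x \<xi> :: "real^'d" assume "R < norm \<xi>"
    then have "R\<^sup>2 < (norm \<xi>)\<^sup>2" using R by (intro power_strict_mono) auto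
    moreover have "0 \<le> K * (\<Sum>l\<in>B. (\<xi> \<bullet> l)\<^sup>2)" using K by (intro mult_nonneg_nonneg sum_nonneg) auto
    ultimately show "complex_of_real (ellipsoid_bump R K B (snd (x, \<xi>))) = 0"
      by (simp add: ellipsoid_bump_def flat_bump_def)
  qed
qed

lemma flat_bump_one: "flat_bump 1 t = (if 0 < t then exp (- (1 / t)) else 0)"
  by (simp add: flat_bump_def)

lemma ellipsoid_bump_bounds: "0 \<le> ellipsoid_bump R K B \<xi>" "ellipsoid_bump R K B \<xi> \<le> 1"
  by (auto simp: ellipsoid_bump_def flat_bump_one)

lemma ellipsoid_bump_zero:
  "R\<^sup>2 \<le> (norm \<xi>)\<^sup>2 + K * (\<Sum>l\<in>B. (\<xi> \<bullet> l)\<^sup>2) \<Longrightarrow> ellipsoid_bump R K B \<xi> = 0"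
  by (auto simp: ellipsoid_bump_def flat_bump_one)

lemma ellipsoid_bump_ge:
  assumes "(norm \<xi>)\<^sup>2 + K * (\<Sum>l\<in>B. (\<xi> \<bullet> l)\<^sup>2) \<le> R\<^sup>2 / 2" "0 < R"
  shows "exp (- 2 / R\<^sup>2) \<le> ellipsoid_bump R K B \<xi>"
proof -
  define t where "t = R\<^sup>2 - ((norm \<xi>)\<^sup>2 + K * (\<Sum>l\<in>B. (\<xi> \<bullet> l)\<^sup>2))"
  have R: "0 < R\<^sup>2 / 2" using assms by simp
  have t: "R\<^sup>2 / 2 \<le> t" using assms unfolding t_def by linarith
  have t0: "0 < t" using t R by linarith
  have "1 / t \<le> 1 / (R\<^sup>2 / 2)" using R t t0 by (intro divide_left_mono mult_pos_pos) auto
  then have "- 2 / R\<^sup>2 \<le> - (1 / t)" by simp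
  with t0 show ?thesis
    unfolding ellipsoid_bump_def flat_bump_one t_def[symmetric] by (simp only: if_True exp_le_cancel_iff)
qed

section \<open>Integration of periodic functions\<close>

lemma real_vec_nth [simp]: "real_vec k $ i = real_of_int (k $ i)"
  by (simp add: real_vec_def)

lemma real_vec_diff: "real_vec (k - l) = real_vec k - real_vec l"
  by (simp add: vec_eq_iff)

lemma real_vec_minus: "real_vec (- k) = - real_vec k"
  by (simp add: vec_eq_iff)

lemma real_vec_0 [simp]: "real_vec 0 = 0"
  by (simp add: vec_eq_iff)

lemma real_vec_eq_iff [simp]: "real_vec k = real_vec l \<longleftrightarrow> k = l"
  by (simp add: vec_eq_iff)

lemma real_vec_eq_0_iff [simp]: "real_vec k = 0 \<longleftrightarrow> k = 0"
  using real_vec_eq_iff[of k 0] by (simp del: real_vec_eq_iff)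

lemma real_vec_inner: "real_vec k \<bullet> real_vec l = real_of_int (\<Sum>i\<in>UNIV. k $ i * l $ i)"
  by (simp add: inner_vec_def)

lemma torus_cell_sets [measurable]: "torus_cell \<in> sets borel"
proof -
  have "torus_cell = {x :: real^'d. \<forall>i\<in>UNIV. 0 \<le> x $ i \<and> x $ i < 2 * pi}" by (simp add: torus_cell_def)
  also have "\<dots> \<in> sets borel" by measurable
  finally show ?thesis .
qed

lemma space_torus [simp]: "space torus = torus_cell"
  by (simp add: torus_def space_restrict_space)

lemma measurable_torus: "f \<in> measurable borel M \<Longrightarrow> f \<in> measurable torus M"
  unfolding torus_def by (rule measurable_restrict_space1) simp

lemma measurable_circle: "f \<in> measurable borel M \<Longrightarrow> f \<in> measurable circle M"
  unfolding circle_def by (rule measurable_restrict_space1) simp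

lemma integral_torus:
  fixes f :: "real^'d \<Rightarrow> 'b::{banach, second_countable_topology}"
  shows "(LINT x|torus. f x) = (LINT x|lborel. indicator torus_cell x *\<^sub>R f x)"
  unfolding torus_def by (rule integral_restrict_space) simp

lemma emeasure_torus_cell: "emeasure lborel (torus_cell :: (real^'d) set) = ennreal ((2 * pi) ^ CARD('d))"
proof (rule antisym)
  let ?b = "(\<chi> i. 2 * pi) :: real^'d"
  have sub: "torus_cell \<subseteq> cbox 0 ?b" "box 0 ?b \<subseteq> torus_cell"
    by (auto simp: torus_cell_def mem_box_cart less_imp_le)
  have nn: "(0 :: real^'d) \<bullet> b \<le> ?b \<bullet> b" if "b \<in> Basis" for b
    using that by (auto simp: Basis_vec_def inner_axis)
  have pr: "(\<Prod>b\<in>Basis. (?b - 0) \<bullet> b) = (2 * pi) ^ CARD('d)"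
  proof -
    have "0 \<in> cbox 0 ?b" by (simp add: mem_box_cart)
    then have "measure lborel (cbox 0 ?b) = (2 * pi) ^ CARD('d)" by (subst content_cbox_cart) auto
    moreover have "measure lborel (cbox 0 ?b) = (\<Prod>b\<in>Basis. (?b - 0) \<bullet> b)"
      using content_cbox[of "0 :: real^'d" ?b] nn by (simp add: inner_diff_left)
    ultimately show ?thesis by simp
  qed
  have "emeasure lborel (torus_cell :: (real^'d) set) \<le> emeasure lborel (cbox 0 ?b)"
    by (rule emeasure_mono[OF sub(1)]) simp
  also have "\<dots> = ennreal ((2 * pi) ^ CARD('d))" using pr nn by (simp only: emeasure_lborel_cbox)
  finally show "emeasure lborel (torus_cell :: (real^'d) set) \<le> ennreal ((2 * pi) ^ CARD('d))" .
  have "ennreal ((2 * pi) ^ CARD('d)) = emeasure lborel (box 0 ?b)" using pr nn by (simp only: emeasure_lborel_box)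
  also have "\<dots> \<le> emeasure lborel (torus_cell :: (real^'d) set)"
    by (rule emeasure_mono[OF sub(2)]) simp
  finally show "ennreal ((2 * pi) ^ CARD('d)) \<le> emeasure lborel (torus_cell :: (real^'d) set)" .
qed

lemma emeasure_torus: "emeasure torus (torus_cell :: (real^'d) set) = ennreal ((2 * pi) ^ CARD('d))"
  by (simp add: torus_def emeasure_restrict_space emeasure_torus_cell)

lemma measure_torus: "measure torus (torus_cell :: (real^'d) set) = (2 * pi) ^ CARD('d)"
  by (simp add: measure_def emeasure_torus)

interpretation torus: finite_measure "torus :: (real^'d) measure"
  by (rule finite_measureI) (simp add: emeasure_torus)

lemma space_circle [simp]: "space circle = {0..<2 * pi}"
  by (simp add: circle_def space_restrict_space)

lemma measure_circle: "measure circle {0..<2 * pi} = 2 * pi"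
  by (simp add: circle_def measure_restrict_space)

interpretation circle: finite_measure circle
  by (rule finite_measureI) (simp add: circle_def emeasure_restrict_space)

lemma integrable_torus_bounded:
  fixes f :: "real^'d \<Rightarrow> 'b::{banach, second_countable_topology}"
  assumes "f \<in> borel_measurable borel" "\<And>x. norm (f x) \<le> B"
  shows "integrable torus f"
  by (rule torus.integrable_const_bound[of _ B]) (use assms in \<open>auto intro: measurable_torus\<close>)

lemma lborel_integral_translate:
  fixes f :: "'a::euclidean_space \<Rightarrow> 'b::{banach, second_countable_topology}"
  assumes [measurable]: "f \<in> borel_measurable borel"
  shows "(LINT x|lborel. f (v + x)) = (LINT x|lborel. f x)"
  by (subst (2) lborel_distr_plus[symmetric, of v]) (simp add: integral_distr)

text \<open>
  Translation by at most one period moves the cell onto itself after one of its two pieces has been shifted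
  back by a full period.
\<close>

lemma torus_integral_translate:
  fixes f :: "real^'d \<Rightarrow> complex"
  assumes f[measurable]: "f \<in> borel_measurable borel" and B: "\<And>x. cmod (f x) \<le> B"
    and per: "torus_periodic f" and s: "0 \<le> s" "s \<le> 2 * pi"
  shows "(LINT x|torus. f (x + axis i s)) = (LINT x|torus. f x)"
proof -
  let ?C = "torus_cell :: (real^'d) set"
  let ?v = "axis i s :: real^'d" and ?w = "axis i (2 * pi) :: real^'d"
  define A where "A = {x\<in>?C. s \<le> x $ i}"
  define A' where "A' = {x\<in>?C. x $ i < s}"
  have A[measurable]: "A \<in> sets borel" "A' \<in> sets borel" unfolding A_def A'_def by measurable
  have w: "f (?w + x) = f x" for x
  proof -
    have "?w = (2 * pi) *\<^sub>R real_vec (axis i 1)" by (simp add: vec_eq_iff axis_def)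
    with per show ?thesis unfolding torus_periodic_def by (metis add.commute)
  qed
  have int: "integrable lborel (\<lambda>x. indicator S x *\<^sub>R f x)" if S[measurable]: "S \<in> sets borel" and "S \<subseteq> ?C" for S
  proof (rule Bochner_Integration.integrable_bound)
    have "emeasure lborel ?C < \<infinity>" by (simp add: emeasure_torus_cell)
    then show "integrable lborel (\<lambda>x. indicator ?C x *\<^sub>R B)" by simp
    show "AE x in lborel. cmod (indicator S x *\<^sub>R f x) \<le> norm (indicator ?C x *\<^sub>R B)"
    proof (rule AE_I2)
      fix x
      have "0 \<le> B" using B[of x] norm_ge_zero[of "f x"] by linarith
      then show "cmod (indicator S x *\<^sub>R f x) \<le> norm (indicator ?C x *\<^sub>R B)"
        using \<open>S \<subseteq> ?C\<close> B[of x] by (auto simp: indicator_def)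
    qed
  qed simp
  have C1: "indicator ?C x = (indicator A (?v + x) + indicator A' (?v + x - ?w) :: real)" for x
  proof -
    let ?rest = "\<forall>j. j \<noteq> i \<longrightarrow> 0 \<le> x $ j \<and> x $ j < 2 * pi"
    have cell: "y \<in> ?C \<longleftrightarrow> (0 \<le> y $ i \<and> y $ i < 2 * pi) \<and> (\<forall>j. j \<noteq> i \<longrightarrow> 0 \<le> y $ j \<and> y $ j < 2 * pi)" for y
      unfolding torus_cell_def mem_Collect_eq by metis
    have "?v + x \<in> A \<longleftrightarrow> (0 \<le> x $ i + s \<and> x $ i + s < 2 * pi \<and> 0 \<le> x $ i) \<and> ?rest"
      unfolding A_def mem_Collect_eq cell by (simp add: axis_def add.commute conj_ac)
    also have "\<dots> \<longleftrightarrow> x \<in> ?C \<and> x $ i + s < 2 * pi"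
      unfolding cell using s by - (rule iffI; elim conjE; intro conjI; (assumption | linarith))
    finally have 1: "?v + x \<in> A \<longleftrightarrow> x \<in> ?C \<and> x $ i + s < 2 * pi" .
    have "?v + x - ?w \<in> A' \<longleftrightarrow> (0 \<le> x $ i + s - 2 * pi \<and> x $ i < 2 * pi) \<and> ?rest"
    proof -
      have "?v + x - ?w \<in> A' \<longleftrightarrow> (0 \<le> s + x $ i - 2 * pi \<and> s + x $ i - 2 * pi < 2 * pi \<and> s + x $ i - 2 * pi < s) \<and> ?rest"
        unfolding A'_def mem_Collect_eq cell by (simp add: axis_def conj_ac)
      also have "\<dots> \<longleftrightarrow> (0 \<le> x $ i + s - 2 * pi \<and> x $ i < 2 * pi) \<and> ?rest"
        using s by - (rule iffI; elim conjE; intro conjI; (assumption | linarith))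
      finally show ?thesis .
    qed
    also have "\<dots> \<longleftrightarrow> x \<in> ?C \<and> \<not> x $ i + s < 2 * pi"
      unfolding cell using s by - (rule iffI; elim conjE; intro conjI; (assumption | linarith))
    finally have 2: "?v + x - ?w \<in> A' \<longleftrightarrow> x \<in> ?C \<and> \<not> x $ i + s < 2 * pi" .
    show ?thesis using 1 2 by (auto simp: indicator_def)
  qed
  have C2: "indicator ?C x = (indicator A x + indicator A' x :: real)" for x
    by (auto simp: A_def A'_def indicator_def)
  have i1: "integrable lborel (\<lambda>x. indicator A (?v + x) *\<^sub>R f (?v + x))"
    using int[of A] lborel_distr_plus[of ?v] integrable_distr_eq[of "(+) ?v" lborel borel "\<lambda>x. indicator A x *\<^sub>R f x"]
    by (simp add: A_def)
  have i2: "integrable lborel (\<lambda>x. indicator A' ((?v - ?w) + x) *\<^sub>R f ((?v - ?w) + x))"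
    using int[of A'] lborel_distr_plus[of "?v - ?w"] integrable_distr_eq[of "(+) (?v - ?w)" lborel borel "\<lambda>x. indicator A' x *\<^sub>R f x"]
    by (simp add: A'_def)
  have fw: "f ((?v - ?w) + x) = f (?v + x)" for x using w[of "(?v - ?w) + x"] by (simp add: algebra_simps)
  have "(LINT x|torus. f (x + ?v)) = (LINT x|lborel. indicator A (?v + x) *\<^sub>R f (?v + x) + indicator A' ((?v - ?w) + x) *\<^sub>R f ((?v - ?w) + x))"
    unfolding integral_torus C1 fw by (simp add: algebra_simps)
  also have "\<dots> = (LINT x|lborel. indicator A (?v + x) *\<^sub>R f (?v + x)) + (LINT x|lborel. indicator A' ((?v - ?w) + x) *\<^sub>R f ((?v - ?w) + x))"
    by (rule Bochner_Integration.integral_add[OF i1 i2])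
  also have "(LINT x|lborel. indicator A (?v + x) *\<^sub>R f (?v + x)) = (LINT x|lborel. indicator A x *\<^sub>R f x)"
    by (rule lborel_integral_translate) measurable
  also have "(LINT x|lborel. indicator A' ((?v - ?w) + x) *\<^sub>R f ((?v - ?w) + x)) = (LINT x|lborel. indicator A' x *\<^sub>R f x)"
    by (rule lborel_integral_translate) measurable
  also have "(LINT x|lborel. indicator A x *\<^sub>R f x) + (LINT x|lborel. indicator A' x *\<^sub>R f x) = (LINT x|torus. f x)"
    unfolding integral_torus C2 scaleR_add_left
    by (rule Bochner_Integration.integral_add[symmetric]) (intro int; simp add: A_def A'_def)+
  finally show ?thesis .
qed

lemma continuous_character: "continuous_on S (\<lambda>x. cis (real_vec k \<bullet> x))"
  by (intro continuous_intros)

lemma borel_character [measurable]: "(\<lambda>x. cis (real_vec k \<bullet> x)) \<in> borel_measurable borel"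
  by (rule borel_measurable_continuous_onI) (rule continuous_character)

lemma borel_character_minus: "(\<lambda>x. cis (- (real_vec l \<bullet> x))) \<in> borel_measurable borel"
  by (intro borel_measurable_continuous_onI continuous_intros)

lemma torus_periodic_character: "torus_periodic (\<lambda>x. cis (real_vec k \<bullet> x))" for k :: "int^'d"
proof -
  have "cis (real_vec k \<bullet> (x + (2 * pi) *\<^sub>R real_vec l)) = cis (real_vec k \<bullet> x)" for x :: "real^'d" and l
  proof -
    have "real_vec k \<bullet> (x + (2 * pi) *\<^sub>R real_vec l) = real_vec k \<bullet> x + 2 * pi * real_of_int (\<Sum>i\<in>UNIV. k $ i * l $ i)"
      by (simp only: inner_add_right inner_scaleR_right real_vec_inner)
    then show ?thesis by (simp only: cis_mult[symmetric] cis_multiple_2pi[OF Ints_of_int] mult_1_right)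
  qed
  then show ?thesis by (simp add: torus_periodic_def)
qed

text \<open>
  Translation by half a wavelength in a direction with \<open>l $ i \<noteq> 0\<close> reverses the sign of the
  integrand and preserves the integral.
\<close>

lemma torus_integral_character:
  "(LINT x|torus. cis (real_vec l \<bullet> x)) = (if l = 0 then (2 * pi) ^ CARD('d) else 0)" for l :: "int^'d"
proof (cases "l = 0")
  case True
  then show ?thesis by (simp add: measure_torus scaleR_conv_of_real)
next
  case False
  then obtain i where i: "l $ i \<noteq> 0" by (auto simp: vec_eq_iff)
  define s where "s = pi / \<bar>real_of_int (l $ i)\<bar>"
  have l1: "1 \<le> \<bar>real_of_int (l $ i)\<bar>" using i by linarith
  then have "pi / \<bar>real_of_int (l $ i)\<bar> \<le> pi / 1" by (intro divide_left_mono) auto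
  then have s: "0 \<le> s" "s \<le> 2 * pi" using pi_gt_zero unfolding s_def by (auto intro: order_trans)
  have "real_of_int (l $ i) * s = pi \<or> real_of_int (l $ i) * s = - pi"
    using i by (auto simp: s_def abs_if)
  then have shift: "cis (real_vec l \<bullet> (x + axis i s)) = - cis (real_vec l \<bullet> x)" for x
    by (auto simp: inner_add_right inner_axis cis_mult[symmetric] cis.code complex_eq_iff)
  have "(LINT x|torus. cis (real_vec l \<bullet> x)) = (LINT x|torus. cis (real_vec l \<bullet> (x + axis i s)))"
    by (rule torus_integral_translate[symmetric, where B = 1])
      (use s in \<open>auto simp: torus_periodic_character\<close>)
  also have "\<dots> = - (LINT x|torus. cis (real_vec l \<bullet> x))" unfolding shift by simp
  finally show ?thesis using False by simp
qed

lemma circle_integral_character: "(LINT t|circle. cis (real_of_int n * t)) = (if n = 0 then 2 * pi else 0)"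
proof (cases "n = 0")
  case True
  then show ?thesis by (simp add: measure_circle scaleR_conv_of_real)
next
  case False
  let ?F = "\<lambda>t. cis (real_of_int n * t) / (\<i> * of_int n)"
  have "has_bochner_integral lborel (\<lambda>t. indicator {0..2 * pi} t *\<^sub>R cis (real_of_int n * t)) (?F (2 * pi) - ?F 0)"
  proof (rule has_bochner_integral_FTC_Icc)
    fix t :: real
    have "((\<lambda>z. exp (\<i> * of_int n * z) / (\<i> * of_int n)) has_field_derivative
        exp (\<i> * of_int n * of_real t) * (\<i> * of_int n) / (\<i> * of_int n)) (at (of_real t))"
      by (auto intro!: derivative_eq_intros)
    then have "((\<lambda>t. exp (\<i> * of_int n * of_real t) / (\<i> * of_int n)) has_vector_derivative
        exp (\<i> * of_int n * of_real t) * (\<i> * of_int n) / (\<i> * of_int n)) (at t within {0..2 * pi})"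
      by (rule has_vector_derivative_real_field)
    moreover have "exp (\<i> * of_int n * of_real t) * (\<i> * of_int n) / (\<i> * of_int n) = exp (\<i> * of_int n * of_real t)"
      by (rule nonzero_mult_div_cancel_right) (use False in auto)
    moreover have "exp (\<i> * of_int n * of_real t) = cis (real_of_int n * t)" for t :: real
      by (simp add: cis_conv_exp mult.assoc)
    ultimately show "(?F has_vector_derivative cis (real_of_int n * t)) (at t within {0..2 * pi})"
      by (simp only:)
  qed (auto intro!: continuous_intros)
  moreover have "?F (2 * pi) - ?F 0 = 0" using cis_multiple_2pi[of "real_of_int n"] by (simp add: mult.commute)
  moreover have [measurable]: "(\<lambda>t. cis (real_of_int n * t)) \<in> borel_measurable borel"
    by (intro borel_measurable_continuous_onI continuous_intros)
  ultimately have "(LINT t|lborel. indicator {0..2 * pi} t *\<^sub>R cis (real_of_int n * t)) = 0"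
    by (simp add: has_bochner_integral_iff)
  moreover have "(LINT t|lborel. indicator {0..<2 * pi} t *\<^sub>R cis (real_of_int n * t))
      = (LINT t|lborel. indicator {0..2 * pi} t *\<^sub>R cis (real_of_int n * t))"
  proof (rule integral_cong_AE)
    have "AE t in lborel. t \<noteq> 2 * pi" by (rule AE_lborel_singleton)
    then show "AE t in lborel. indicator {0..<2 * pi} t *\<^sub>R cis (real_of_int n * t) = indicator {0..2 * pi} t *\<^sub>R cis (real_of_int n * t)"
      by eventually_elim (auto simp: indicator_def)
  qed measurable
  ultimately show ?thesis using False by (simp add: circle_def integral_restrict_space)
qed

section \<open>Fourier coefficients of the density of a Schroedinger flow\<close>

interpretation spacetime: pair_sigma_finite circle "torus :: (real^'d) measure" ..

definition trig_poly :: "(int^'d \<Rightarrow> complex) \<Rightarrow> (int^'d) set \<Rightarrow> real^'d \<Rightarrow> complex" where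
  "trig_poly c E x = (\<Sum>k\<in>E. c k * cis (real_vec k \<bullet> x))"

lemma continuous_trig_poly: "continuous_on S (trig_poly c E)"
  unfolding trig_poly_def by (intro continuous_intros)

lemma borel_trig_poly [measurable]: "trig_poly c E \<in> borel_measurable borel"
  by (rule borel_measurable_continuous_onI) (rule continuous_trig_poly)

lemma trig_poly_measurable_torus [measurable]: "trig_poly c E \<in> borel_measurable torus"
  by (rule measurable_torus) measurable

lemma trig_poly_bound: "cmod (trig_poly c E x) \<le> (\<Sum>k\<in>E. cmod (c k))"
  unfolding trig_poly_def by (rule sum_norm_le) (simp add: norm_mult)

lemma integrable_character: "integrable torus (\<lambda>x. cis (real_vec l \<bullet> x))"
  by (rule integrable_torus_bounded[of _ 1]) auto

lemma trig_poly_norm_sq: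
  "of_real ((cmod (trig_poly c E x))\<^sup>2) = (\<Sum>k\<in>E. \<Sum>j\<in>E. c k * cnj (c j) * cis (real_vec (k - j) \<bullet> x))"
proof -
  have "of_real ((cmod (trig_poly c E x))\<^sup>2) = trig_poly c E x * cnj (trig_poly c E x)"
    by (rule complex_norm_square)
  also have "\<dots> = (\<Sum>k\<in>E. c k * cis (real_vec k \<bullet> x)) * (\<Sum>j\<in>E. cnj (c j) * cis (- (real_vec j \<bullet> x)))"
    by (simp add: trig_poly_def cis_cnj)
  also have "\<dots> = (\<Sum>k\<in>E. \<Sum>j\<in>E. c k * cnj (c j) * (cis (real_vec k \<bullet> x) * cis (- (real_vec j \<bullet> x))))"
    unfolding sum_product by (simp add: mult_ac)
  also have "\<dots> = (\<Sum>k\<in>E. \<Sum>j\<in>E. c k * cnj (c j) * cis (real_vec (k - j) \<bullet> x))"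
    by (simp add: cis_mult real_vec_diff inner_diff_left)
  finally show ?thesis .
qed

lemma torus_integral_trig_poly_sq:
  fixes c :: "int^'d \<Rightarrow> complex"
  assumes E: "finite E"
  shows "(LINT x|torus. of_real ((cmod (trig_poly c E x))\<^sup>2) * cis (- (real_vec l \<bullet> x)))
     = (2 * pi) ^ CARD('d) * (\<Sum>k\<in>{k\<in>E. k - l \<in> E}. c k * cnj (c (k - l)))"
proof -
  have pt: "of_real ((cmod (trig_poly c E x))\<^sup>2) * cis (- (real_vec l \<bullet> x))
      = (\<Sum>k\<in>E. \<Sum>j\<in>E. c k * cnj (c j) * cis (real_vec (k - j - l) \<bullet> x))" for x
    by (simp only: trig_poly_norm_sq sum_distrib_right mult.assoc cis_mult) (simp add: real_vec_diff inner_diff_left)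
  have "(LINT x|torus. of_real ((cmod (trig_poly c E x))\<^sup>2) * cis (- (real_vec l \<bullet> x)))
      = (\<Sum>k\<in>E. \<Sum>j\<in>E. c k * cnj (c j) * (LINT x|torus. cis (real_vec (k - j - l) \<bullet> x)))"
    unfolding pt
    by (subst Bochner_Integration.integral_sum, intro Bochner_Integration.integrable_sum integrable_mult_right integrable_character,
        rule sum.cong[OF refl], subst Bochner_Integration.integral_sum,
        intro Bochner_Integration.integrable_sum integrable_mult_right integrable_character)
      simp
  also have "\<dots> = (\<Sum>k\<in>E. \<Sum>j\<in>E. if j = k - l then (2 * pi) ^ CARD('d) * (c k * cnj (c (k - l))) else 0)"
    unfolding torus_integral_character
    by (intro sum.cong refl) (auto simp: algebra_simps)
  also have "\<dots> = (\<Sum>k\<in>E. if k - l \<in> E then (2 * pi) ^ CARD('d) * (c k * cnj (c (k - l))) else 0)"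
    using E by (simp add: sum.delta)
  also have "\<dots> = (2 * pi) ^ CARD('d) * (\<Sum>k\<in>{k\<in>E. k - l \<in> E}. c k * cnj (c (k - l)))"
    using E by (auto simp: sum.inter_filter sum_distrib_left intro!: sum.cong)
  finally show ?thesis by simp
qed

lemma torus_integral_trig_poly_norm:
  fixes c :: "int^'d \<Rightarrow> complex"
  assumes E: "finite E"
  shows "(LINT x|torus. (cmod (trig_poly c E x))\<^sup>2) = (2 * pi) ^ CARD('d) * (\<Sum>k\<in>E. (cmod (c k))\<^sup>2)"
proof -
  have "complex_of_real (LINT x|torus. (cmod (trig_poly c E x))\<^sup>2)
      = complex_of_real ((2 * pi) ^ CARD('d) * (\<Sum>k\<in>E. (cmod (c k))\<^sup>2))"
    using torus_integral_trig_poly_sq[OF E, of c 0]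
    by (simp only: integral_complex_of_real[symmetric]) (simp add: complex_norm_square flip: of_real_power)
  then show ?thesis by (simp only: of_real_eq_iff)
qed

lemma integrable_trig_poly_sq: "integrable torus (\<lambda>x. (cmod (trig_poly c E x))\<^sup>2)"
proof (rule integrable_torus_bounded)
  show "norm ((cmod (trig_poly c E x))\<^sup>2) \<le> (\<Sum>k\<in>E. cmod (c k))\<^sup>2" for x
    using power_mono[OF trig_poly_bound norm_ge_zero, of c E x 2] by simp
qed simp

lemma L2_torus_integrable:
  assumes "u \<in> L2_torus"
  shows "integrable torus u" "integrable torus (\<lambda>x. u x * cis (- (real_vec k \<bullet> x)))"
proof -
  have [measurable]: "u \<in> borel_measurable torus" and sq: "integrable torus (\<lambda>x. (cmod (u x))\<^sup>2)"
    using assms by (auto simp: L2_torus_def)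
  have "integrable torus (\<lambda>x. (cmod (u x))\<^sup>2 + 1)" using sq by simp
  then show "integrable torus u"
  proof (rule Bochner_Integration.integrable_bound)
    have "cmod (u x) \<le> (cmod (u x))\<^sup>2 + 1" for x
      using zero_le_power2[of "cmod (u x) - 1/2"] by (simp add: power2_diff power2_eq_square algebra_simps)
    then show "AE x in torus. cmod (u x) \<le> norm ((cmod (u x))\<^sup>2 + 1)" by (simp add: add_nonneg_nonneg)
  qed measurable
  then show "integrable torus (\<lambda>x. u x * cis (- (real_vec k \<bullet> x)))"
  proof (rule Bochner_Integration.integrable_bound)
    have [measurable]: "(\<lambda>x. cis (real_vec (- k) \<bullet> x)) \<in> borel_measurable torus" by (rule measurable_torus) measurable
    then show "(\<lambda>x. u x * cis (- (real_vec k \<bullet> x))) \<in> borel_measurable torus"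
      by (simp add: real_vec_minus)
  qed (simp add: norm_mult)
qed

lemma L2_torus_trig_poly: "trig_poly c E \<in> L2_torus"
  by (simp add: L2_torus_def integrable_trig_poly_sq)

lemma cmod_diff_sq_le: "(cmod (a - b))\<^sup>2 \<le> 2 * (cmod a)\<^sup>2 + 2 * (cmod b)\<^sup>2"
proof -
  have "(cmod (a - b))\<^sup>2 \<le> (cmod a + cmod b)\<^sup>2" by (intro power_mono norm_triangle_ineq4 norm_ge_zero)
  also have "\<dots> \<le> 2 * (cmod a)\<^sup>2 + 2 * (cmod b)\<^sup>2"
    using zero_le_power2[of "cmod a - cmod b"] by (simp add: power2_eq_square algebra_simps)
  finally show ?thesis .
qed

lemma L2_torus_diff:
  assumes "u \<in> L2_torus" "v \<in> L2_torus"
  shows "(\<lambda>x. u x - v x) \<in> L2_torus"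
proof -
  have [measurable]: "u \<in> borel_measurable torus" "v \<in> borel_measurable torus"
    and sq: "integrable torus (\<lambda>x. (cmod (u x))\<^sup>2)" "integrable torus (\<lambda>x. (cmod (v x))\<^sup>2)"
    using assms by (auto simp: L2_torus_def)
  then have "integrable torus (\<lambda>x. 2 * (cmod (u x))\<^sup>2 + 2 * (cmod (v x))\<^sup>2)" by simp
  then have "integrable torus (\<lambda>x. (cmod (u x - v x))\<^sup>2)"
    by (rule Bochner_Integration.integrable_bound) (use cmod_diff_sq_le in auto)
  then show ?thesis by (simp add: L2_torus_def)
qed

lemma L2_norm_sq: "(L2_norm u)\<^sup>2 = (LINT x|torus. (cmod (u x))\<^sup>2)"
  unfolding L2_norm_def by (rule real_sqrt_pow2) simp

lemma bessel_inequality: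
  fixes u :: "real^'d \<Rightarrow> complex"
  assumes u: "u \<in> L2_torus" and F: "finite F"
  shows "(2 * pi) ^ CARD('d) * (\<Sum>k\<in>F. (cmod (fourier_coeff u k))\<^sup>2) \<le> (L2_norm u)\<^sup>2"
proof -
  let ?c = "fourier_coeff u" and ?D = "(2 * pi) ^ CARD('d) :: real"
  let ?S = "trig_poly ?c F"
  have [measurable]: "u \<in> borel_measurable torus" and sq: "integrable torus (\<lambda>x. (cmod (u x))\<^sup>2)"
    using u by (auto simp: L2_torus_def)
  have cross: "u x * cnj (?S x) = (\<Sum>k\<in>F. cnj (?c k) * (u x * cis (- (real_vec k \<bullet> x))))" for x
    by (simp add: trig_poly_def sum_distrib_left cis_cnj mult_ac)
  have int: "integrable torus (\<lambda>x. u x * cnj (?S x))"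
    unfolding cross using L2_torus_integrable(2)[OF u] by (intro Bochner_Integration.integrable_sum integrable_mult_right)
  have coef: "(LINT x|torus. u x * cis (- (real_vec k \<bullet> x))) = ?D * ?c k" for k
    by (simp add: fourier_coeff_def)
  have "(LINT x|torus. u x * cnj (?S x)) = (\<Sum>k\<in>F. cnj (?c k) * (LINT x|torus. u x * cis (- (real_vec k \<bullet> x))))"
    unfolding cross using L2_torus_integrable(2)[OF u]
    by (subst Bochner_Integration.integral_sum) (auto intro!: integrable_mult_right)
  also have "\<dots> = of_real (?D * (\<Sum>k\<in>F. (cmod (?c k))\<^sup>2))"
    unfolding coef by (simp add: sum_distrib_left complex_norm_square mult_ac flip: of_real_power)
  finally have "Re (LINT x|torus. u x * cnj (?S x)) = ?D * (\<Sum>k\<in>F. (cmod (?c k))\<^sup>2)" by simp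
  then have re: "(LINT x|torus. Re (u x * cnj (?S x))) = ?D * (\<Sum>k\<in>F. (cmod (?c k))\<^sup>2)"
    by (simp only: integral_Re[OF int])
  define f where "f x = Re (u x * cnj (?S x))" for x
  have f: "integrable torus f" unfolding f_def using int by (rule integrable_Re)
  have pt: "(cmod (u x - ?S x))\<^sup>2 = (cmod (u x))\<^sup>2 - 2 * f x + (cmod (?S x))\<^sup>2" for x
    unfolding f_def cmod_power2 by (simp add: power2_eq_square algebra_simps)
  have "0 \<le> (LINT x|torus. (cmod (u x - ?S x))\<^sup>2)" by simp
  also have "\<dots> = (LINT x|torus. (cmod (u x))\<^sup>2) - 2 * (LINT x|torus. f x) + (LINT x|torus. (cmod (?S x))\<^sup>2)"
    unfolding pt using sq f integrable_trig_poly_sq[of ?c F] by simp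
  finally show ?thesis
    unfolding f_def re torus_integral_trig_poly_norm[OF F] L2_norm_sq by linarith
qed

abbreviation flow_coeff :: "(real^'d \<Rightarrow> complex) \<Rightarrow> real \<Rightarrow> int^'d \<Rightarrow> complex" where
  "flow_coeff u t k \<equiv> fourier_coeff u k * cis (- ((norm (real_vec k))\<^sup>2 * t))"

lemma flow_sum: "(\<Sum>k\<in>F. fourier_coeff u k * cis (real_vec k \<bullet> x - (norm (real_vec k))\<^sup>2 * t)) = trig_poly (flow_coeff u t) F x"
  unfolding trig_poly_def by (intro sum.cong) (auto simp: mult.assoc cis_mult)

text \<open>
  Compare both with a large partial sum \<open>F\<close> of the series: the first distance tends to 0 by the
  definition of the flow, the second is the mass of the modes in \<open>F - E\<close>, by orthogonality. The factor 2 avoids the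
  triangle inequality in \<open>L\<^sup>2\<close>.
\<close>

lemma schroedinger_flow_truncation:
  fixes u :: "real^'d \<Rightarrow> complex"
  assumes flow: "schroedinger_flow u \<psi>" and E: "finite E"
    and \<tau>: "\<And>F. finite F \<Longrightarrow> F \<inter> E = {} \<Longrightarrow> (\<Sum>k\<in>F. (cmod (fourier_coeff u k))\<^sup>2) \<le> \<tau>"
  shows "(LINT x|torus. (cmod (\<psi> t x - trig_poly (flow_coeff u t) E x))\<^sup>2) \<le> 2 * ((2 * pi) ^ CARD('d) * \<tau>)"
proof (rule field_le_epsilon)
  let ?D = "(2 * pi) ^ CARD('d) :: real"
  let ?S = "\<lambda>F. trig_poly (flow_coeff u t) F"
  fix e :: real assume e: "0 < e"
  have \<psi>: "\<psi> t \<in> L2_torus" and lim: "((\<lambda>F. L2_norm (\<lambda>x. \<psi> t x - ?S F x)) \<longlongrightarrow> 0) (finite_subsets_at_top UNIV)"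
    using flow unfolding schroedinger_flow_def flow_sum by auto
  have "eventually (\<lambda>F. L2_norm (\<lambda>x. \<psi> t x - ?S F x) < sqrt (e / 2)) (finite_subsets_at_top UNIV)"
    using e by (intro order_tendstoD(2)[OF lim]) simp
  moreover have "eventually (\<lambda>F. finite F \<and> E \<subseteq> F) (finite_subsets_at_top UNIV)"
    using E by (auto simp: eventually_finite_subsets_at_top)
  ultimately have "\<exists>F. L2_norm (\<lambda>x. \<psi> t x - ?S F x) < sqrt (e / 2) \<and> finite F \<and> E \<subseteq> F"
    by (rule eventually_happens'[OF finite_subsets_at_top_neq_bot eventually_conj])
  then obtain F where F: "L2_norm (\<lambda>x. \<psi> t x - ?S F x) < sqrt (e / 2)" "finite F" "E \<subseteq> F" by blast
  have "0 \<le> L2_norm (\<lambda>x. \<psi> t x - ?S F x)" by (simp add: L2_norm_def)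
  then have "(L2_norm (\<lambda>x. \<psi> t x - ?S F x))\<^sup>2 \<le> (sqrt (e / 2))\<^sup>2" using F(1) by (intro power_mono) auto
  then have A: "(LINT x|torus. (cmod (\<psi> t x - ?S F x))\<^sup>2) \<le> e / 2" using e by (simp add: L2_norm_sq)
  have diff: "?S E x - ?S F x = - ?S (F - E) x" for x
    using F sum.subset_diff[of E F "\<lambda>k. flow_coeff u t k * cis (real_vec k \<bullet> x)"] by (simp add: trig_poly_def)
  have pt: "(cmod (\<psi> t x - ?S E x))\<^sup>2 \<le> 2 * (cmod (\<psi> t x - ?S F x))\<^sup>2 + 2 * (cmod (?S (F - E) x))\<^sup>2" for x
  proof -
    have "\<psi> t x - ?S F x - (?S E x - ?S F x) = \<psi> t x - ?S E x" by simp
    moreover have "cmod (?S E x - ?S F x) = cmod (?S (F - E) x)" unfolding diff by simp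
    ultimately show ?thesis using cmod_diff_sq_le[of "\<psi> t x - ?S F x" "?S E x - ?S F x"] by simp
  qed
  have i: "integrable torus (\<lambda>x. (cmod (\<psi> t x - ?S F x))\<^sup>2)" for F
    using L2_torus_diff[OF \<psi> L2_torus_trig_poly] by (simp add: L2_torus_def)
  have "(LINT x|torus. (cmod (\<psi> t x - ?S E x))\<^sup>2) \<le> (LINT x|torus. 2 * (cmod (\<psi> t x - ?S F x))\<^sup>2 + 2 * (cmod (?S (F - E) x))\<^sup>2)"
    by (rule Bochner_Integration.integral_mono) (use i pt integrable_trig_poly_sq in \<open>auto intro!: Bochner_Integration.integrable_add\<close>)
  also have "\<dots> = 2 * (LINT x|torus. (cmod (\<psi> t x - ?S F x))\<^sup>2) + 2 * (?D * (\<Sum>k\<in>F - E. (cmod (flow_coeff u t k))\<^sup>2))"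
    using i integrable_trig_poly_sq[of "flow_coeff u t" "F - E"] torus_integral_trig_poly_norm[of "F - E" "flow_coeff u t"] F(2)
    by (subst Bochner_Integration.integral_add) auto
  also have "\<dots> \<le> 2 * (e / 2) + 2 * (?D * \<tau>)"
    using A \<tau>[of "F - E"] F(2) by (intro add_mono mult_left_mono) (auto simp: norm_mult)
  finally show "(LINT x|torus. (cmod (\<psi> t x - ?S E x))\<^sup>2) \<le> 2 * (?D * \<tau>) + e" by simp
qed

text \<open>
  The Fourier coefficient at frequency \<open>(l, s)\<close> of the density of the flow truncated to the modes in
  \<open>E\<close>.
\<close>

definition autocorrelation :: "(real^'d \<Rightarrow> complex) \<Rightarrow> (int^'d) set \<Rightarrow> int^'d \<Rightarrow> int \<Rightarrow> complex" where
  "autocorrelation u E l s =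
     (\<Sum>k\<in>{k\<in>E. k - l \<in> E \<and> (norm (real_vec (k - l)))\<^sup>2 - (norm (real_vec k))\<^sup>2 = real_of_int s}.
        fourier_coeff u k * cnj (fourier_coeff u (k - l)))"

lemma circle_character_integrable: "integrable circle (\<lambda>t. cis (a * t))"
  by (rule circle.integrable_const_bound[of _ 1])
    (auto intro!: measurable_circle borel_measurable_continuous_onI continuous_intros)

lemma norm_real_vec_sq: "(norm (real_vec k))\<^sup>2 = real_of_int (\<Sum>i\<in>UNIV. k $ i * k $ i)"
  by (simp only: dot_square_norm[symmetric] real_vec_inner)

text \<open>
  Integration over the torus selects the pairs with difference \<open>l\<close>, and integration over a period in
  time selects those among them whose energies differ by \<open>s\<close>.
\<close>

lemma autocorrelation_integral:
  fixes u :: "real^'d \<Rightarrow> complex"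
  assumes E: "finite E"
  shows "(LINT t|circle. cis (- (real_of_int s * t)) *
      (LINT x|torus. of_real ((cmod (trig_poly (flow_coeff u t) E x))\<^sup>2) * cis (- (real_vec l \<bullet> x))))
      = (2 * pi) ^ (CARD('d) + 1) * autocorrelation u E l s" (is "?L = _")
proof -
  let ?N = "\<lambda>k. \<Sum>i\<in>UNIV. k $ i * k $ i" and ?K = "{k\<in>E. k - l \<in> E}"
  let ?c = "\<lambda>k. fourier_coeff u k * cnj (fourier_coeff u (k - l))"
  have fin: "finite ?K" using E by simp
  have "?L = (LINT t|circle. (\<Sum>k\<in>?K. ((2 * pi) ^ CARD('d) * ?c k) * cis (real_of_int (?N (k - l) - ?N k - s) * t)))"
    unfolding torus_integral_trig_poly_sq[OF E] sum_distrib_left norm_real_vec_sq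
    by (intro Bochner_Integration.integral_cong refl sum.cong)
      (simp add: cis_cnj mult_ac cis_mult right_diff_distrib left_diff_distrib flip: of_int_sum of_int_mult)
  also have "\<dots> = (\<Sum>k\<in>?K. ((2 * pi) ^ CARD('d) * ?c k) * (LINT t|circle. cis (real_of_int (?N (k - l) - ?N k - s) * t)))"
    by (subst Bochner_Integration.integral_sum) (auto intro!: integrable_mult_right circle_character_integrable)
  also have "\<dots> = (\<Sum>k\<in>?K. if ?N (k - l) - ?N k = s then (2 * pi) ^ (CARD('d) + 1) * ?c k else 0)"
    unfolding circle_integral_character by (intro sum.cong refl) auto
  also have "\<dots> = (2 * pi) ^ (CARD('d) + 1) * (\<Sum>k\<in>{k\<in>?K. ?N (k - l) - ?N k = s}. ?c k)"
    unfolding sum_distrib_left by (rule sum.inter_filter[OF fin, symmetric])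
  also have "{k\<in>?K. ?N (k - l) - ?N k = s} = {k\<in>E. k - l \<in> E \<and> (norm (real_vec (k - l)))\<^sup>2 - (norm (real_vec k))\<^sup>2 = real_of_int s}"
    unfolding norm_real_vec_sq of_int_diff[symmetric] of_int_eq_iff by auto
  finally show ?thesis by (simp add: autocorrelation_def)
qed

lemma measurable_flow_character:
  assumes "(\<lambda>(t, x). f t x) \<in> borel_measurable (circle \<Otimes>\<^sub>M torus)"
  shows "(\<lambda>(t, x). cis (- (real_of_int s * t)) * cis (- (real_vec l \<bullet> x)) * of_real (f t x :: real))
      \<in> borel_measurable (circle \<Otimes>\<^sub>M torus)"
proof -
  note assms[measurable]
  have [measurable]: "(\<lambda>t. cis (- (real_of_int s * t))) \<in> borel_measurable circle"
    by (intro measurable_circle borel_measurable_continuous_onI continuous_intros)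
  have [measurable]: "(\<lambda>x. cis (- (real_vec l \<bullet> x))) \<in> borel_measurable torus"
    by (intro measurable_torus borel_measurable_continuous_onI continuous_intros)
  show ?thesis by measurable
qed

lemma spacetime_integrable:
  assumes f: "(\<lambda>(t, x). f t x) \<in> borel_measurable (circle \<Otimes>\<^sub>M torus)"
    and C: "AE t in circle. integrable torus (f t) \<and> (LINT x|torus. \<bar>f t x\<bar>) \<le> C"
  shows "integrable (circle \<Otimes>\<^sub>M torus)
      (\<lambda>(t, x). cis (- (real_of_int s * t)) * cis (- (real_vec l \<bullet> x)) * of_real (f t x :: real))"
proof (rule spacetime.Fubini_integrable)
  note f[measurable]
  have [measurable]: "(\<lambda>t. LINT x|torus. \<bar>f t x\<bar>) \<in> borel_measurable circle" by measurable
  show "integrable circle (\<lambda>t. LINT x|torus. norm (case (t, x) of (t, x) \<Rightarrow>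
      cis (- (real_of_int s * t)) * cis (- (real_vec l \<bullet> x)) * of_real (f t x)))"
    by (rule circle.integrable_const_bound[of _ C]) (use C in \<open>auto simp: norm_mult\<close>)
  show "AE t in circle. integrable torus (\<lambda>x. case (t, x) of (t, x) \<Rightarrow>
      cis (- (real_of_int s * t)) * cis (- (real_vec l \<bullet> x)) * of_real (f t x))"
    using C
  proof eventually_elim
    case (elim t)
    have [measurable]: "(\<lambda>x. cis (- (real_vec l \<bullet> x))) \<in> borel_measurable torus"
      by (intro measurable_torus borel_measurable_continuous_onI continuous_intros)
    from elim have i: "integrable torus (f t)" by simp
    then have "(\<lambda>x. cis (- (real_of_int s * t)) * cis (- (real_vec l \<bullet> x)) * of_real (f t x)) \<in> borel_measurable torus"
      by measurable
    with i show ?case by (auto intro: Bochner_Integration.integrable_bound[OF i] simp: norm_mult)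
  qed
qed (rule measurable_flow_character[OF f])

text \<open>
  The parameter \<open>\<eta>\<close> trades the small distance between \<open>a\<close> and \<open>b\<close> against a small multiple of the
  mass, as a substitute for the Cauchy-Schwarz inequality.
\<close>

lemma sq_diff_le:
  fixes a b :: complex
  assumes "0 < \<eta>"
  shows "\<bar>(cmod a)\<^sup>2 - (cmod b)\<^sup>2\<bar> \<le> (1 + 1 / \<eta>) * (cmod (a - b))\<^sup>2 + \<eta> * (cmod b)\<^sup>2"
proof -
  define D B where "D = cmod (a - b)" and "B = cmod b"
  have A: "\<bar>cmod a - B\<bar> \<le> D" unfolding D_def B_def by (rule norm_triangle_ineq3)
  have "\<bar>(cmod a)\<^sup>2 - B\<^sup>2\<bar> = \<bar>cmod a - B\<bar> * (cmod a + B)"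
    by (simp add: power2_eq_square square_diff_square_factored abs_mult B_def mult.commute)
  also have "\<dots> \<le> D * (D + 2 * B)"
    by (rule mult_mono) (use A in \<open>auto simp: B_def D_def\<close>)
  also have "\<dots> \<le> D\<^sup>2 + (D\<^sup>2 / \<eta> + \<eta> * B\<^sup>2)"
  proof -
    have "0 \<le> (D - \<eta> * B)\<^sup>2 / \<eta>" using assms by simp
    also have "\<dots> = D\<^sup>2 / \<eta> + \<eta> * B\<^sup>2 - 2 * (D * B)"
      using assms by (simp add: power2_eq_square field_simps)
    finally show ?thesis by (simp add: power2_eq_square algebra_simps)
  qed
  finally show ?thesis by (simp add: D_def B_def algebra_simps)
qed

text \<open>
  Discarding modes of total mass \<open>\<tau>\<close> changes every coefficient of the density by a small amount,
  uniformly in the frequency: integrate \<open>sq_diff_le\<close> over space-time, with \<open>schroedinger_flow_truncation\<close> for the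
  discarded part.
\<close>

theorem flow_density_coefficient_approx:
  fixes u :: "real^'d \<Rightarrow> complex"
  assumes flow: "schroedinger_flow u \<psi>" and E: "finite E" and \<eta>: "0 < \<eta>"
    and \<tau>: "\<And>F. finite F \<Longrightarrow> F \<inter> E = {} \<Longrightarrow> (\<Sum>k\<in>F. (cmod (fourier_coeff u k))\<^sup>2) \<le> \<tau>"
    and Q: "(\<Sum>k\<in>E. (cmod (fourier_coeff u k))\<^sup>2) \<le> Q"
  shows "cmod (spacetime_fourier_coeff (\<lambda>t x. (cmod (\<psi> t x))\<^sup>2) l s - autocorrelation u E l s)
      \<le> (1 + 1 / \<eta>) * (2 * \<tau>) + \<eta> * Q"
proof -
  let ?D = "(2 * pi) ^ CARD('d) :: real"
  let ?S = "\<lambda>t. trig_poly (flow_coeff u t) E"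
  let ?e = "\<lambda>t. cis (- (real_of_int s * t))" and ?f = "\<lambda>x. cis (- (real_vec l \<bullet> x))"
  define B where "B = (1 + 1 / \<eta>) * (2 * \<tau>) + \<eta> * Q"
  have \<psi>: "\<psi> t \<in> L2_torus" for t using flow by (auto simp: schroedinger_flow_def)
  have \<psi>m[measurable]: "(\<lambda>(t, x). \<psi> t x) \<in> borel_measurable (circle \<Otimes>\<^sub>M torus)"
    using flow by (auto simp: schroedinger_flow_def)
  have \<psi>i: "integrable torus (\<lambda>x. (cmod (\<psi> t x))\<^sup>2)" for t using \<psi> by (auto simp: L2_torus_def)
  have Si: "(LINT x|torus. (cmod (?S t x))\<^sup>2) \<le> ?D * Q" for t
    unfolding torus_integral_trig_poly_norm[OF E] using Q by (intro mult_left_mono) (auto simp: norm_mult)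
  have di: "integrable torus (\<lambda>x. (cmod (\<psi> t x - ?S t x))\<^sup>2)" for t
    using L2_torus_diff[OF \<psi> L2_torus_trig_poly] by (simp add: L2_torus_def)
  have fm[measurable]: "?f \<in> borel_measurable torus"
    by (intro measurable_torus borel_measurable_continuous_onI continuous_intros)
  have inner: "\<bar>LINT x|torus. \<bar>(cmod (\<psi> t x))\<^sup>2 - (cmod (?S t x))\<^sup>2\<bar>\<bar> \<le> ?D * B" for t
  proof -
    have "(LINT x|torus. \<bar>(cmod (\<psi> t x))\<^sup>2 - (cmod (?S t x))\<^sup>2\<bar>)
        \<le> (LINT x|torus. (1 + 1 / \<eta>) * (cmod (\<psi> t x - ?S t x))\<^sup>2 + \<eta> * (cmod (?S t x))\<^sup>2)"
      by (rule Bochner_Integration.integral_mono)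
        (use \<psi>i di integrable_trig_poly_sq[of "flow_coeff u t" E] sq_diff_le[OF \<eta>] in \<open>auto intro!: Bochner_Integration.integrable_add Bochner_Integration.integrable_diff integrable_abs\<close>)
    also have "\<dots> = (1 + 1 / \<eta>) * (LINT x|torus. (cmod (\<psi> t x - ?S t x))\<^sup>2) + \<eta> * (LINT x|torus. (cmod (?S t x))\<^sup>2)"
      using di integrable_trig_poly_sq by (subst Bochner_Integration.integral_add) auto
    also have "\<dots> \<le> (1 + 1 / \<eta>) * (2 * (?D * \<tau>)) + \<eta> * (?D * Q)"
      using \<eta> by (intro add_mono mult_left_mono schroedinger_flow_truncation[OF flow E \<tau>] Si) auto
    also have "\<dots> = ?D * B" by (simp add: B_def algebra_simps)
    finally show ?thesis by simp
  qed
  define P where "P t = (LINT x|torus. ?f x * of_real ((cmod (\<psi> t x))\<^sup>2))" for t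
  define T where "T t = (LINT x|torus. ?f x * of_real ((cmod (?S t x))\<^sup>2))" for t
  have PT: "cmod (P t - T t) \<le> ?D * B" for t
  proof -
    have i1: "integrable torus (\<lambda>x. ?f x * of_real ((cmod (\<psi> t x))\<^sup>2))"
      using \<psi>i[of t] \<psi>[of t] by (intro Bochner_Integration.integrable_bound[OF \<psi>i[of t]]) (auto simp: norm_mult norm_power L2_torus_def)
    have i2: "integrable torus (\<lambda>x. ?f x * of_real ((cmod (?S t x))\<^sup>2))"
      by (intro Bochner_Integration.integrable_bound[OF integrable_trig_poly_sq[of "flow_coeff u t" E]]) (auto simp: norm_mult norm_power)
    have "cmod (P t - T t) = cmod (LINT x|torus. ?f x * of_real ((cmod (\<psi> t x))\<^sup>2 - (cmod (?S t x))\<^sup>2))"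
      unfolding P_def T_def using i1 i2 by (simp add: right_diff_distrib)
    also have "\<dots> \<le> (LINT x|torus. cmod (?f x * of_real ((cmod (\<psi> t x))\<^sup>2 - (cmod (?S t x))\<^sup>2)))"
      by (rule Bochner_Integration.integral_norm_bound)
    also have "\<dots> = (LINT x|torus. \<bar>(cmod (\<psi> t x))\<^sup>2 - (cmod (?S t x))\<^sup>2\<bar>)"
      by (simp only: norm_mult norm_cis norm_of_real mult_1)
    also have "\<dots> \<le> ?D * B" using inner[of t] by linarith
    finally show ?thesis .
  qed
  have abs\<psi>: "(LINT x|torus. \<bar>(cmod (\<psi> t x))\<^sup>2\<bar>) \<le> ?D * B + ?D * Q" for t
  proof -
    have "(LINT x|torus. (cmod (\<psi> t x))\<^sup>2) \<le> (LINT x|torus. \<bar>(cmod (\<psi> t x))\<^sup>2 - (cmod (?S t x))\<^sup>2\<bar> + (cmod (?S t x))\<^sup>2)"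
      by (rule Bochner_Integration.integral_mono)
        (use \<psi>i integrable_trig_poly_sq in \<open>auto intro!: Bochner_Integration.integrable_add Bochner_Integration.integrable_diff integrable_abs\<close>)
    also have "\<dots> = (LINT x|torus. \<bar>(cmod (\<psi> t x))\<^sup>2 - (cmod (?S t x))\<^sup>2\<bar>) + (LINT x|torus. (cmod (?S t x))\<^sup>2)"
      by (rule Bochner_Integration.integral_add)
        (use \<psi>i integrable_trig_poly_sq in \<open>auto intro!: Bochner_Integration.integrable_diff integrable_abs\<close>)
    also have "\<dots> \<le> ?D * B + ?D * Q" using inner[of t] Si[of t] by linarith
    finally show ?thesis by simp
  qed
  have int: "integrable (circle \<Otimes>\<^sub>M torus) (\<lambda>(t, x). ?e t * ?f x * of_real ((cmod (\<psi> t x))\<^sup>2))"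
    by (rule spacetime_integrable[of "\<lambda>t x. (cmod (\<psi> t x))\<^sup>2" "?D * B + ?D * Q"]) (use \<psi>i abs\<psi> in auto)
  have eP: "integrable circle (\<lambda>t. ?e t * P t)"
    using spacetime.integrable_fst'[OF int] by (simp add: P_def mult.assoc)
  have Tm: "T t = ?D * (\<Sum>k\<in>{k\<in>E. k - l \<in> E}. flow_coeff u t k * cnj (flow_coeff u t (k - l)))" for t
    unfolding T_def using torus_integral_trig_poly_sq[OF E, of "flow_coeff u t" l] by (simp add: mult.commute)
  have "T \<in> borel_measurable borel"
    unfolding Tm by (intro borel_measurable_continuous_onI continuous_intros)
  then have [measurable]: "T \<in> borel_measurable circle" by (rule measurable_circle)
  have em[measurable]: "?e \<in> borel_measurable circle"
    by (intro measurable_circle borel_measurable_continuous_onI continuous_intros)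
  have eT: "integrable circle (\<lambda>t. ?e t * T t)"
  proof (rule circle.integrable_const_bound)
    have "cmod (T t) \<le> ?D * Q" for t
    proof -
      have "cmod (T t) \<le> (LINT x|torus. cmod (?f x * of_real ((cmod (?S t x))\<^sup>2)))"
        unfolding T_def by (rule Bochner_Integration.integral_norm_bound)
      also have "\<dots> = (LINT x|torus. (cmod (?S t x))\<^sup>2)" by (simp add: norm_mult norm_power)
      finally show ?thesis using Si[of t] by linarith
    qed
    then show "AE t in circle. cmod (?e t * T t) \<le> ?D * Q" by (simp add: norm_mult)
  qed measurable
  have "spacetime_fourier_coeff (\<lambda>t x. (cmod (\<psi> t x))\<^sup>2) l s = (LINT t|circle. ?e t * P t) / ?D / (2 * pi)"
  proof -
    have "(LINT (t, x)|(circle \<Otimes>\<^sub>M torus). complex_of_real ((cmod (\<psi> t x))\<^sup>2) * cis (- (real_vec l \<bullet> x + real_of_int s * t)))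
        = (LINT (t, x)|(circle \<Otimes>\<^sub>M torus). ?e t * ?f x * of_real ((cmod (\<psi> t x))\<^sup>2))"
      by (intro Bochner_Integration.integral_cong) (auto simp: cis_mult algebra_simps)
    also have "\<dots> = (LINT t|circle. ?e t * P t)"
      using spacetime.integral_fst'[OF int] by (simp add: P_def mult.assoc)
    finally show ?thesis by (simp add: spacetime_fourier_coeff_def)
  qed
  moreover have "autocorrelation u E l s = (LINT t|circle. ?e t * T t) / ?D / (2 * pi)"
    using autocorrelation_integral[OF E, of s u l] by (simp add: T_def mult.commute)
  ultimately have "spacetime_fourier_coeff (\<lambda>t x. (cmod (\<psi> t x))\<^sup>2) l s - autocorrelation u E l s
      = ((LINT t|circle. ?e t * P t) - (LINT t|circle. ?e t * T t)) / ?D / (2 * pi)"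
    by (simp add: diff_divide_distrib)
  also have "\<dots> = (LINT t|circle. ?e t * (P t - T t)) / ?D / (2 * pi)"
    using eP eT by (simp add: right_diff_distrib)
  also have "cmod \<dots> = cmod (LINT t|circle. ?e t * (P t - T t)) / ?D / (2 * pi)"
    by (simp add: norm_divide norm_mult norm_power)
  also have "\<dots> \<le> (2 * pi * (?D * B)) / ?D / (2 * pi)"
  proof (intro divide_right_mono)
    have "cmod (LINT t|circle. ?e t * (P t - T t)) \<le> (LINT t|circle. cmod (?e t * (P t - T t)))"
      by (rule Bochner_Integration.integral_norm_bound)
    also have "\<dots> \<le> (LINT t|circle. ?D * B)"
    proof (rule Bochner_Integration.integral_mono)
      have "integrable circle (\<lambda>t. ?e t * (P t - T t))" using eP eT by (simp add: right_diff_distrib)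
      then show "integrable circle (\<lambda>t. cmod (?e t * (P t - T t)))" by simp
    qed (use PT in \<open>auto simp: norm_mult\<close>)
    also have "\<dots> = 2 * pi * (?D * B)" by (simp add: measure_circle)
    finally show "cmod (LINT t|circle. ?e t * (P t - T t)) \<le> 2 * pi * (?D * B)" .
  qed auto
  also have "\<dots> = B" by simp
  finally show ?thesis by (simp only: B_def)
qed

section \<open>Fourier decay of test functions\<close>

lemma smooth_frechet: "smooth f \<Longrightarrow> smooth (\<lambda>x. frechet_derivative f (at x) v)"
  unfolding smooth_def by (metis times_differentiable.simps(2))

lemma smooth_has_derivative: "smooth f \<Longrightarrow> (f has_derivative frechet_derivative f (at x)) (at x)"
  unfolding smooth_def by (metis times_differentiable.simps(2) frechet_derivative_works)

lemma smooth_continuous: "smooth f \<Longrightarrow> continuous_on S f"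
  unfolding smooth_def by (metis times_differentiable.simps(1) continuous_on_subset subset_UNIV)

lemma test_function_continuous: "a \<in> test_functions \<Longrightarrow> continuous_on S a"
  by (simp add: test_functions_def smooth_continuous)

lemma test_function_periodic: "a \<in> test_functions \<Longrightarrow> a (x + (2 * pi) *\<^sub>R real_vec k, \<xi>) = a (x, \<xi>)"
  by (simp add: test_functions_def torus_periodic_def)

text \<open>
  The representative of \<open>x\<close> in the fundamental cell.
\<close>

definition wrap :: "real^'d \<Rightarrow> real^'d" where
  "wrap x = (\<chi> i. x $ i - 2 * pi * of_int \<lfloor>x $ i / (2 * pi)\<rfloor>)"

lemma wrap_eq: "wrap x = x + (2 * pi) *\<^sub>R real_vec (\<chi> i. - \<lfloor>x $ i / (2 * pi)\<rfloor>)"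
  by (simp add: wrap_def vec_eq_iff)

lemma wrap_in_torus_cell: "wrap x \<in> torus_cell"
proof -
  have "0 \<le> x $ i - 2 * pi * of_int \<lfloor>x $ i / (2 * pi)\<rfloor> \<and> x $ i - 2 * pi * of_int \<lfloor>x $ i / (2 * pi)\<rfloor> < 2 * pi" for i
  proof -
    define y where "y = x $ i / (2 * pi)"
    have x: "x $ i = 2 * pi * y" by (simp add: y_def)
    have "2 * pi * of_int \<lfloor>y\<rfloor> \<le> 2 * pi * y" "2 * pi * y < 2 * pi * (of_int \<lfloor>y\<rfloor> + 1)"
      by (simp_all add: mult_left_mono floor_correct)
    then show ?thesis unfolding y_def[symmetric] x by (simp add: algebra_simps)
  qed
  then show ?thesis by (simp add: wrap_def torus_cell_def)
qed

lemma test_function_wrap: "a \<in> test_functions \<Longrightarrow> a (wrap x, \<xi>) = a (x, \<xi>)"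
  unfolding wrap_eq by (rule test_function_periodic)

lemma test_function_support:
  assumes "a \<in> test_functions"
  obtains R where "0 < R" "\<And>x \<xi>. R < norm \<xi> \<Longrightarrow> a (x, \<xi>) = 0"
proof -
  obtain R where "\<And>x \<xi>. norm \<xi> > R \<Longrightarrow> a (x, \<xi>) = 0" using assms by (auto simp: test_functions_def)
  then show ?thesis by (intro that[of "max R 1"]) auto
qed

lemma test_function_bounded:
  fixes a :: "(real^'d) \<times> (real^'d) \<Rightarrow> complex"
  assumes a: "a \<in> test_functions"
  obtains B where "0 < B" "\<And>z. cmod (a z) \<le> B"
proof -
  obtain R where R: "0 < R" "\<And>x \<xi>. R < norm \<xi> \<Longrightarrow> a (x, \<xi>) = 0" using test_function_support[OF a] by blast
  have "compact (cbox 0 (\<chi> i. 2 * pi) \<times> cball 0 R :: ((real^'d) \<times> (real^'d)) set)"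
    by (intro compact_Times compact_cbox compact_cball)
  then have "bounded (a ` (cbox 0 (\<chi> i. 2 * pi) \<times> cball 0 R))"
    using test_function_continuous[OF a] by (intro compact_imp_bounded compact_continuous_image)
  then obtain B where B: "0 < B" "\<And>z. z \<in> cbox 0 (\<chi> i. 2 * pi) \<times> cball 0 R \<Longrightarrow> cmod (a z) \<le> B"
    by (auto simp: bounded_pos)
  have "cmod (a (x, \<xi>)) \<le> B" for x \<xi>
  proof (cases "R < norm \<xi>")
    case True
    then show ?thesis using R B(1) by simp
  next
    case False
    have "wrap x \<in> cbox 0 (\<chi> i. 2 * pi)"
      using wrap_in_torus_cell[of x] by (auto simp: torus_cell_def mem_box_cart less_imp_le)
    then have "cmod (a (wrap x, \<xi>)) \<le> B" using False by (intro B(2)) auto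
    then show ?thesis by (simp add: test_function_wrap[OF a])
  qed
  then show ?thesis using that[of B] B(1) by (metis surj_pair)
qed

lemma test_function_uniformly_continuous:
  fixes a :: "(real^'d) \<times> (real^'d) \<Rightarrow> complex"
  assumes a: "a \<in> test_functions" and "0 < e"
  obtains \<delta> where "0 < \<delta>" "\<And>x \<xi> \<xi>'. dist \<xi> \<xi>' < \<delta> \<Longrightarrow> cmod (a (x, \<xi>) - a (x, \<xi>')) < e"
proof -
  obtain R where R: "0 < R" "\<And>x \<xi>. R < norm \<xi> \<Longrightarrow> a (x, \<xi>) = 0" using test_function_support[OF a] by blast
  let ?K = "cbox 0 (\<chi> i. 2 * pi) \<times> cball 0 (R + 1) :: ((real^'d) \<times> (real^'d)) set"
  have "compact ?K" by (intro compact_Times compact_cbox compact_cball)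
  then have "uniformly_continuous_on ?K a"
    using test_function_continuous[OF a] by (intro compact_uniformly_continuous)
  then obtain \<delta> where \<delta>: "0 < \<delta>" "\<And>z z'. z \<in> ?K \<Longrightarrow> z' \<in> ?K \<Longrightarrow> dist z' z < \<delta> \<Longrightarrow> dist (a z') (a z) < e"
    using \<open>0 < e\<close> unfolding uniformly_continuous_on_def by meson
  show ?thesis
  proof (rule that[of "min \<delta> 1"])
    fix x \<xi> \<xi>' :: "real^'d" assume d: "dist \<xi> \<xi>' < min \<delta> 1"
    show "cmod (a (x, \<xi>) - a (x, \<xi>')) < e"
    proof (cases "R < norm \<xi> \<and> R < norm \<xi>'")
      case True
      then show ?thesis using R \<open>0 < e\<close> by simp
    next
      case False
      have "norm \<xi> \<le> norm \<xi>' + dist \<xi> \<xi>'" "norm \<xi>' \<le> norm \<xi> + dist \<xi> \<xi>'"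
        by (norm)+
      then have "norm \<xi> \<le> R + 1" "norm \<xi>' \<le> R + 1" using False d by linarith+
      moreover have "wrap x \<in> cbox 0 (\<chi> i. 2 * pi)"
        using wrap_in_torus_cell[of x] by (auto simp: torus_cell_def mem_box_cart less_imp_le)
      ultimately have "dist (a (wrap x, \<xi>)) (a (wrap x, \<xi>')) < e"
        using d by (intro \<delta>(2)) (auto simp: dist_Pair_Pair)
      then show ?thesis by (simp add: test_function_wrap[OF a] dist_norm)
    qed
  qed (use \<delta> in auto)
qed

abbreviation partial :: "'d \<Rightarrow> ((real^'d) \<times> (real^'d) \<Rightarrow> complex) \<Rightarrow> (real^'d) \<times> (real^'d) \<Rightarrow> complex" where
  "partial i a \<equiv> \<lambda>z. frechet_derivative a (at z) (axis i 1, 0)"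

lemma test_function_partial:
  fixes a :: "(real^'d) \<times> (real^'d) \<Rightarrow> complex"
  assumes a: "a \<in> test_functions"
  shows "partial i a \<in> test_functions"
proof -
  have sm: "smooth a" using a by (simp add: test_functions_def)
  have per: "partial i a (x + (2 * pi) *\<^sub>R real_vec k, \<xi>) = partial i a (x, \<xi>)" for x \<xi> and k :: "int^'d"
  proof -
    let ?p = "((2 * pi) *\<^sub>R real_vec k, 0) :: (real^'d) \<times> (real^'d)"
    have "((\<lambda>z. a (z + ?p)) has_derivative frechet_derivative a (at ((x, \<xi>) + ?p))) (at (x, \<xi>))"
    proof -
      have "((\<lambda>z. z + ?p) has_derivative (\<lambda>z. z)) (at (x, \<xi>))" by (auto intro!: derivative_eq_intros)
      from has_derivative_compose[OF this smooth_has_derivative[OF sm]] show ?thesis by simp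
    qed
    moreover have "(\<lambda>z. a (z + ?p)) = a"
      using test_function_periodic[OF a] by (auto simp: fun_eq_iff)
    ultimately have "(a has_derivative frechet_derivative a (at ((x, \<xi>) + ?p))) (at (x, \<xi>))" by simp
    then show ?thesis using frechet_derivative_at by fastforce
  qed
  obtain R where R: "0 < R" "\<And>x \<xi>. R < norm \<xi> \<Longrightarrow> a (x, \<xi>) = 0" using test_function_support[OF a] by blast
  have supp: "partial i a (x, \<xi>) = 0" if \<xi>: "R < norm \<xi>" for x \<xi>
  proof -
    have op: "open ((UNIV :: (real^'d) set) \<times> {\<xi> :: real^'d. R < norm \<xi>})"
      by (intro open_Times open_UNIV open_Collect_less continuous_intros)
    have "((\<lambda>_. 0) has_derivative (\<lambda>_. 0)) (at (x, \<xi>))" by simp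
    then have "(a has_derivative (\<lambda>_. 0)) (at (x, \<xi>))"
      by (rule has_derivative_transform_within_open[OF _ op]) (use R \<xi> in auto)
    then show ?thesis using frechet_derivative_at by (metis (no_types, lifting))
  qed
  show ?thesis
    unfolding test_functions_def
  proof (intro CollectI conjI)
    show "smooth (partial i a)" by (rule smooth_frechet[OF sm])
    show "\<forall>\<xi>. torus_periodic (\<lambda>x. partial i a (x, \<xi>))" using per by (simp add: torus_periodic_def)
    show "\<exists>R. \<forall>x \<xi>. norm \<xi> > R \<longrightarrow> partial i a (x, \<xi>) = 0" using supp by blast
  qed
qed

lemma borel_test_function_slice [measurable]:
  assumes "a \<in> test_functions"
  shows "(\<lambda>x. a (x, \<xi>)) \<in> borel_measurable borel"
  by (intro borel_measurable_continuous_onI continuous_on_compose2[OF test_function_continuous[OF assms]] continuous_intros) auto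

lemma fourier_coeff_bound:
  fixes f :: "real^'d \<Rightarrow> complex"
  assumes f: "f \<in> borel_measurable borel" "\<And>x. cmod (f x) \<le> B"
  shows "cmod (fourier_coeff f l) \<le> B"
proof -
  have m: "(\<lambda>x. f x * cis (- (real_vec l \<bullet> x))) \<in> borel_measurable borel"
    using f borel_character[of "- l"] by (intro borel_measurable_times) (auto simp: real_vec_minus)
  have "cmod (LINT x|torus. f x * cis (- (real_vec l \<bullet> x))) \<le> (LINT x|torus. cmod (f x * cis (- (real_vec l \<bullet> x))))"
    by (rule Bochner_Integration.integral_norm_bound)
  also have "\<dots> \<le> (LINT x|(torus :: (real^'d) measure). B)"
  proof (rule Bochner_Integration.integral_mono)
    have "integrable torus (\<lambda>x. f x * cis (- (real_vec l \<bullet> x)))"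
      by (rule integrable_torus_bounded[OF m, of B]) (simp add: norm_mult f)
    then show "integrable torus (\<lambda>x. cmod (f x * cis (- (real_vec l \<bullet> x))))" by simp
  qed (auto simp: norm_mult f)
  also have "\<dots> = (2 * pi) ^ CARD('d) * B" by (simp add: measure_torus)
  finally have "cmod (LINT x|torus. f x * cis (- (real_vec l \<bullet> x))) / (2 * pi) ^ CARD('d) \<le> B"
    by (simp add: divide_le_eq mult.commute)
  then show ?thesis by (simp add: fourier_coeff_def norm_divide norm_power norm_mult)
qed

lemma fourier_coeff_translate:
  fixes f :: "real^'d \<Rightarrow> complex"
  assumes f: "f \<in> borel_measurable borel" "\<And>x. cmod (f x) \<le> B" and per: "torus_periodic f" and s: "0 \<le> s" "s \<le> 2 * pi"
  shows "fourier_coeff (\<lambda>x. f (x + axis i s)) l = cis (real_of_int (l $ i) * s) * fourier_coeff f l"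
proof -
  let ?g = "\<lambda>x. f x * cis (- (real_vec l \<bullet> x))"
  have m: "?g \<in> borel_measurable borel"
    using f borel_character[of "- l"] by (intro borel_measurable_times) (auto simp: real_vec_minus)
  have p: "torus_periodic ?g"
    using per torus_periodic_character[of "- l"] by (simp add: torus_periodic_def real_vec_minus)
  have "f (x + axis i s) * cis (- (real_vec l \<bullet> x)) = cis (real_of_int (l $ i) * s) * ?g (x + axis i s)" for x
    by (simp add: inner_add_right inner_axis cis_mult algebra_simps)
  then have "(LINT x|torus. f (x + axis i s) * cis (- (real_vec l \<bullet> x))) = cis (real_of_int (l $ i) * s) * (LINT x|torus. ?g (x + axis i s))"
    by (simp only: integral_mult_right_zero)
  also have "(LINT x|torus. ?g (x + axis i s)) = (LINT x|torus. ?g x)"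
    by (rule torus_integral_translate[OF m _ p s, where B = B]) (simp add: norm_mult f)
  finally show ?thesis by (simp add: fourier_coeff_def)
qed

lemma vector_derivative_quotient:
  fixes f :: "real \<Rightarrow> 'a::real_normed_vector"
  assumes "(f has_vector_derivative D) (at 0)"
  shows "((\<lambda>h. (f h - f 0) /\<^sub>R h) \<longlongrightarrow> D) (at 0)"
proof -
  have "((\<lambda>h. norm (f (0 + h) - f 0 - h *\<^sub>R D) / norm h) \<longlongrightarrow> 0) (at 0)"
    using assms unfolding has_vector_derivative_def has_derivative_at by blast
  moreover have "norm (f (0 + h) - f 0 - h *\<^sub>R D) / norm h = norm ((f h - f 0) /\<^sub>R h - D)" if "h \<noteq> 0" for h
  proof -
    have "(f h - f 0) /\<^sub>R h - D = (f h - f 0 - h *\<^sub>R D) /\<^sub>R h"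
      using that by (simp add: scaleR_diff_right)
    then show ?thesis by (simp add: divide_inverse mult.commute)
  qed
  ultimately have "((\<lambda>h. norm ((f h - f 0) /\<^sub>R h - D)) \<longlongrightarrow> 0) (at 0)"
    by (elim Lim_transform_eventually) (auto simp: eventually_at_filter)
  then have "((\<lambda>h. (f h - f 0) /\<^sub>R h - D) \<longlongrightarrow> 0) (at 0)" by (rule tendsto_norm_zero_cancel)
  then show ?thesis by (rule LIM_zero_cancel)
qed

text \<open>
  Integration by parts, obtained from translation invariance: the coefficient of a difference quotient in
  direction \<open>i\<close> is a multiple of the original coefficient, and both sides converge as the step tends to 0. The
  difference quotients are dominated by the bound of the partial derivative.
\<close>

lemma fourier_coeff_partial:
  fixes a :: "(real^'d) \<times> (real^'d) \<Rightarrow> complex"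
  assumes a: "a \<in> test_functions"
  shows "fourier_coeff (\<lambda>x. partial i a (x, \<xi>)) l = \<i> * of_int (l $ i) * fourier_coeff (\<lambda>x. a (x, \<xi>)) l"
proof -
  have sm: "smooth a" using a by (simp add: test_functions_def)
  obtain B where B: "0 < B" "\<And>z. cmod (partial i a z) \<le> B"
    using test_function_bounded[OF test_function_partial[OF a]] by blast
  obtain B0 where B0: "\<And>z. cmod (a z) \<le> B0" using test_function_bounded[OF a] by blast
  define s where "s n = 1 / real (Suc n)" for n
  have s0: "0 < s n" "s n \<le> 2 * pi" for n
  proof -
    show "0 < s n" by (simp add: s_def)
    have "s n \<le> 1" by (simp add: s_def)
    then show "s n \<le> 2 * pi" using pi_gt3 by linarith
  qed
  have slim: "s \<longlonglongrightarrow> 0" unfolding s_def by (rule LIMSEQ_Suc[OF lim_1_over_n])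
  have der: "((\<lambda>t. a (x + axis i t, \<xi>)) has_vector_derivative partial i a (x + axis i t, \<xi>)) (at t)" for x t
  proof -
    have ax: "(\<lambda>t. (x + axis i t, \<xi>)) = (\<lambda>t. (x + t *\<^sub>R axis i 1, \<xi>))"
      by (auto simp: fun_eq_iff vec_eq_iff axis_def)
    have "((\<lambda>t. (x + axis i t, \<xi>)) has_derivative (\<lambda>t. t *\<^sub>R (axis i 1, 0 :: real^'d))) (at t)"
      unfolding ax by (auto intro!: derivative_eq_intros)
    from has_derivative_compose[OF this smooth_has_derivative[OF sm]]
    have "((\<lambda>t. a (x + axis i t, \<xi>)) has_derivative (\<lambda>t'. frechet_derivative a (at (x + axis i t, \<xi>)) (t' *\<^sub>R (axis i 1, 0)))) (at t)" .
    moreover have "linear (frechet_derivative a (at (x + axis i t, \<xi>)))"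
      using smooth_has_derivative[OF sm] has_derivative_linear by blast
    ultimately show ?thesis unfolding has_vector_derivative_def by (simp only: linear_scale)
  qed
  define g where "g n x = (a (x + axis i (s n), \<xi>) - a (x, \<xi>)) /\<^sub>R s n" for n x
  have g_bound: "cmod (g n x) \<le> B" for n x
  proof -
    have "\<exists>t\<in>{0<..<s n}. cmod (a (x + axis i (s n), \<xi>) - a (x + axis i 0, \<xi>)) \<le> cmod ((s n - 0) *\<^sub>R partial i a (x + axis i t, \<xi>))"
    proof (rule mvt_general[where f = "\<lambda>t. a (x + axis i t, \<xi>)" and f' = "\<lambda>t t'. t' *\<^sub>R partial i a (x + axis i t, \<xi>)"])
      show "continuous_on {0..s n} (\<lambda>t. a (x + axis i t, \<xi>))"
        using der by (intro continuous_at_imp_continuous_on ballI) (blast intro: has_vector_derivative_continuous)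
    qed (use s0 der in \<open>auto simp: has_vector_derivative_def\<close>)
    then obtain t where "cmod (a (x + axis i (s n), \<xi>) - a (x, \<xi>)) \<le> s n * cmod (partial i a (x + axis i t, \<xi>))"
      using s0[of n] by (auto simp: axis_def zero_vec_def[symmetric])
    also have "\<dots> \<le> s n * B" using B s0[of n] by (intro mult_left_mono) auto
    finally show ?thesis using s0[of n] by (simp add: g_def divide_simps mult.commute)
  qed
  have g_lim: "(\<lambda>n. g n x) \<longlonglongrightarrow> partial i a (x, \<xi>)" for x
  proof -
    have "((\<lambda>t. a (x + axis i t, \<xi>)) has_vector_derivative partial i a (x, \<xi>)) (at 0)"
      using der[of x 0] by (simp add: axis_def zero_vec_def[symmetric])
    then have "((\<lambda>h. (a (x + axis i h, \<xi>) - a (x, \<xi>)) /\<^sub>R h) \<longlongrightarrow> partial i a (x, \<xi>)) (at 0)"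
      using vector_derivative_quotient by (fastforce simp: axis_def zero_vec_def[symmetric])
    moreover have "filterlim s (at 0) sequentially"
      using slim s0(1) by (auto simp: filterlim_at less_le)
    ultimately show ?thesis unfolding g_def by (rule filterlim_compose)
  qed
  have [measurable]: "(\<lambda>x. a (x, \<xi>)) \<in> borel_measurable borel" "(\<lambda>x. partial i a (x, \<xi>)) \<in> borel_measurable borel"
    using borel_test_function_slice a test_function_partial by blast+
  have [measurable]: "(\<lambda>x. a (x + axis i t, \<xi>)) \<in> borel_measurable borel" for t
    by (intro borel_measurable_continuous_onI continuous_on_compose2[OF test_function_continuous[OF a]] continuous_intros) auto
  have cm: "(\<lambda>x. cis (- (real_vec l \<bullet> x))) \<in> borel_measurable borel"
    by (intro borel_measurable_continuous_onI continuous_intros)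
  have [measurable]: "g n \<in> borel_measurable borel" for n unfolding g_def by measurable
  have "(\<lambda>n. fourier_coeff (g n) l) \<longlonglongrightarrow> fourier_coeff (\<lambda>x. partial i a (x, \<xi>)) l"
    unfolding fourier_coeff_def
  proof (intro tendsto_divide tendsto_const integral_dominated_convergence[where w = "\<lambda>_. B"])
    show "AE x in torus. (\<lambda>n. g n x * cis (- (real_vec l \<bullet> x))) \<longlonglongrightarrow> partial i a (x, \<xi>) * cis (- (real_vec l \<bullet> x))"
      by (intro AE_I2 tendsto_mult g_lim tendsto_const)
    show "AE x in torus. cmod (g n x * cis (- (real_vec l \<bullet> x))) \<le> B" for n
      by (simp add: norm_mult g_bound)
  qed (use cm in \<open>auto intro!: borel_measurable_times measurable_torus\<close>)
  moreover have "fourier_coeff (g n) l = (cis (real_of_int (l $ i) * s n) - 1) /\<^sub>R s n * fourier_coeff (\<lambda>x. a (x, \<xi>)) l" for n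
  proof -
    have ig: "integrable torus (\<lambda>x. f x * cis (- (real_vec l \<bullet> x)))" if "f \<in> borel_measurable borel" "\<And>x. cmod (f x) \<le> B0" for f
    proof (rule integrable_torus_bounded[of _ B0])
      show "(\<lambda>x. f x * cis (- (real_vec l \<bullet> x))) \<in> borel_measurable borel"
        using that borel_character[of "- l"] by (intro borel_measurable_times) (auto simp: real_vec_minus)
    qed (simp add: norm_mult that)
    have "fourier_coeff (g n) l = (fourier_coeff (\<lambda>x. a (x + axis i (s n), \<xi>)) l - fourier_coeff (\<lambda>x. a (x, \<xi>)) l) /\<^sub>R s n"
      unfolding fourier_coeff_def g_def scaleR_conv_of_real
      using ig[of "\<lambda>x. a (x + axis i (s n), \<xi>)"] ig[of "\<lambda>x. a (x, \<xi>)"] B0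
      by (simp add: left_diff_distrib right_diff_distrib diff_divide_distrib mult.assoc)
    also have "fourier_coeff (\<lambda>x. a (x + axis i (s n), \<xi>)) l = cis (real_of_int (l $ i) * s n) * fourier_coeff (\<lambda>x. a (x, \<xi>)) l"
      using fourier_coeff_translate[of "\<lambda>x. a (x, \<xi>)" B0 "s n" i l] B0 s0[of n] a
      by (auto simp: test_functions_def less_imp_le)
    finally show ?thesis by (simp add: algebra_simps scaleR_conv_of_real)
  qed
  moreover have "(\<lambda>n. (cis (real_of_int (l $ i) * s n) - 1) /\<^sub>R s n * fourier_coeff (\<lambda>x. a (x, \<xi>)) l) \<longlonglongrightarrow> \<i> * of_int (l $ i) * fourier_coeff (\<lambda>x. a (x, \<xi>)) l"
  proof (intro tendsto_mult tendsto_const)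
    have "((\<lambda>z. exp (\<i> * of_int (l $ i) * z)) has_field_derivative exp (\<i> * of_int (l $ i) * of_real 0) * (\<i> * of_int (l $ i))) (at (of_real 0))"
      by (auto intro!: derivative_eq_intros)
    then have "((\<lambda>t. exp (\<i> * of_int (l $ i) * of_real t)) has_vector_derivative exp (\<i> * of_int (l $ i) * of_real 0) * (\<i> * of_int (l $ i))) (at 0)"
      by (rule has_vector_derivative_real_field)
    then have "((\<lambda>h. (exp (\<i> * of_int (l $ i) * of_real h) - 1) /\<^sub>R h) \<longlongrightarrow> \<i> * of_int (l $ i)) (at 0)"
      using vector_derivative_quotient by fastforce
    moreover have "filterlim s (at 0) sequentially"
      using slim s0(1) by (auto simp: filterlim_at less_le)
    ultimately have "(\<lambda>n. (exp (\<i> * of_int (l $ i) * of_real (s n)) - 1) /\<^sub>R s n) \<longlonglongrightarrow> \<i> * of_int (l $ i)"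
      by (rule filterlim_compose)
    then show "(\<lambda>n. (cis (real_of_int (l $ i) * s n) - 1) /\<^sub>R s n) \<longlonglongrightarrow> \<i> * of_int (l $ i)"
      by (simp add: cis_conv_exp mult.assoc)
  qed
  ultimately show ?thesis by (simp only: LIMSEQ_unique)
qed

definition lattice_weight :: "int^'d \<Rightarrow> real" where
  "lattice_weight l = (\<Prod>i\<in>UNIV. 1 / (1 + \<bar>real_of_int (l $ i)\<bar>)\<^sup>2)"

lemma lattice_weight_nonneg: "0 \<le> lattice_weight l"
  unfolding lattice_weight_def by (intro prod_nonneg) auto

lemma fourier_coeff_partial_iterate:
  fixes a :: "(real^'d) \<times> (real^'d) \<Rightarrow> complex"
  assumes a: "a \<in> test_functions"
  shows "(partial i ^^ n) a \<in> test_functions"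
    and "fourier_coeff (\<lambda>x. ((partial i ^^ n) a) (x, \<xi>)) l = (\<i> * of_int (l $ i)) ^ n * fourier_coeff (\<lambda>x. a (x, \<xi>)) l"
proof -
  have "(partial i ^^ n) a \<in> test_functions \<and>
    fourier_coeff (\<lambda>x. ((partial i ^^ n) a) (x, \<xi>)) l = (\<i> * of_int (l $ i)) ^ n * fourier_coeff (\<lambda>x. a (x, \<xi>)) l"
    by (induction n) (auto simp: a test_function_partial fourier_coeff_partial)
  then show "(partial i ^^ n) a \<in> test_functions"
    and "fourier_coeff (\<lambda>x. ((partial i ^^ n) a) (x, \<xi>)) l = (\<i> * of_int (l $ i)) ^ n * fourier_coeff (\<lambda>x. a (x, \<xi>)) l"
    by auto
qed

text \<open>
  Apply \<open>fourier_coeff_partial\<close> \<open>2 d\<close> times in the direction of the largest entry of \<open>l\<close>. The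
  product of \<open>d\<close> squares in \<open>lattice_weight\<close> is controlled by this entry alone.
\<close>

lemma test_function_fourier_decay:
  fixes a :: "(real^'d) \<times> (real^'d) \<Rightarrow> complex"
  assumes a: "a \<in> test_functions"
  obtains C where "0 < C" "\<And>l \<xi>. cmod (fourier_coeff (\<lambda>x. a (x, \<xi>)) l) \<le> C * lattice_weight l"
proof -
  let ?N = "2 * CARD('d)"
  obtain B0 where B0: "0 < B0" "\<And>z. cmod (a z) \<le> B0" using test_function_bounded[OF a] by blast
  have "\<exists>B. \<forall>z. cmod ((partial i ^^ ?N) a z) \<le> B" for i
    using test_function_bounded[OF fourier_coeff_partial_iterate(1)[OF a]] by metis
  then obtain B where B: "\<And>i z. cmod ((partial i ^^ ?N) a z) \<le> B i" by metis
  define C where "C = B0 + (\<Sum>i\<in>UNIV. \<bar>B i\<bar>)"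
  have CB: "B i \<le> C" "B0 \<le> C" for i
  proof -
    have "B i \<le> \<bar>B i\<bar>" by simp
    also have "\<dots> \<le> (\<Sum>i\<in>UNIV. \<bar>B i\<bar>)" by (rule member_le_sum) auto
    finally show "B i \<le> C" using B0 by (simp add: C_def)
    show "B0 \<le> C" by (simp add: C_def sum_nonneg)
  qed
  have C0: "0 < C" using B0(1) CB(2) by linarith
  show ?thesis
  proof (rule that[of "C * 2 ^ ?N"])
    fix l :: "int^'d" and \<xi> :: "real^'d"
    obtain i where i: "\<And>j. \<bar>l $ j\<bar> \<le> \<bar>l $ i\<bar>"
    proof -
      have "finite (range (\<lambda>j. \<bar>l $ j\<bar>))" by simp
      then have "Max (range (\<lambda>j. \<bar>l $ j\<bar>)) \<in> range (\<lambda>j. \<bar>l $ j\<bar>)" by (intro Max_in) auto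
      then obtain i where "Max (range (\<lambda>j. \<bar>l $ j\<bar>)) = \<bar>l $ i\<bar>" by (rule imageE)
      then show ?thesis using Max_ge[of "range (\<lambda>j. \<bar>l $ j\<bar>)"] that[of i] by auto
    qed
    define L where "L = \<bar>real_of_int (l $ i)\<bar>"
    have L0: "0 \<le> L" by (simp add: L_def)
    have w: "1 / (1 + L) ^ ?N \<le> lattice_weight l"
    proof -
      have "1 / (1 + L) ^ ?N = (\<Prod>j\<in>(UNIV :: 'd set). 1 / (1 + L)\<^sup>2)"
        by (simp add: power_mult power_one_over)
      also have "\<dots> \<le> lattice_weight l"
        unfolding lattice_weight_def
      proof (intro prod_mono conjI divide_left_mono power_mono)
        fix j show "1 + \<bar>real_of_int (l $ j)\<bar> \<le> 1 + L" using i[of j] unfolding L_def by linarith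
      qed (use L0 in \<open>auto intro!: mult_pos_pos add_pos_nonneg\<close>)
      finally show ?thesis .
    qed
    have "cmod (fourier_coeff (\<lambda>x. a (x, \<xi>)) l) \<le> C * 2 ^ ?N / (1 + L) ^ ?N"
    proof (cases "l $ i = 0")
      case True
      have "cmod (fourier_coeff (\<lambda>x. a (x, \<xi>)) l) \<le> B0"
        by (rule fourier_coeff_bound) (use a B0 in \<open>auto intro: borel_test_function_slice\<close>)
      also have "\<dots> \<le> C * 2 ^ ?N"
        using CB(2) C0 B0 mult_left_mono[of 1 "2 ^ ?N" C] by (simp add: order_trans[of B0 C])
      finally show ?thesis using True by (simp add: L_def)
    next
      case False
      then have L1: "1 \<le> L" unfolding L_def by linarith
      have "L ^ ?N * cmod (fourier_coeff (\<lambda>x. a (x, \<xi>)) l) = cmod (fourier_coeff (\<lambda>x. ((partial i ^^ ?N) a) (x, \<xi>)) l)"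
        unfolding fourier_coeff_partial_iterate(2)[OF a] by (simp add: norm_mult norm_power L_def)
      also have "\<dots> \<le> B i"
        by (rule fourier_coeff_bound)
          (use B in \<open>auto intro!: borel_test_function_slice fourier_coeff_partial_iterate(1)[OF a]\<close>)
      also have "\<dots> \<le> C" by (rule CB)
      finally have "cmod (fourier_coeff (\<lambda>x. a (x, \<xi>)) l) \<le> C / L ^ ?N"
        using L1 by (simp add: pos_le_divide_eq mult.commute)
      also have "\<dots> = C * 2 ^ ?N / (2 * L) ^ ?N" by (simp add: power_mult_distrib)
      also have "\<dots> \<le> C * 2 ^ ?N / (1 + L) ^ ?N"
        using L1 C0 by (intro divide_left_mono power_mono) auto
      finally show ?thesis .
    qed
    also have "\<dots> = C * 2 ^ ?N * (1 / (1 + L) ^ ?N)" by simp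
    also have "\<dots> \<le> C * 2 ^ ?N * lattice_weight l" using w C0 by (intro mult_left_mono) auto
    finally show "cmod (fourier_coeff (\<lambda>x. a (x, \<xi>)) l) \<le> C * 2 ^ ?N * lattice_weight l" .
  qed (use C0 in simp)
qed

lemma sum_box_prod:
  fixes w :: "'d::finite \<Rightarrow> int \<Rightarrow> real"
  assumes I: "\<And>i. finite (I i)"
  shows "(\<Sum>l\<in>{l :: int^'d. \<forall>i. l $ i \<in> I i}. \<Prod>i\<in>UNIV. w i (l $ i)) = (\<Prod>i\<in>UNIV. \<Sum>m\<in>I i. w i m)"
proof -
  have "(\<Prod>i\<in>UNIV. \<Sum>m\<in>I i. w i m) = (\<Sum>g\<in>PiE UNIV I. \<Prod>i\<in>UNIV. w i (g i))"
    by (rule prod_sum_PiE) (use I in auto)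
  also have "\<dots> = (\<Sum>l\<in>{l :: int^'d. \<forall>i. l $ i \<in> I i}. \<Prod>i\<in>UNIV. w i (l $ i))"
    by (rule sum.reindex_bij_witness[of _ vec_nth vec_lambda]) (auto simp: PiE_def)
  finally show ?thesis by simp
qed

lemma finite_box: "(\<And>i. finite (I i)) \<Longrightarrow> finite {l :: int^'d. \<forall>i. l $ i \<in> I i}"
proof -
  assume I: "\<And>i. finite (I i)"
  have "{l :: int^'d. \<forall>i. l $ i \<in> I i} = vec_lambda ` (PiE UNIV I)"
    by (auto simp: PiE_def Pi_def image_iff intro!: exI[of _ "vec_nth _"])
  then show ?thesis using I by (simp add: finite_PiE)
qed

lemma finite_modes_in_ball:
  assumes "0 < h"
  shows "finite {k :: int^'d. norm (h *\<^sub>R real_vec k) \<le> R}"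
proof -
  define b where "b = \<lceil>R / h\<rceil>"
  have "{k :: int^'d. norm (h *\<^sub>R real_vec k) \<le> R} \<subseteq> {c. \<forall>i. c $ i \<in> {- b..b}}"
  proof safe
    fix c :: "int^'d" and i assume c: "norm (h *\<^sub>R real_vec c) \<le> R"
    have "\<bar>(h *\<^sub>R real_vec c) $ i\<bar> \<le> R" using component_le_norm_cart c by (rule order_trans)
    then have "\<bar>real_of_int (c $ i)\<bar> \<le> R / h"
      using assms by (simp add: abs_mult pos_le_divide_eq mult.commute)
    then show "c $ i \<in> {- b..b}" unfolding b_def atLeastAtMost_iff by linarith
  qed
  then show ?thesis by (rule finite_subset) (rule finite_box, simp)
qed

text \<open>
  Over a box the sum factors into \<open>d\<close> sums over an interval of integers, each bounded by twice the
  sum of \<open>1 / n\<^sup>2\<close>.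
\<close>

lemma lattice_weight_summable: "(lattice_weight :: int^'d \<Rightarrow> real) summable_on UNIV"
proof -
  have "summable (\<lambda>n. 1 / (1 + real n)\<^sup>2)"
    using inverse_power_summable[of 2, where 'a = real] summable_Suc_iff[of "\<lambda>n. inverse ((of_nat n :: real)\<^sup>2)"]
    by (simp add: inverse_eq_divide add.commute)
  then obtain S where S: "\<And>n. (\<Sum>k<n. 1 / (1 + real k)\<^sup>2) \<le> S"
    using sum_le_suminf[of "\<lambda>n. 1 / (1 + real n)\<^sup>2"] by (metis (no_types, lifting) divide_nonneg_nonneg finite_lessThan zero_le_one zero_le_power2)
  have one: "(\<Sum>m\<in>{- int b..int b}. 1 / (1 + \<bar>real_of_int m\<bar>)\<^sup>2) \<le> 2 * S" for b
  proof -
    let ?f = "\<lambda>m. 1 / (1 + \<bar>real_of_int m\<bar>)\<^sup>2"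
    have "{- int b..int b} \<subseteq> int ` {..<Suc b} \<union> (\<lambda>n. - int n) ` {..<Suc b}"
    proof
      fix m assume "m \<in> {- int b..int b}"
      then show "m \<in> int ` {..<Suc b} \<union> (\<lambda>n. - int n) ` {..<Suc b}"
        by (cases "0 \<le> m") (auto simp: image_iff intro!: bexI[of _ "nat \<bar>m\<bar>"])
    qed
    then have "sum ?f {- int b..int b} \<le> sum ?f (int ` {..<Suc b} \<union> (\<lambda>n. - int n) ` {..<Suc b})"
      by (intro sum_mono2) auto
    also have "\<dots> \<le> sum ?f (int ` {..<Suc b}) + sum ?f ((\<lambda>n. - int n) ` {..<Suc b})"
      by (subst sum_Un) (auto intro: sum_nonneg)
    also have "\<dots> = (\<Sum>k<Suc b. 1 / (1 + real k)\<^sup>2) + (\<Sum>k<Suc b. 1 / (1 + real k)\<^sup>2)"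
      by (subst sum.reindex, simp add: inj_on_def, subst sum.reindex, simp add: inj_on_def) (simp add: comp_def)
    also have "\<dots> \<le> 2 * S" using S[of "Suc b"] by linarith
    finally show ?thesis .
  qed
  have "sum lattice_weight F \<le> (2 * S) ^ CARD('d)" if F: "finite F" for F :: "(int^'d) set"
  proof -
    define b where "b = nat (Max (insert 0 ((\<lambda>(l, i). \<bar>l $ i\<bar>) ` (F \<times> UNIV))))"
    have fin: "finite (insert 0 ((\<lambda>(l, i). \<bar>l $ i\<bar>) ` (F \<times> (UNIV :: 'd set))))" using F by simp
    have "\<bar>l $ i\<bar> \<le> int b" if "l \<in> F" for l i
      using Max_ge[OF fin, of "\<bar>l $ i\<bar>"] that by (force simp: b_def)
    then have sub: "F \<subseteq> {l. \<forall>i. l $ i \<in> {- int b..int b}}" by (auto simp: abs_le_iff) (smt (verit))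
    have "sum lattice_weight F \<le> sum lattice_weight {l :: int^'d. \<forall>i. l $ i \<in> {- int b..int b}}"
      by (rule sum_mono2[OF finite_box sub]) (auto simp: lattice_weight_nonneg)
    also have "\<dots> = (\<Prod>i\<in>(UNIV :: 'd set). \<Sum>m\<in>{- int b..int b}. 1 / (1 + \<bar>real_of_int m\<bar>)\<^sup>2)"
      unfolding lattice_weight_def by (rule sum_box_prod) simp
    also have "\<dots> \<le> (\<Prod>i\<in>(UNIV :: 'd set). 2 * S)"
      by (intro prod_mono conjI one sum_nonneg) auto
    finally show ?thesis by simp
  qed
  then show ?thesis
    by (intro nonneg_bdd_above_summable_on lattice_weight_nonneg bdd_aboveI2[where M = "(2 * S) ^ CARD('d)"]) auto
qed

text \<open>
  Bound \<open>|c k| |c j|\<close> by half the sum of the squares; each half then sees a full sum of \<open>\<delta>\<close> along one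
  index.
\<close>

lemma schur_test:
  fixes c :: "int^'d \<Rightarrow> complex" and K :: "int^'d \<Rightarrow> int^'d \<Rightarrow> complex"
  assumes c: "\<And>F. finite F \<Longrightarrow> (\<Sum>k\<in>F. (cmod (c k))\<^sup>2) \<le> Q"
    and K: "\<And>k j. cmod (K k j) \<le> \<delta> (j - k)"
    and \<delta>: "\<And>F. finite F \<Longrightarrow> sum \<delta> F \<le> S"
  shows "(\<lambda>(k, j). c k * cnj (c j) * K k j) summable_on UNIV"
    and "cmod (\<Sum>\<^sub>\<infinity>(k, j). c k * cnj (c j) * K k j) \<le> Q * S"
proof -
  let ?f = "\<lambda>(k, j). c k * cnj (c j) * K k j"
  have \<delta>0: "0 \<le> \<delta> l" for l using order_trans[OF norm_ge_zero K[of 0 l]] by simp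
  have Q0: "0 \<le> Q" using c[of "{}"] by simp
  have fin: "(\<Sum>z\<in>P. cmod (?f z)) \<le> Q * S" if P: "finite P" for P
  proof -
    define F where "F = fst ` P \<union> snd ` P"
    have F: "finite F" "P \<subseteq> F \<times> F" using P by (auto simp: F_def image_iff) force+
    \<comment> \<open>For fixed \<open>k\<close> the differences \<open>j - k\<close> are distinct, so their \<open>\<delta>\<close>-values sum to at most \<open>S\<close>.\<close>
    have half1: "(\<Sum>k\<in>F. \<Sum>j\<in>F. (cmod (c k))\<^sup>2 * \<delta> (j - k)) \<le> Q * S"
    proof -
      have "(\<Sum>j\<in>F. \<delta> (j - k)) \<le> S" for k
        using \<delta>[of "(\<lambda>j. j - k) ` F"] F by (simp add: sum.reindex inj_on_def)
      then have "(\<Sum>k\<in>F. \<Sum>j\<in>F. (cmod (c k))\<^sup>2 * \<delta> (j - k)) \<le> (\<Sum>k\<in>F. (cmod (c k))\<^sup>2 * S)"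
        unfolding sum_distrib_left[symmetric] by (intro sum_mono mult_left_mono) auto
      also have "\<dots> \<le> Q * S"
        unfolding sum_distrib_right[symmetric] using c[OF F(1)] \<delta>[of "{}"] by (intro mult_right_mono) auto
      finally show ?thesis .
    qed
    have half2: "(\<Sum>k\<in>F. \<Sum>j\<in>F. (cmod (c j))\<^sup>2 * \<delta> (j - k)) \<le> Q * S"
    proof -
      have "(\<Sum>k\<in>F. \<delta> (j - k)) \<le> S" for j
        using \<delta>[of "(\<lambda>k. j - k) ` F"] F by (simp add: sum.reindex inj_on_def)
      then have "(\<Sum>j\<in>F. \<Sum>k\<in>F. (cmod (c j))\<^sup>2 * \<delta> (j - k)) \<le> (\<Sum>j\<in>F. (cmod (c j))\<^sup>2 * S)"
        unfolding sum_distrib_left[symmetric] by (intro sum_mono mult_left_mono) auto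
      also have "\<dots> \<le> Q * S"
        unfolding sum_distrib_right[symmetric] using c[OF F(1)] \<delta>[of "{}"] by (intro mult_right_mono) auto
      finally show ?thesis by (subst sum.swap)
    qed
    have "(\<Sum>z\<in>P. cmod (?f z)) \<le> (\<Sum>z\<in>F \<times> F. cmod (?f z))"
      by (rule sum_mono2) (use F in auto)
    also have "\<dots> = (\<Sum>k\<in>F. \<Sum>j\<in>F. cmod (c k) * cmod (c j) * cmod (K k j))"
      by (simp add: sum.cartesian_product norm_mult case_prod_beta)
    also have "\<dots> \<le> (\<Sum>k\<in>F. \<Sum>j\<in>F. ((cmod (c k))\<^sup>2 * \<delta> (j - k) + (cmod (c j))\<^sup>2 * \<delta> (j - k)) / 2)"
    proof (intro sum_mono)
      fix k j
      have "cmod (c k) * cmod (c j) \<le> ((cmod (c k))\<^sup>2 + (cmod (c j))\<^sup>2) / 2"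
        using zero_le_power2[of "cmod (c k) - cmod (c j)"] by (simp add: power2_eq_square algebra_simps)
      then have "cmod (c k) * cmod (c j) * cmod (K k j) \<le> ((cmod (c k))\<^sup>2 + (cmod (c j))\<^sup>2) / 2 * \<delta> (j - k)"
        using K by (intro mult_mono) auto
      then show "cmod (c k) * cmod (c j) * cmod (K k j) \<le> ((cmod (c k))\<^sup>2 * \<delta> (j - k) + (cmod (c j))\<^sup>2 * \<delta> (j - k)) / 2"
        by (simp add: algebra_simps add_divide_distrib)
    qed
    also have "\<dots> = ((\<Sum>k\<in>F. \<Sum>j\<in>F. (cmod (c k))\<^sup>2 * \<delta> (j - k)) + (\<Sum>k\<in>F. \<Sum>j\<in>F. (cmod (c j))\<^sup>2 * \<delta> (j - k))) / 2"
      by (simp add: sum_divide_distrib[symmetric] sum.distrib)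
    also have "\<dots> \<le> Q * S" using half1 half2 by simp
    finally show ?thesis .
  qed
  have abs: "(\<lambda>z. cmod (?f z)) summable_on UNIV"
    by (rule nonneg_bdd_above_summable_on) (use fin in \<open>auto intro!: bdd_aboveI2[where M = "Q * S"]\<close>)
  then show "?f summable_on UNIV" by (rule abs_summable_summable)
  have "cmod (infsum ?f UNIV) \<le> (\<Sum>\<^sub>\<infinity>z. cmod (?f z))" by (rule norm_infsum_bound[OF abs])
  also have "\<dots> \<le> Q * S" by (rule infsum_le_finite_sums[OF abs]) (rule fin)
  finally show "cmod (infsum ?f UNIV) \<le> Q * S" .
qed

section \<open>Positive approximations of Wigner distributions\<close>

lemma integral_count_torus:
  fixes f :: "'c \<Rightarrow> real^'d \<Rightarrow> 'b::{banach, second_countable_topology}"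
  assumes C: "finite C" and f: "\<And>c. f c \<in> borel_measurable borel" and B: "\<And>c x. c \<in> C \<Longrightarrow> norm (f c x) \<le> B"
  shows "integrable (count_space C \<Otimes>\<^sub>M torus) (\<lambda>(c, x). f c x)"
    and "(LINT (c, x)|(count_space C \<Otimes>\<^sub>M torus). f c x) = (\<Sum>c\<in>C. LINT x|torus. f c x)"
proof -
  interpret C: finite_measure "count_space C" using C by (rule finite_measure_count_space)
  interpret P: pair_sigma_finite "count_space C" "torus :: (real^'d) measure" ..
  interpret PF: finite_measure "count_space C \<Otimes>\<^sub>M (torus :: (real^'d) measure)"
    by (rule finite_measure_pair_measure) unfold_locales
  have m: "(\<lambda>(c, x). f c x) \<in> borel_measurable (count_space C \<Otimes>\<^sub>M torus)"
    by (rule measurable_pair_measure_countable1) (use C f in \<open>auto intro: countable_finite measurable_torus\<close>)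
  show i: "integrable (count_space C \<Otimes>\<^sub>M torus) (\<lambda>(c, x). f c x)"
    by (rule PF.integrable_const_bound[OF _ m, of B]) (use B in \<open>auto simp: space_pair_measure intro!: AE_I2\<close>)
  show "(LINT (c, x)|(count_space C \<Otimes>\<^sub>M torus). f c x) = (\<Sum>c\<in>C. LINT x|torus. f c x)"
    using P.integral_fst'[OF i] C by (simp add: lebesgue_integral_count_space_finite)
qed

definition lattice_box :: "nat \<Rightarrow> int^'d \<Rightarrow> (int^'d) set" where
  "lattice_box N c = {k. \<forall>i. k $ i \<in> {c $ i..<c $ i + int N}}"

lemma finite_lattice_box [simp]: "finite (lattice_box N c)"
  unfolding lattice_box_def by (rule finite_box) simp

lemma card_box:
  assumes "\<And>i. finite (I i)"
  shows "real (card {l :: int^'d. \<forall>i. l $ i \<in> I i}) = (\<Prod>i\<in>UNIV. real (card (I i)))"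
  using sum_box_prod[of I "\<lambda>_ _. 1"] assms by simp

text \<open>
  The boxes containing both \<open>k\<close> and \<open>j\<close> start at the points of a smaller box, whose side lengths are
  \<open>N\<close> minus the distances of the coordinates.
\<close>

lemma lattice_box_pairs:
  "{c. k \<in> lattice_box N c \<and> j \<in> lattice_box N c}
    = {c :: int^'d. \<forall>i. c $ i \<in> {max (k $ i) (j $ i) - int N <.. min (k $ i) (j $ i)}}"
  by (auto simp: lattice_box_def) (smt (verit))+

lemma card_lattice_box_pairs:
  "real (card {c :: int^'d. k \<in> lattice_box N c \<and> j \<in> lattice_box N c})
    = (\<Prod>i\<in>UNIV. max 0 (real N - \<bar>real_of_int ((j - k) $ i)\<bar>))"
proof -
  have "real (nat (min (k $ i) (j $ i) - (max (k $ i) (j $ i) - int N))) = max 0 (real N - \<bar>real_of_int ((j - k) $ i)\<bar>)" for i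
    by (auto simp: max_def min_def)
  then show ?thesis unfolding lattice_box_pairs by (subst card_box) simp_all
qed

text \<open>
  Among the boxes of side \<open>N\<close> containing a given point, the proportion of those that also contain its
  translate by \<open>l\<close>.
\<close>

definition overlap :: "nat \<Rightarrow> int^'d \<Rightarrow> real" where
  "overlap N l = (\<Prod>i\<in>UNIV. max 0 (1 - \<bar>real_of_int (l $ i)\<bar> / real N))"

lemma overlap_card:
  fixes k j :: "int^'d"
  assumes "0 < N"
  shows "real (card {c. k \<in> lattice_box N c \<and> j \<in> lattice_box N c}) / real N ^ CARD('d) = overlap N (j - k)"
proof -
  have "overlap N (j - k) = (\<Prod>i\<in>(UNIV :: 'd set). max 0 (real N - \<bar>real_of_int ((j - k) $ i)\<bar>) / real N)"
    unfolding overlap_def by (rule prod.cong) (use assms in \<open>auto simp: max_def field_simps\<close>)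
  then show ?thesis by (simp add: card_lattice_box_pairs prod_dividef)
qed

lemma overlap_bounds: "0 \<le> overlap N l" "overlap N l \<le> 1"
  unfolding overlap_def by (auto intro!: prod_nonneg prod_le_1)

lemma overlap_tendsto: "(\<lambda>N. overlap N l) \<longlonglongrightarrow> 1"
proof -
  have "(\<lambda>N. \<Prod>i\<in>UNIV. max 0 (1 - \<bar>real_of_int (l $ i)\<bar> / real N)) \<longlonglongrightarrow> (\<Prod>i\<in>(UNIV :: 'a set). max 0 (1 - 0))"
    by (intro tendsto_prod tendsto_max tendsto_diff tendsto_const lim_const_over_n)
  then show ?thesis by (simp add: overlap_def)
qed

text \<open>
  The density, over the position \<open>x\<close>, of the part of \<open>u\<close> with frequencies in the box at \<open>c\<close>. The normalization
  makes the sum over all boxes count every mode once. This is a positive substitute for the Wigner distribution, in the manner of a Husimi function.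
\<close>

definition husimi_density :: "(real^'d \<Rightarrow> complex) \<Rightarrow> nat \<Rightarrow> int^'d \<Rightarrow> real^'d \<Rightarrow> real" where
  "husimi_density u N c x = (cmod (trig_poly (fourier_coeff u) (lattice_box N c) x))\<^sup>2 / ((2 * pi) ^ CARD('d) * real N ^ CARD('d))"

definition husimi :: "(real^'d \<Rightarrow> complex) \<Rightarrow> nat \<Rightarrow> (int^'d) set \<Rightarrow> ((int^'d) \<times> (real^'d)) measure" where
  "husimi u N C = density (count_space C \<Otimes>\<^sub>M torus) (\<lambda>(c, x). ennreal (husimi_density u N c x))"

lemma borel_husimi_density [measurable]: "husimi_density u N c \<in> borel_measurable borel"
  unfolding husimi_density_def by measurable

lemma husimi_density_nonneg: "0 \<le> husimi_density u N c x"
  by (simp add: husimi_density_def)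

lemma husimi_density_bounded:
  assumes "finite C"
  obtains B where "0 \<le> B" "\<And>c x. c \<in> C \<Longrightarrow> husimi_density u N c x \<le> B"
proof -
  let ?b = "\<lambda>c. (\<Sum>k\<in>lattice_box N c. cmod (fourier_coeff u k))\<^sup>2 / ((2 * pi) ^ CARD('a) * real N ^ CARD('a))"
  have 0: "0 \<le> ?b c" for c by simp
  show ?thesis
  proof (rule that[of "\<Sum>c\<in>C. ?b c"])
    fix c and x :: "real^'a" assume "c \<in> C"
    have "husimi_density u N c x \<le> ?b c"
      unfolding husimi_density_def by (intro divide_right_mono power_mono trig_poly_bound) auto
    also have "\<dots> \<le> (\<Sum>c\<in>C. ?b c)" using assms \<open>c \<in> C\<close> 0 by (intro member_le_sum) auto
    finally show "husimi_density u N c x \<le> (\<Sum>c\<in>C. ?b c)" .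
  qed (use 0 in \<open>auto intro: sum_nonneg\<close>)
qed

lemma integral_husimi:
  fixes f :: "int^'d \<Rightarrow> real^'d \<Rightarrow> complex"
  assumes C: "finite C" and f[measurable]: "\<And>c. f c \<in> borel_measurable borel" and B: "\<And>c x. cmod (f c x) \<le> B"
  shows "(LINT (c, x)|husimi u N C. f c x) = (\<Sum>c\<in>C. LINT x|torus. of_real (husimi_density u N c x) * f c x)"
proof -
  obtain B' where B': "0 \<le> B'" "\<And>c x. c \<in> C \<Longrightarrow> husimi_density u N c x \<le> B'"
    using husimi_density_bounded[OF C] by blast
  have cC: "countable C" using C by (rule countable_finite)
  define D where "D = (\<lambda>z. husimi_density u N (fst z) (snd z))"
  define F where "F = (\<lambda>z. f (fst z) (snd z))"
  have mD: "D \<in> borel_measurable (count_space C \<Otimes>\<^sub>M torus)"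
    unfolding D_def by (rule measurable_pair_measure_countable1[OF cC]) (simp add: measurable_torus)
  have mF: "F \<in> borel_measurable (count_space C \<Otimes>\<^sub>M torus)"
    unfolding F_def by (rule measurable_pair_measure_countable1[OF cC]) (simp add: measurable_torus)
  have "husimi u N C = density (count_space C \<Otimes>\<^sub>M torus) (\<lambda>z. ennreal (D z))"
    by (simp add: husimi_def D_def case_prod_beta')
  then have "(LINT (c, x)|husimi u N C. f c x) = (LINT z|density (count_space C \<Otimes>\<^sub>M torus) (\<lambda>z. ennreal (D z)). F z)"
    by (simp add: F_def case_prod_beta')
  also have "\<dots> = (LINT z|(count_space C \<Otimes>\<^sub>M torus). D z *\<^sub>R F z)"
    by (rule integral_density[OF mF mD]) (simp add: D_def husimi_density_nonneg)
  also have "\<dots> = (LINT (c, x)|(count_space C \<Otimes>\<^sub>M torus). of_real (husimi_density u N c x) * f c x)"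
    by (simp add: D_def F_def case_prod_beta' scaleR_conv_of_real)
  also have "\<dots> = (\<Sum>c\<in>C. LINT x|torus. of_real (husimi_density u N c x) * f c x)"
  proof (rule integral_count_torus(2)[OF C])
    show "(\<lambda>x. of_real (husimi_density u N c x) * f c x) \<in> borel_measurable borel" for c by measurable
    show "norm (of_real (husimi_density u N c x) * f c x) \<le> B' * B" if "c \<in> C" for c x
      unfolding norm_mult norm_of_real using B'(2)[OF that, of x] B'(1) B husimi_density_nonneg[of u N c x]
      by (intro mult_mono) auto
  qed
  finally show ?thesis .
qed

lemma finite_measure_husimi:
  assumes C: "finite C"
  shows "finite_measure (husimi u N C)"
proof (rule finite_measureI)
  interpret C: finite_measure "count_space C" using C by (rule finite_measure_count_space)
  interpret PF: finite_measure "count_space C \<Otimes>\<^sub>M (torus :: (real^'a) measure)"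
    by (rule finite_measure_pair_measure) unfold_locales
  obtain B' where B': "0 \<le> B'" "\<And>c x. c \<in> C \<Longrightarrow> husimi_density u N c x \<le> B'"
    using husimi_density_bounded[OF C] by blast
  have cC: "countable C" using C by (rule countable_finite)
  have m: "(\<lambda>(c, x). ennreal (husimi_density u N c x)) \<in> borel_measurable (count_space C \<Otimes>\<^sub>M torus)"
    by (rule measurable_pair_measure_countable1[OF cC], simp, intro measurable_torus, measurable)
  have "emeasure (husimi u N C) (space (husimi u N C))
      = (\<integral>\<^sup>+z. (case z of (c, x) \<Rightarrow> ennreal (husimi_density u N c x)) \<partial>(count_space C \<Otimes>\<^sub>M torus))"
    unfolding husimi_def by (subst emeasure_density[OF m]) (auto intro!: nn_integral_cong)
  also have "\<dots> \<le> (\<integral>\<^sup>+z. ennreal B' \<partial>(count_space C \<Otimes>\<^sub>M (torus :: (real^'a) measure)))"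
    by (rule nn_integral_mono) (use B' in \<open>auto simp: space_pair_measure intro!: ennreal_leI\<close>)
  also have "\<dots> < \<infinity>"
    by (simp add: ennreal_mult_eq_top_iff less_top[symmetric])
  finally show "emeasure (husimi u N C) (space (husimi u N C)) \<noteq> \<infinity>" by simp
qed

lemma sets_husimi: "sets (husimi u N C) = sets (count_space C \<Otimes>\<^sub>M torus)"
  by (simp add: husimi_def)

lemma space_husimi: "space (husimi u N C) = C \<times> torus_cell"
  by (simp add: husimi_def space_pair_measure)

text \<open>
  Each mode belongs to exactly \<open>N ^ d\<close> boxes.
\<close>

lemma husimi_mass:
  fixes u :: "real^'d \<Rightarrow> complex"
  assumes C: "finite C" and N: "0 < N" and Q: "\<And>F. finite F \<Longrightarrow> (\<Sum>k\<in>F. (cmod (fourier_coeff u k))\<^sup>2) \<le> Q"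
  shows "measure (husimi u N C) (space (husimi u N C)) \<le> Q"
proof -
  let ?g = "\<lambda>k. (cmod (fourier_coeff u k))\<^sup>2"
  interpret finite_measure "husimi u N C" using C by (rule finite_measure_husimi)
  define F where "F = (\<Union>c\<in>C. lattice_box N c)"
  have F: "finite F" using C by (auto simp: F_def)
  have "complex_of_real (measure (husimi u N C) (space (husimi u N C))) = (LINT (c, x)|husimi u N C. 1)"
    by (simp add: scaleR_conv_of_real case_prod_beta')
  also have "\<dots> = (\<Sum>c\<in>C. LINT x|torus. of_real (husimi_density u N c x) * 1)"
    by (rule integral_husimi[OF C, where B = 1]) auto
  also have "\<dots> = of_real (\<Sum>c\<in>C. LINT x|torus. husimi_density u N c x)" by simp
  finally have "measure (husimi u N C) (space (husimi u N C)) = (\<Sum>c\<in>C. LINT x|torus. husimi_density u N c x)"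
    by (simp only: of_real_eq_iff)
  also have "\<dots> = (\<Sum>c\<in>C. (\<Sum>k\<in>lattice_box N c. ?g k) / real N ^ CARD('d))"
    by (rule sum.cong) (simp_all add: husimi_density_def torus_integral_trig_poly_norm)
  also have "\<dots> = (\<Sum>c\<in>C. \<Sum>k\<in>F. if k \<in> lattice_box N c then ?g k else 0) / real N ^ CARD('d)"
  proof -
    have "(\<Sum>k\<in>lattice_box N c. ?g k) = (\<Sum>k\<in>F. if k \<in> lattice_box N c then ?g k else 0)" if "c \<in> C" for c
    proof -
      have "{k \<in> F. k \<in> lattice_box N c} = lattice_box N c" using that by (auto simp: F_def)
      then show ?thesis using sum.inter_filter[OF F, of ?g "\<lambda>k. k \<in> lattice_box N c"] by simp
    qed
    then show ?thesis by (simp add: sum_divide_distrib)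
  qed
  also have "(\<Sum>c\<in>C. \<Sum>k\<in>F. if k \<in> lattice_box N c then ?g k else 0) = (\<Sum>k\<in>F. \<Sum>c\<in>C. if k \<in> lattice_box N c then ?g k else 0)"
    by (rule sum.swap)
  also have "\<dots> \<le> (\<Sum>k\<in>F. real N ^ CARD('d) * ?g k)"
  proof (rule sum_mono)
    fix k
    have "{c :: int^'d. k \<in> lattice_box N c} = {c. \<forall>i. c $ i \<in> {k $ i - int N<..k $ i}}"
      using lattice_box_pairs[of k N k] by (simp only: conj_absorb max.idem min.idem)
    then have fin: "finite {c :: int^'d. k \<in> lattice_box N c}"
      using finite_box[of "\<lambda>i. {k $ i - int N<..k $ i}"] by simp
    have "real (card {c\<in>C. k \<in> lattice_box N c}) \<le> real (card {c :: int^'d. k \<in> lattice_box N c \<and> k \<in> lattice_box N c})"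
      using fin by (intro of_nat_mono card_mono) auto
    also have "\<dots> = real N ^ CARD('d)" by (simp only: card_lattice_box_pairs) simp
    finally have "real (card {c\<in>C. k \<in> lattice_box N c}) * ?g k \<le> real N ^ CARD('d) * ?g k" by (rule mult_right_mono) simp
    then show "(\<Sum>c\<in>C. if k \<in> lattice_box N c then ?g k else 0) \<le> real N ^ CARD('d) * ?g k"
      using C by (simp add: sum.inter_filter[symmetric])
  qed
  also have "(\<Sum>k\<in>F. real N ^ CARD('d) * ?g k) / real N ^ CARD('d) = (\<Sum>k\<in>F. ?g k)"
    using N by (simp add: sum_distrib_left[symmetric])
  also have "\<dots> \<le> Q" using F by (rule Q)
  finally show ?thesis using N by (simp add: divide_right_mono)
qed

lemma integral_husimi_test_function:
  fixes u :: "real^'d \<Rightarrow> complex" and a :: "(real^'d) \<times> (real^'d) \<Rightarrow> complex"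
  assumes C: "finite C" and a: "a \<in> test_functions"
  shows "(LINT (c, x)|husimi u N C. a (x, h *\<^sub>R real_vec c))
    = (\<Sum>c\<in>C. \<Sum>k\<in>lattice_box N c. \<Sum>j\<in>lattice_box N c. fourier_coeff u k * cnj (fourier_coeff u j)
         * fourier_coeff (\<lambda>x. a (x, h *\<^sub>R real_vec c)) (j - k) / of_nat N ^ CARD('d))"
proof -
  let ?c = "fourier_coeff u" and ?D = "(2 * pi) ^ CARD('d) * real N ^ CARD('d)"
  obtain B where B: "0 < B" "\<And>z. cmod (a z) \<le> B" using test_function_bounded[OF a] by blast
  have "(LINT (c, x)|husimi u N C. a (x, h *\<^sub>R real_vec c)) = (\<Sum>c\<in>C. LINT x|torus. of_real (husimi_density u N c x) * a (x, h *\<^sub>R real_vec c))"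
    by (rule integral_husimi[OF C, of _ B]) (use B a in \<open>auto intro: borel_test_function_slice\<close>)
  also have "\<dots> = (\<Sum>c\<in>C. \<Sum>k\<in>lattice_box N c. \<Sum>j\<in>lattice_box N c. ?c k * cnj (?c j)
         * fourier_coeff (\<lambda>x. a (x, h *\<^sub>R real_vec c)) (j - k) / of_nat N ^ CARD('d))"
  proof (rule sum.cong[OF refl])
    fix c
    let ?b = "\<lambda>x. a (x, h *\<^sub>R real_vec c)"
    have i: "integrable torus (\<lambda>x. ?b x * cis (- (real_vec (j - k) \<bullet> x)))" for j k
    proof (rule integrable_torus_bounded[of _ B])
      show "(\<lambda>x. ?b x * cis (- (real_vec (j - k) \<bullet> x))) \<in> borel_measurable borel"
        using borel_test_function_slice[OF a] by (intro borel_measurable_times borel_character_minus)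
    qed (simp add: norm_mult B)
    have pt: "of_real (husimi_density u N c x) * ?b x
        = (\<Sum>k\<in>lattice_box N c. \<Sum>j\<in>lattice_box N c. (?c k * cnj (?c j) / of_real ?D) * (?b x * cis (- (real_vec (j - k) \<bullet> x))))" for x
    proof -
      have "of_real (husimi_density u N c x) * ?b x = of_real ((cmod (trig_poly ?c (lattice_box N c) x))\<^sup>2) * (?b x / of_real ?D)"
        by (simp add: husimi_density_def)
      also have "\<dots> = (\<Sum>k\<in>lattice_box N c. \<Sum>j\<in>lattice_box N c. ?c k * cnj (?c j) * cis (real_vec (k - j) \<bullet> x) * (?b x / of_real ?D))"
        unfolding trig_poly_norm_sq sum_distrib_right ..
      also have "\<dots> = (\<Sum>k\<in>lattice_box N c. \<Sum>j\<in>lattice_box N c. (?c k * cnj (?c j) / of_real ?D) * (?b x * cis (- (real_vec (j - k) \<bullet> x))))"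
        by (intro sum.cong refl) (simp add: real_vec_diff inner_diff_left)
      finally show ?thesis .
    qed
    have "(LINT x|torus. of_real (husimi_density u N c x) * ?b x)
        = (\<Sum>k\<in>lattice_box N c. \<Sum>j\<in>lattice_box N c. (?c k * cnj (?c j) / of_real ?D) * (LINT x|torus. ?b x * cis (- (real_vec (j - k) \<bullet> x))))"
      unfolding pt
      by (subst Bochner_Integration.integral_sum, intro Bochner_Integration.integrable_sum integrable_mult_right i,
          rule sum.cong[OF refl], subst Bochner_Integration.integral_sum,
          intro integrable_mult_right i, simp)
    also have "\<dots> = (\<Sum>k\<in>lattice_box N c. \<Sum>j\<in>lattice_box N c. ?c k * cnj (?c j) * fourier_coeff ?b (j - k) / of_nat N ^ CARD('d))"
      by (intro sum.cong refl) (simp add: fourier_coeff_def)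
    finally show "(LINT x|torus. of_real (husimi_density u N c x) * ?b x)
        = (\<Sum>k\<in>lattice_box N c. \<Sum>j\<in>lattice_box N c. ?c k * cnj (?c j) * fourier_coeff ?b (j - k) / of_nat N ^ CARD('d))" .
  qed
  finally show ?thesis .
qed

text \<open>
  The matrix of the quadratic form in the Fourier coefficients of \<open>u\<close> that tests the averaged densities
  against \<open>a\<close>.
\<close>

definition husimi_kernel :: "((real^'d) \<times> (real^'d) \<Rightarrow> complex) \<Rightarrow> real \<Rightarrow> nat \<Rightarrow> (int^'d) set \<Rightarrow> int^'d \<Rightarrow> int^'d \<Rightarrow> complex" where
  "husimi_kernel a h N C k j =
     (\<Sum>c\<in>{c\<in>C. k \<in> lattice_box N c \<and> j \<in> lattice_box N c}. fourier_coeff (\<lambda>x. a (x, h *\<^sub>R real_vec c)) (j - k)) / of_nat N ^ CARD('d)"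

lemma integral_husimi_kernel:
  fixes u :: "real^'d \<Rightarrow> complex" and a :: "(real^'d) \<times> (real^'d) \<Rightarrow> complex"
  assumes C: "finite C" and a: "a \<in> test_functions"
  shows "((\<lambda>(k, j). fourier_coeff u k * cnj (fourier_coeff u j) * husimi_kernel a h N C k j)
     has_sum (LINT (c, x)|husimi u N C. a (x, h *\<^sub>R real_vec c))) UNIV"
proof -
  let ?c = "fourier_coeff u" and ?b = "\<lambda>c l. fourier_coeff (\<lambda>x. a (x, h *\<^sub>R real_vec c)) l / of_nat N ^ CARD('d)"
  define F where "F = (\<Union>c\<in>C. lattice_box N c)"
  have F: "finite F" using C by (auto simp: F_def)
  have ext: "(\<Sum>k\<in>lattice_box N c. g k) = (\<Sum>k\<in>F. if k \<in> lattice_box N c then g k else 0)" if "c \<in> C" for c and g :: "int^'d \<Rightarrow> complex"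
  proof -
    have "{k \<in> F. k \<in> lattice_box N c} = lattice_box N c" using that by (auto simp: F_def)
    then show ?thesis using sum.inter_filter[OF F, of g "\<lambda>k. k \<in> lattice_box N c"] by simp
  qed
  have "(LINT (c, x)|husimi u N C. a (x, h *\<^sub>R real_vec c))
      = (\<Sum>c\<in>C. \<Sum>k\<in>lattice_box N c. \<Sum>j\<in>lattice_box N c. ?c k * cnj (?c j) * ?b c (j - k))"
    unfolding integral_husimi_test_function[OF C a] by simp
  also have "\<dots> = (\<Sum>c\<in>C. \<Sum>k\<in>F. \<Sum>j\<in>F. if k \<in> lattice_box N c \<and> j \<in> lattice_box N c then ?c k * cnj (?c j) * ?b c (j - k) else 0)"
  proof (rule sum.cong[OF refl])
    fix c assume c: "c \<in> C"
    let ?T = "\<lambda>k j. ?c k * cnj (?c j) * ?b c (j - k)"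
    have "(\<Sum>k\<in>lattice_box N c. \<Sum>j\<in>lattice_box N c. ?T k j)
        = (\<Sum>k\<in>lattice_box N c. \<Sum>j\<in>F. if j \<in> lattice_box N c then ?T k j else 0)"
      by (intro sum.cong refl ext[OF c])
    also have "\<dots> = (\<Sum>k\<in>F. if k \<in> lattice_box N c then \<Sum>j\<in>F. if j \<in> lattice_box N c then ?T k j else 0 else 0)"
      by (rule ext[OF c])
    also have "\<dots> = (\<Sum>k\<in>F. \<Sum>j\<in>F. if k \<in> lattice_box N c \<and> j \<in> lattice_box N c then ?T k j else 0)"
      by (rule sum.cong) auto
    finally show "(\<Sum>k\<in>lattice_box N c. \<Sum>j\<in>lattice_box N c. ?T k j)
        = (\<Sum>k\<in>F. \<Sum>j\<in>F. if k \<in> lattice_box N c \<and> j \<in> lattice_box N c then ?T k j else 0)" .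
  qed
  also have "\<dots> = (\<Sum>k\<in>F. \<Sum>j\<in>F. \<Sum>c\<in>C. if k \<in> lattice_box N c \<and> j \<in> lattice_box N c then ?c k * cnj (?c j) * ?b c (j - k) else 0)"
    by (subst sum.swap, rule sum.cong[OF refl], rule sum.swap)
  also have "\<dots> = (\<Sum>k\<in>F. \<Sum>j\<in>F. ?c k * cnj (?c j) * husimi_kernel a h N C k j)"
    using C by (intro sum.cong refl) (simp add: husimi_kernel_def sum.inter_filter[symmetric] sum_distrib_left sum_divide_distrib)
  also have "\<dots> = (\<Sum>(k, j)\<in>F \<times> F. ?c k * cnj (?c j) * husimi_kernel a h N C k j)"
    by (rule sum.cartesian_product)
  finally have eq: "(LINT (c, x)|husimi u N C. a (x, h *\<^sub>R real_vec c)) = (\<Sum>(k, j)\<in>F \<times> F. ?c k * cnj (?c j) * husimi_kernel a h N C k j)" .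
  show ?thesis
    unfolding eq
  proof (rule has_sum_finite_neutralI)
    fix z assume "z \<in> UNIV - F \<times> F"
    then obtain k j where z: "z = (k, j)" "k \<notin> F \<or> j \<notin> F" by (cases z) auto
    then have "{c\<in>C. k \<in> lattice_box N c \<and> j \<in> lattice_box N c} = {}" by (auto simp: F_def)
    then show "(case z of (k, j) \<Rightarrow> ?c k * cnj (?c j) * husimi_kernel a h N C k j) = 0"
      by (simp add: z husimi_kernel_def del: Collect_empty_eq)
  qed (use F in auto)
qed

lemma midpoint_near:
  fixes x y c n :: real
  assumes "c \<le> x" "c \<le> y" "x < c + n" "y < c + n"
  shows "\<bar>(x + y) / 2 - c\<bar> \<le> n"
proof (rule abs_leI)
  show "(x + y) / 2 - c \<le> n" using assms by (simp add: field_simps)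
  show "- ((x + y) / 2 - c) \<le> n" using assms by (simp add: field_simps)
qed

text \<open>
  A box that contains \<open>k\<close> and \<open>j\<close> starts within distance \<open>N\<close> of their midpoint in every
  coordinate. Replacing the midpoint in the Wigner form by such starting points costs the oscillation of \<open>a\<close> at scale
  \<open>h N\<close>; the missing proportion of boxes costs \<open>1 - overlap\<close>.
\<close>

lemma wigner_kernel_error:
  fixes a :: "(real^'d) \<times> (real^'d) \<Rightarrow> complex"
  assumes a: "a \<in> test_functions" and N: "0 < N" and C: "finite C"
    and supp: "\<And>c x. c \<notin> C \<Longrightarrow> a (x, h *\<^sub>R real_vec c) = 0"
    and A: "\<And>\<xi>. cmod (fourier_coeff (\<lambda>x. a (x, \<xi>)) (j - k)) \<le> A"
  defines "E \<equiv> fourier_coeff (\<lambda>x. a (x, (h / 2) *\<^sub>R real_vec (k + j))) (j - k) - husimi_kernel a h N C k j"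
  shows "cmod E \<le> 2 * A"
    and "\<lbrakk>\<And>x \<xi> \<xi>'. dist \<xi> \<xi>' < \<delta> \<Longrightarrow> cmod (a (x, \<xi>) - a (x, \<xi>')) < e; real CARD('d) * (\<bar>h\<bar> * real N) < \<delta>\<rbrakk>
      \<Longrightarrow> cmod E \<le> (1 - overlap N (j - k)) * A + e"
proof -
  let ?b = "\<lambda>\<xi>. fourier_coeff (\<lambda>x. a (x, \<xi>)) (j - k)"
  define S where "S = {c :: int^'d. k \<in> lattice_box N c \<and> j \<in> lattice_box N c}"
  define \<xi>0 where "\<xi>0 = (h / 2) *\<^sub>R real_vec (k + j)"
  define M where "M = real N ^ CARD('d)"
  have M: "0 < M" using N by (simp add: M_def)
  have S: "finite S" unfolding S_def lattice_box_pairs by (rule finite_box) simp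
  have A0: "0 \<le> A" using order_trans[OF norm_ge_zero A] .
  have th: "real (card S) / M = overlap N (j - k)" unfolding S_def M_def by (rule overlap_card[OF N])
  have "(\<Sum>c\<in>{c\<in>C. k \<in> lattice_box N c \<and> j \<in> lattice_box N c}. ?b (h *\<^sub>R real_vec c)) = (\<Sum>c\<in>S. ?b (h *\<^sub>R real_vec c))"
  proof (rule sum.mono_neutral_left[OF S])
    have "?b (h *\<^sub>R real_vec c) = 0" if "c \<notin> C" for c
      using supp[OF that] by (simp add: fourier_coeff_def)
    then show "\<forall>c\<in>S - {c\<in>C. k \<in> lattice_box N c \<and> j \<in> lattice_box N c}. ?b (h *\<^sub>R real_vec c) = 0"
      unfolding S_def by blast
  qed (auto simp: S_def)
  then have ker: "husimi_kernel a h N C k j = (\<Sum>c\<in>S. ?b (h *\<^sub>R real_vec c)) / of_real M"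
    by (simp add: husimi_kernel_def M_def)
  have "cmod (husimi_kernel a h N C k j) \<le> (\<Sum>c\<in>S. A) / M"
    unfolding ker norm_divide using M by (intro frac_le sum_norm_le A sum_nonneg A0) auto
  also have "\<dots> = overlap N (j - k) * A" by (simp add: th[symmetric])
  also have "\<dots> \<le> A" using overlap_bounds[of N "j - k"] A0 mult_right_mono[of "overlap N (j - k)" 1 A] by simp
  finally have "cmod (husimi_kernel a h N C k j) \<le> A" .
  then show "cmod E \<le> 2 * A"
    unfolding E_def using A[of "(h / 2) *\<^sub>R real_vec (k + j)"] by (intro order_trans[OF norm_triangle_ineq4]) simp
  assume cont: "\<And>x \<xi> \<xi>'. dist \<xi> \<xi>' < \<delta> \<Longrightarrow> cmod (a (x, \<xi>) - a (x, \<xi>')) < e" and \<delta>: "real CARD('d) * (\<bar>h\<bar> * real N) < \<delta>"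
  have e0: "0 \<le> e"
  proof -
    have "0 \<le> real CARD('d) * (\<bar>h\<bar> * real N)" by simp
    then have "0 < \<delta>" using \<delta> by linarith
    then show ?thesis using cont[of 0 0 0] by simp
  qed
  have close: "cmod (?b \<xi>0 - ?b (h *\<^sub>R real_vec c)) \<le> e" if c: "c \<in> S" for c
  proof -
    let ?v = "\<xi>0 - h *\<^sub>R real_vec c"
    have "\<bar>?v $ i\<bar> \<le> \<bar>h\<bar> * real N" for i
    proof -
      have k: "c $ i \<le> k $ i" "k $ i < c $ i + int N" and j: "c $ i \<le> j $ i" "j $ i < c $ i + int N"
        using c by (auto simp: S_def lattice_box_def)
      have "?v $ i = h * ((real_of_int (k $ i) + real_of_int (j $ i)) / 2 - real_of_int (c $ i))"
        by (simp add: \<xi>0_def algebra_simps)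
      moreover have "\<bar>(real_of_int (k $ i) + real_of_int (j $ i)) / 2 - real_of_int (c $ i)\<bar> \<le> real N"
      proof -
        have "real_of_int (c $ i) \<le> real_of_int (k $ i)" "real_of_int (c $ i) \<le> real_of_int (j $ i)"
          using k j by (simp_all only: of_int_le_iff)
        moreover have "real_of_int (k $ i) < real_of_int (c $ i + int N)" "real_of_int (j $ i) < real_of_int (c $ i + int N)"
          using k j by (simp_all only: of_int_less_iff)
        ultimately show ?thesis unfolding of_int_add of_int_of_nat_eq by (rule midpoint_near)
      qed
      ultimately show ?thesis by (simp add: abs_mult mult_left_mono)
    qed
    then have "(\<Sum>i\<in>UNIV. \<bar>?v $ i\<bar>) \<le> (\<Sum>i\<in>(UNIV :: 'd set). \<bar>h\<bar> * real N)" by (intro sum_mono)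
    then have "norm ?v < \<delta>" using norm_le_l1_cart[of ?v] \<delta> by simp
    then have d: "dist \<xi>0 (h *\<^sub>R real_vec c) < \<delta>" by (simp add: dist_norm)
    have "?b \<xi>0 - ?b (h *\<^sub>R real_vec c) = fourier_coeff (\<lambda>x. a (x, \<xi>0) - a (x, h *\<^sub>R real_vec c)) (j - k)"
    proof -
      obtain B where B: "0 < B" "\<And>z. cmod (a z) \<le> B" using test_function_bounded[OF a] by blast
      have i: "integrable torus (\<lambda>x. a (x, \<xi>) * cis (- (real_vec (j - k) \<bullet> x)))" for \<xi>
      proof (rule integrable_torus_bounded[of _ B])
        show "(\<lambda>x. a (x, \<xi>) * cis (- (real_vec (j - k) \<bullet> x))) \<in> borel_measurable borel"
          using borel_test_function_slice[OF a] by (intro borel_measurable_times borel_character_minus)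
      qed (simp add: norm_mult B)
      show ?thesis
        unfolding fourier_coeff_def left_diff_distrib
        using i by (simp add: diff_divide_distrib)
    qed
    also have "cmod \<dots> \<le> e"
    proof (rule fourier_coeff_bound)
      show "(\<lambda>x. a (x, \<xi>0) - a (x, h *\<^sub>R real_vec c)) \<in> borel_measurable borel"
        using borel_test_function_slice[OF a] by (intro borel_measurable_diff) auto
    qed (use cont[OF d] in \<open>simp add: less_imp_le\<close>)
    finally show ?thesis .
  qed
  have eqE: "E = (1 - of_real (overlap N (j - k))) * ?b \<xi>0 + (\<Sum>c\<in>S. ?b \<xi>0 - ?b (h *\<^sub>R real_vec c)) / of_real M"
  proof -
    have alg: "b - T / M' = (1 - K / M') * b + (K * b - T) / M'" for b T K M' :: complex
      by (simp add: left_diff_distrib diff_divide_distrib)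
    have "(\<Sum>c\<in>S. ?b \<xi>0 - ?b (h *\<^sub>R real_vec c)) = of_nat (card S) * ?b \<xi>0 - (\<Sum>c\<in>S. ?b (h *\<^sub>R real_vec c))"
      by (simp only: sum_subtractf sum_constant)
    then show ?thesis
      unfolding E_def ker \<xi>0_def[symmetric] th[symmetric] of_real_divide of_real_of_nat_eq by (simp only:) (rule alg)
  qed
  have "cmod ((1 - of_real (overlap N (j - k))) * ?b \<xi>0) \<le> (1 - overlap N (j - k)) * A"
  proof -
    have "cmod (complex_of_real (1 - overlap N (j - k))) = 1 - overlap N (j - k)"
      unfolding norm_of_real using overlap_bounds[of N "j - k"] by simp
    then have "cmod (1 - of_real (overlap N (j - k))) = 1 - overlap N (j - k)" by simp
    then show ?thesis using overlap_bounds[of N "j - k"] by (simp add: norm_mult mult_left_mono A)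
  qed
  moreover have "cmod ((\<Sum>c\<in>S. ?b \<xi>0 - ?b (h *\<^sub>R real_vec c)) / of_real M) \<le> e"
  proof -
    have "cmod ((\<Sum>c\<in>S. ?b \<xi>0 - ?b (h *\<^sub>R real_vec c)) / of_real M) \<le> (\<Sum>c\<in>S. e) / M"
      unfolding norm_divide using M by (intro frac_le sum_norm_le close sum_nonneg e0) auto
    also have "\<dots> = overlap N (j - k) * e" by (simp add: th[symmetric])
    also have "\<dots> \<le> e" using overlap_bounds[of N "j - k"] e0 mult_right_mono[of "overlap N (j - k)" 1 e] by simp
    finally show ?thesis .
  qed
  moreover have "cmod E \<le> cmod ((1 - of_real (overlap N (j - k))) * ?b \<xi>0) + cmod ((\<Sum>c\<in>S. ?b \<xi>0 - ?b (h *\<^sub>R real_vec c)) / of_real M)" unfolding eqE by (rule norm_triangle_ineq)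
  ultimately show "cmod E \<le> (1 - overlap N (j - k)) * A + e" by linarith
qed

section \<open>Existence of semiclassical measures\<close>

lemma summable_on_small_tail:
  fixes f :: "'a \<Rightarrow> real"
  assumes f: "f summable_on UNIV" and f0: "\<And>x. 0 \<le> f x" and e: "0 < e"
  obtains L where "finite L" "\<And>F. finite F \<Longrightarrow> F \<inter> L = {} \<Longrightarrow> sum f F \<le> e"
proof -
  have lim: "(sum f \<longlongrightarrow> infsum f UNIV) (finite_subsets_at_top UNIV)"
    using f by (simp add: has_sum_def[symmetric])
  then have "eventually (\<lambda>L. infsum f UNIV - e < sum f L) (finite_subsets_at_top UNIV)"
    using e by (intro order_tendstoD(1)) auto
  then obtain L where L: "finite L" "infsum f UNIV - e < sum f L"
    unfolding eventually_finite_subsets_at_top by blast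
  show ?thesis
  proof (rule that[OF L(1)])
    fix F assume F: "finite F" "F \<inter> L = {}"
    have "sum f F + sum f L = sum f (F \<union> L)" using F L by (simp add: sum.union_disjoint)
    also have "\<dots> \<le> infsum f UNIV" using f f0 F L by (intro finite_sum_le_infsum) auto
    finally show "sum f F \<le> e" using L by simp
  qed
qed

text \<open>
  The errors of the kernel tend to 0 for each fixed difference \<open>l = j - k\<close>, and they are dominated by
  a summable function of \<open>l\<close>. Hence their sum over \<open>l\<close> tends to 0, and the Schur test turns this sum into a bound for
  the quadratic form.
\<close>

theorem husimi_approximates_wigner:
  fixes u :: "nat \<Rightarrow> real^'d \<Rightarrow> complex" and a :: "(real^'d) \<times> (real^'d) \<Rightarrow> complex"
  assumes Q: "\<And>n F. finite F \<Longrightarrow> (\<Sum>k\<in>F. (cmod (fourier_coeff (u n) k))\<^sup>2) \<le> Q"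
    and a: "a \<in> test_functions"
    and N: "\<And>n. 0 < N n" "filterlim N at_top sequentially" "(\<lambda>n. \<bar>h n\<bar> * real (N n)) \<longlonglongrightarrow> 0"
    and C: "\<And>n. finite (C n)" "\<And>R. eventually (\<lambda>n. \<forall>c. norm (h n *\<^sub>R real_vec c) \<le> R \<longrightarrow> c \<in> C n) sequentially"
  shows "(\<lambda>n. wigner (h n) (u n) a - (LINT (c, x)|husimi (u n) (N n) (C n). a (x, h n *\<^sub>R real_vec c))) \<longlonglongrightarrow> 0"
proof -
  obtain R where R: "0 < R" "\<And>x \<xi>. R < norm \<xi> \<Longrightarrow> a (x, \<xi>) = 0" using test_function_support[OF a] by blast
  obtain D where D: "0 < D" "\<And>l \<xi>. cmod (fourier_coeff (\<lambda>x. a (x, \<xi>)) l) \<le> D * lattice_weight l"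
    using test_function_fourier_decay[OF a] by blast
  define A where "A l = D * lattice_weight l" for l :: "int^'d"
  have A0: "0 \<le> A l" for l using D(1) lattice_weight_nonneg[of l] by (simp add: A_def)
  have As: "A summable_on UNIV" unfolding A_def by (intro summable_on_cmult_right lattice_weight_summable)
  have Q0: "0 \<le> Q" using Q[of "{}"] by simp
  let ?c = "\<lambda>n. fourier_coeff (u n)"
  let ?W = "\<lambda>n k j. fourier_coeff (\<lambda>x. a (x, (h n / 2) *\<^sub>R real_vec (k + j))) (j - k)"
  let ?K = "\<lambda>n k j. husimi_kernel a (h n) (N n) (C n) k j"
  \<comment> \<open>The value of \<open>infsum\<close> is meaningful: the Wigner sum converges absolutely.\<close>
  have T1: "(\<lambda>(k, j). ?c n k * cnj (?c n j) * ?W n k j) summable_on UNIV" for n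
  proof (rule schur_test(1)[where \<delta> = A and S = "infsum A UNIV"])
    show "sum A F \<le> infsum A UNIV" if "finite F" for F
      using that As A0 by (intro finite_sum_le_infsum) auto
  qed (use Q D in \<open>auto simp: A_def\<close>)
  have diff: "wigner (h n) (u n) a - (LINT (c, x)|husimi (u n) (N n) (C n). a (x, h n *\<^sub>R real_vec c))
      = (\<Sum>\<^sub>\<infinity>(k, j). ?c n k * cnj (?c n j) * (?W n k j - ?K n k j))" for n
  proof -
    have "((\<lambda>(k, j). ?c n k * cnj (?c n j) * ?W n k j) has_sum wigner (h n) (u n) a) UNIV"
      using T1[of n] by (simp add: wigner_def)
    from has_sum_add[OF this has_sum_uminusI[OF integral_husimi_kernel[OF C(1) a]]]
    have "((\<lambda>(k, j). ?c n k * cnj (?c n j) * (?W n k j - ?K n k j))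
        has_sum (wigner (h n) (u n) a - (LINT (c, x)|husimi (u n) (N n) (C n). a (x, h n *\<^sub>R real_vec c)))) UNIV"
      by (simp add: case_prod_beta' right_diff_distrib)
    then show ?thesis by (rule infsumI[symmetric])
  qed
  show ?thesis
  proof (rule LIMSEQ_I)
    fix r :: real assume r: "0 < r"
    define e where "e = r / (2 * (Q + 1))"
    have e: "0 < e" using r Q0 by (simp add: e_def)
    obtain L where L: "finite L" "\<And>F. finite F \<Longrightarrow> F \<inter> L = {} \<Longrightarrow> sum (\<lambda>l. 2 * A l) F \<le> e"
      using summable_on_small_tail[of "\<lambda>l. 2 * A l" e] As A0 e by (auto intro: summable_on_cmult_right)
    define e1 where "e1 = e / (real (card L) + 1)"
    have e1: "0 < e1" using e by (simp add: e1_def)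
    obtain \<delta> where \<delta>: "0 < \<delta>" "\<And>x \<xi> \<xi>'. dist \<xi> \<xi>' < \<delta> \<Longrightarrow> cmod (a (x, \<xi>) - a (x, \<xi>')) < e1 / 2"
      using test_function_uniformly_continuous[OF a, of "e1 / 2"] e1 by auto
    have "eventually (\<lambda>n. \<forall>l\<in>L. (1 - overlap (N n) l) * A l < e1 / 2) sequentially"
    proof (intro eventually_ball_finite[OF L(1)] ballI)
      fix l assume "l \<in> L"
      have "(\<lambda>n. (1 - overlap (N n) l) * A l) \<longlonglongrightarrow> (1 - 1) * A l"
        by (intro tendsto_intros filterlim_compose[OF overlap_tendsto N(2)])
      then show "eventually (\<lambda>n. (1 - overlap (N n) l) * A l < e1 / 2) sequentially"
        using e1 by (intro order_tendstoD(2)) auto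
    qed
    moreover have "eventually (\<lambda>n. real CARD('d) * (\<bar>h n\<bar> * real (N n)) < \<delta>) sequentially"
      using \<delta>(1) tendsto_mult_right_zero[OF N(3), of "real CARD('d)"] by (intro order_tendstoD(2)) auto
    moreover have "eventually (\<lambda>n. \<forall>c. norm (h n *\<^sub>R real_vec c) \<le> R \<longrightarrow> c \<in> C n) sequentially" by (rule C(2))
    ultimately have "eventually (\<lambda>n. norm (wigner (h n) (u n) a - (LINT (c, x)|husimi (u n) (N n) (C n). a (x, h n *\<^sub>R real_vec c)) - 0) < r) sequentially"
    proof eventually_elim
      case (elim n)
      define \<gamma> where "\<gamma> l = (if l \<in> L then e1 else 2 * A l)" for l
      have supp: "a (x, h n *\<^sub>R real_vec c) = 0" if "c \<notin> C n" for c x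
        using elim(3) R(2) that by (meson not_le)
      have "cmod (?W n k j - ?K n k j) \<le> \<gamma> (j - k)" for k j
      proof (cases "j - k \<in> L")
        case True
        have "cmod (?W n k j - ?K n k j) \<le> (1 - overlap (N n) (j - k)) * A (j - k) + e1 / 2"
          by (rule wigner_kernel_error(2)[OF a N(1) C(1) supp _ \<delta>(2) elim(2)]) (use D in \<open>auto simp: A_def\<close>)
        also have "\<dots> \<le> e1" using elim(1) True by fastforce
        finally show ?thesis using True by (simp add: \<gamma>_def)
      next
        case False
        have "cmod (?W n k j - ?K n k j) \<le> 2 * A (j - k)"
          by (rule wigner_kernel_error(1)[OF a N(1) C(1) supp]) (use D in \<open>auto simp: A_def\<close>)
        then show ?thesis using False by (simp add: \<gamma>_def)
      qed
      moreover have "sum \<gamma> F \<le> 2 * e" if F: "finite F" for F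
      proof -
        have "sum \<gamma> F = sum \<gamma> (F \<inter> L) + sum \<gamma> (F - L)" using F by (rule sum.Int_Diff)
        also have "sum \<gamma> (F \<inter> L) = real (card (F \<inter> L)) * e1" by (simp add: \<gamma>_def)
        also have "\<dots> \<le> real (card L) * e1"
          using e1 L(1) by (intro mult_right_mono) (auto intro: card_mono)
        also have "\<dots> \<le> e" using e by (simp add: e1_def field_simps)
        also have "sum \<gamma> (F - L) = sum (\<lambda>l. 2 * A l) (F - L)" by (rule sum.cong) (auto simp: \<gamma>_def)
        also have "\<dots> \<le> e" using F by (intro L(2)) auto
        finally show ?thesis by simp
      qed
      ultimately have "cmod (\<Sum>\<^sub>\<infinity>(k, j). ?c n k * cnj (?c n j) * (?W n k j - ?K n k j)) \<le> Q * (2 * e)"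
        by (intro schur_test(2)) (use Q in auto)
      also have "\<dots> < r" using r Q0 by (simp add: e_def field_simps)
      finally show ?case using diff by simp
    qed
    then show "\<exists>no. \<forall>n\<ge>no. norm (wigner (h n) (u n) a - (LINT (c, x)|husimi (u n) (N n) (C n). a (x, h n *\<^sub>R real_vec c)) - 0) < r"
      by (simp only: eventually_sequentially)
  qed
qed

text \<open>
  The bounded image of the frequency space in which limits of measures exist; mass escaping to infinite
  frequency ends up on the unit sphere.
\<close>

definition compress :: "'a::real_normed_vector \<Rightarrow> 'a" where
  "compress \<xi> = \<xi> /\<^sub>R (1 + norm \<xi>)"

definition decompress :: "'a::real_normed_vector \<Rightarrow> 'a" where
  "decompress \<eta> = \<eta> /\<^sub>R (1 - norm \<eta>)"

lemma norm_compress: "norm (compress \<xi>) = norm \<xi> / (1 + norm \<xi>)"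
  by (simp add: compress_def divide_inverse mult.commute add_nonneg_nonneg abs_of_nonneg)

lemma norm_compress_less: "norm (compress \<xi>) < 1"
  unfolding norm_compress by (simp add: divide_less_eq add_pos_nonneg)

lemma decompress_compress [simp]: "decompress (compress \<xi>) = \<xi>"
proof -
  have "1 + norm \<xi> \<noteq> 0" using norm_ge_zero[of \<xi>] by linarith
  then have "1 - norm (compress \<xi>) = 1 / (1 + norm \<xi>)" unfolding norm_compress by (simp add: field_simps)
  then show ?thesis using \<open>1 + norm \<xi> \<noteq> 0\<close> by (simp add: decompress_def compress_def)
qed

lemma norm_decompress: "norm \<eta> < 1 \<Longrightarrow> norm (decompress \<eta>) = norm \<eta> / (1 - norm \<eta>)"
  by (simp add: decompress_def divide_inverse mult.commute)

text \<open>
  A test function transported to the compressed space. It vanishes near the unit sphere, so the extension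
  by 0 is continuous.
\<close>

definition compactified :: "((real^'d) \<times> (real^'d) \<Rightarrow> complex) \<Rightarrow> (real^'d) \<times> (real^'d) \<Rightarrow> complex" where
  "compactified a z = (if norm (snd z) < 1 then a (fst z, decompress (snd z)) else 0)"

lemma compactified_compress: "compactified a (x, compress \<xi>) = a (x, \<xi>)"
  by (simp add: compactified_def norm_compress_less)

lemma continuous_compactified:
  assumes a: "a \<in> test_functions"
  shows "continuous_on UNIV (compactified a)"
proof -
  obtain R where R: "0 < R" "\<And>x \<xi>. R < norm \<xi> \<Longrightarrow> a (x, \<xi>) = 0" using test_function_support[OF a] by blast
  let ?S = "{z :: (real^'a) \<times> (real^'a). norm (snd z) < 1}" and ?T = "{z :: (real^'a) \<times> (real^'a). R / (1 + R) < norm (snd z)}"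
  have op: "open ?S" "open ?T" by (intro open_Collect_less continuous_intros)+
  have "continuous_on ?S (\<lambda>z. a (fst z, decompress (snd z)))"
    unfolding decompress_def
    by (intro continuous_on_compose2[OF test_function_continuous[OF a, of UNIV]] continuous_intros) auto
  then have S: "continuous_on ?S (compactified a)"
    by (rule continuous_on_eq) (simp add: compactified_def)
  have "compactified a z = 0" if "z \<in> ?T" for z
  proof (cases "norm (snd z) < 1")
    case True
    have "R < norm (snd z) * (1 + R)" using that R(1) by (simp add: divide_less_eq)
    then have "R < norm (decompress (snd z))"
      using True by (simp add: norm_decompress less_divide_eq algebra_simps)
    then show ?thesis using R(2) by (simp add: compactified_def)
  qed (simp add: compactified_def)
  then have "continuous_on ?T (compactified a)"
    by (intro continuous_on_eq[OF continuous_on_const[of _ 0]]) auto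
  with S have "continuous_on (?S \<union> ?T) (compactified a)" using op by (intro continuous_on_open_Un)
  moreover have "R / (1 + R) < 1" using R(1) by simp
  then have "?S \<union> ?T = UNIV" by auto
  ultimately show ?thesis by simp
qed

lemma measurable_wrap [measurable]: "(wrap :: real^'d \<Rightarrow> real^'d) \<in> borel \<rightarrow>\<^sub>M torus"
proof -
  have "(wrap :: real^'d \<Rightarrow> real^'d) \<in> borel_measurable borel"
  proof (rule borel_measurable_euclidean_space[THEN iffD2, OF ballI])
    fix b :: "real^'d" assume "b \<in> Basis"
    then obtain i where "b = axis i 1" by (auto simp: Basis_vec_def)
    then have "(\<lambda>x. wrap x \<bullet> b) = (\<lambda>x. x $ i - 2 * pi * of_int \<lfloor>x $ i / (2 * pi)\<rfloor>)"
      by (simp add: inner_axis wrap_def)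
    also have "\<dots> \<in> borel_measurable borel" by measurable
    finally show "(\<lambda>x. wrap x \<bullet> b) \<in> borel_measurable borel" .
  qed
  then show ?thesis unfolding torus_def
    by (intro measurable_restrict_space2) (auto simp: wrap_in_torus_cell)
qed

lemma bounded_torus_cell: "bounded (torus_cell :: (real^'d) set)"
proof (rule bounded_subset[OF bounded_cbox])
  show "torus_cell \<subseteq> cbox 0 (\<chi> i. 2 * pi)" by (auto simp: torus_cell_def mem_box_cart less_imp_le)
qed

lemma test_function_measurable_phase_space:
  assumes a: "a \<in> test_functions"
  shows "a \<in> borel_measurable (torus \<Otimes>\<^sub>M borel)"
proof -
  have "(\<lambda>x. x) \<in> torus \<rightarrow>\<^sub>M borel" by (rule measurable_torus) simp
  from measurable_compose[OF measurable_fst this]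
  have "(\<lambda>z. (fst z, snd z)) \<in> (torus \<Otimes>\<^sub>M borel) \<rightarrow>\<^sub>M (borel \<Otimes>\<^sub>M borel)"
    by (intro measurable_Pair measurable_snd)
  moreover have "a \<in> borel_measurable (borel \<Otimes>\<^sub>M borel)"
    unfolding borel_prod by (rule borel_measurable_continuous_onI[OF test_function_continuous[OF a]])
  ultimately show ?thesis by (auto dest: measurable_compose)
qed

text \<open>
  Choose boxes of side \<open>N\<close> about \<open>h\<close> to the power \<open>- 1 / 2\<close>, so that \<open>N\<close> tends to infinity and
  \<open>h N\<close> to 0. By \<open>husimi_approximates_wigner\<close> the Wigner distributions have the same limits as positive
  measures of bounded mass, which converge along a subsequence after compression of the frequencies. The mass at
  infinite frequency is dropped, and the positions are wrapped back into the fundamental cell, since the limit may charge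
  its closure.
\<close>

theorem wigner_accumulation_point_exists:
  fixes u :: "nat \<Rightarrow> real^'d \<Rightarrow> complex"
  assumes Q: "\<And>n F. finite F \<Longrightarrow> (\<Sum>k\<in>F. (cmod (fourier_coeff (u n) k))\<^sup>2) \<le> Q"
    and h: "\<And>n. 0 < h n" "h \<longlonglongrightarrow> 0"
  obtains \<mu> where "wigner_accumulation_point h u \<mu>"
proof -
  define N where "N n = nat \<lceil>1 / sqrt (h n)\<rceil>" for n
  define C where "C n = {c :: int^'d. norm (h n *\<^sub>R real_vec c) \<le> real n}" for n
  have sq: "0 < 1 / sqrt (h n)" for n using h by simp
  have N0: "0 < N n" for n using sq[of n] by (simp add: N_def)
  have Nr: "1 / sqrt (h n) \<le> real (N n)" "real (N n) \<le> 1 / sqrt (h n) + 1" for n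
    using sq[of n] unfolding N_def by linarith+
  have sqrt0: "(\<lambda>n. sqrt (h n)) \<longlonglongrightarrow> 0" using tendsto_real_sqrt[OF h(2)] by simp
  have "filterlim (\<lambda>n. 1 / sqrt (h n)) at_top sequentially"
  proof -
    have "filterlim (\<lambda>n. sqrt (h n)) (at_right 0) sequentially"
      using sqrt0 h(1) by (simp add: filterlim_at less_imp_neq[symmetric])
    then show ?thesis using filterlim_compose[OF filterlim_inverse_at_top_right] by (simp add: inverse_eq_divide)
  qed
  then have "filterlim (\<lambda>n. real (N n)) at_top sequentially"
    by (rule filterlim_at_top_mono) (simp add: Nr)
  then have Ninf: "filterlim N at_top sequentially"
    by (simp add: filterlim_sequentially_iff_filterlim_real)
  have hN: "(\<lambda>n. \<bar>h n\<bar> * real (N n)) \<longlonglongrightarrow> 0"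
  proof (rule Lim_null_comparison[OF always_eventually])
    show "\<forall>n. norm (\<bar>h n\<bar> * real (N n)) \<le> sqrt (h n) + h n"
    proof
      fix n
      have "h n * real (N n) \<le> h n * (1 / sqrt (h n) + 1)" using Nr h(1)[of n] by (intro mult_left_mono) auto
      also have "\<dots> = sqrt (h n) + h n" using h(1)[of n] by (simp add: algebra_simps real_div_sqrt)
      finally show "norm (\<bar>h n\<bar> * real (N n)) \<le> sqrt (h n) + h n" using h(1)[of n] by simp
    qed
    show "(\<lambda>n. sqrt (h n) + h n) \<longlonglongrightarrow> 0" using tendsto_add[OF sqrt0 h(2)] by simp
  qed
  have Cfin: "finite (C n)" for n
    unfolding C_def using h(1) by (rule finite_modes_in_ball)
  have Cev: "eventually (\<lambda>n. \<forall>c. norm (h n *\<^sub>R real_vec c) \<le> R \<longrightarrow> c \<in> C n) sequentially" for R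
  proof -
    obtain n0 where "R \<le> real n0" using real_arch_simple by blast
    then show ?thesis
      unfolding eventually_sequentially C_def by (intro exI[of _ n0]) (auto intro: order_trans)
  qed
  define m where "m n = husimi (u n) (N n) (C n)" for n
  define G where "G n = (\<lambda>z :: (int^'d) \<times> (real^'d). (snd z, compress (h n *\<^sub>R real_vec (fst z))))" for n
  define X where "X = (torus_cell :: (real^'d) set) \<times> ball (0 :: real^'d) 1"
  obtain \<sigma> \<mu>' where \<sigma>: "strict_mono (\<sigma> :: nat \<Rightarrow> nat)" and \<mu>': "sets \<mu>' = sets (borel :: ((real^'d) \<times> (real^'d)) measure)" "finite_measure \<mu>'"
    and conv: "\<And>\<phi> :: (real^'d) \<times> (real^'d) \<Rightarrow> complex. continuous_on UNIV \<phi> \<Longrightarrow> bounded (range \<phi>) \<Longrightarrow>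
       (\<lambda>n. LINT z|m (\<sigma> n). \<phi> (G (\<sigma> n) z)) \<longlonglongrightarrow> (LINT y|\<mu>'. \<phi> y)"
  proof (rule bounded_measures_converging_subsequence[of m Q G X])
    show "finite_measure (m n)" for n unfolding m_def by (rule finite_measure_husimi[OF Cfin])
    show "measure (m n) (space (m n)) \<le> Q" for n unfolding m_def by (rule husimi_mass[OF Cfin N0 Q])
    show "G n \<in> borel_measurable (m n)" for n
    proof -
      have "G n \<in> borel_measurable (count_space (C n) \<Otimes>\<^sub>M torus)"
        unfolding G_def
        by (rule measurable_pair_measure_countable1[OF countable_finite[OF Cfin]])
          (auto intro!: measurable_torus borel_measurable_continuous_onI continuous_intros)
      then show ?thesis using measurable_cong_sets[OF sets_husimi refl] unfolding m_def by blast
    qed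
    show "G n z \<in> X" if "z \<in> space (m n)" for n z
      using that norm_compress_less by (auto simp: m_def space_husimi G_def X_def)
    show "bounded X" unfolding X_def by (intro bounded_Times bounded_torus_cell bounded_ball)
  qed (rule that)
  interpret \<mu>': finite_measure \<mu>' by (rule \<mu>')
  define S where "S = {z :: (real^'d) \<times> (real^'d). norm (snd z) < 1}"
  define \<pi> where "\<pi> z = (wrap (fst z), decompress (snd z))" for z :: "(real^'d) \<times> (real^'d)"
  have S: "S \<in> sets \<mu>'" unfolding \<mu>'(1) S_def by (intro borel_open open_Collect_less continuous_intros)
  have \<pi>: "\<pi> \<in> restrict_space \<mu>' S \<rightarrow>\<^sub>M (torus \<Otimes>\<^sub>M borel)"
  proof (rule measurable_restrict_space1)
    have [measurable]: "decompress \<in> borel_measurable (borel :: (real^'d) measure)"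
      unfolding decompress_def by measurable
    have "\<pi> \<in> (borel \<Otimes>\<^sub>M borel) \<rightarrow>\<^sub>M (torus \<Otimes>\<^sub>M borel)" unfolding \<pi>_def by measurable
    then show "\<pi> \<in> \<mu>' \<rightarrow>\<^sub>M (torus \<Otimes>\<^sub>M borel)"
      unfolding borel_prod using measurable_cong_sets[OF \<mu>'(1) refl] by blast
  qed
  \<comment> \<open>The sphere at infinity is cut off before the frequencies are decompressed.\<close>
  define \<mu> where "\<mu> = distr (restrict_space \<mu>' S) (torus \<Otimes>\<^sub>M borel) \<pi>"
  have "finite_measure (restrict_space \<mu>' S)" using \<mu>'(2) S by (rule finite_measure_restrict_space)
  then have fin: "finite_measure \<mu>" unfolding \<mu>_def using \<pi> by (rule finite_measure.finite_measure_distr)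
  have radon: "phase_space_radon_measure \<mu>"
    unfolding phase_space_radon_measure_def using finite_measure.emeasure_finite[OF fin]
    by (auto simp: \<mu>_def less_top)
  have int: "(LINT z|\<mu>. a z) = (LINT z|\<mu>'. compactified a z)" if a: "a \<in> test_functions" for a
  proof -
    have "(LINT z|\<mu>. a z) = (LINT z|restrict_space \<mu>' S. a (\<pi> z))"
      unfolding \<mu>_def by (rule integral_distr[OF \<pi> test_function_measurable_phase_space[OF a]])
    also have "\<dots> = (LINT z|\<mu>'. indicator S z *\<^sub>R a (\<pi> z))"
      by (rule integral_restrict_space) (use S in simp)
    also have "\<dots> = (LINT z|\<mu>'. compactified a z)"
      by (intro Bochner_Integration.integral_cong) (auto simp: indicator_def S_def compactified_def \<pi>_def test_function_wrap[OF a])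
    finally show ?thesis .
  qed
  have "(\<lambda>n. wigner (h (\<sigma> n)) (u (\<sigma> n)) a) \<longlonglongrightarrow> (LINT z|\<mu>. a z)" if a: "a \<in> test_functions" for a
  proof -
    obtain B where B: "0 < B" "\<And>z. cmod (a z) \<le> B" using test_function_bounded[OF a] by blast
    have "bounded (range (compactified a))"
      unfolding bounded_iff using B by (intro exI[of _ B]) (auto simp: compactified_def less_imp_le)
    from conv[OF continuous_compactified[OF a] this]
    have c: "(\<lambda>n. LINT (c, x)|m (\<sigma> n). a (x, h (\<sigma> n) *\<^sub>R real_vec c)) \<longlonglongrightarrow> (LINT z|\<mu>. a z)"
      unfolding int[OF a] by (simp add: G_def compactified_compress case_prod_beta')
    have "(\<lambda>n. wigner (h n) (u n) a - (LINT (c, x)|m n. a (x, h n *\<^sub>R real_vec c))) \<longlonglongrightarrow> 0"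
      unfolding m_def by (rule husimi_approximates_wigner[OF Q a N0 Ninf hN Cfin Cev])
    from tendsto_add[OF LIMSEQ_subseq_LIMSEQ[OF this \<sigma>] c]
    show ?thesis by (simp add: comp_def)
  qed
  then have "wigner_accumulation_point h u \<mu>"
    unfolding wigner_accumulation_point_def using radon \<sigma> by blast
  then show ?thesis by (rule that)
qed

section \<open>Resonant vectors\<close>

lemma common_denominator:
  fixes f :: "'a \<Rightarrow> rat"
  assumes "finite T"
  shows "\<exists>D::int. D \<noteq> 0 \<and> (\<forall>v\<in>T. \<exists>m::int. f v * of_int D = of_int m)"
  using assms
proof (induction T rule: finite_induct)
  case empty
  then show ?case by (intro exI[of _ 1]) auto
next
  case (insert v T)
  then obtain D :: int where D: "D \<noteq> 0" "\<forall>v\<in>T. \<exists>m::int. f v * of_int D = of_int m" by blast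
  obtain a b :: int where ab: "f v = of_int a / of_int b" "b > 0"
    by (cases "f v" rule: Rat_cases) (auto simp: Fract_of_int_quotient)
  show ?case
  proof (rule exI[of _ "D * b"], intro conjI ballI)
    fix w assume w: "w \<in> insert v T"
    show "\<exists>m::int. f w * of_int (D * b) = of_int m"
    proof (cases "w = v")
      case True
      then have "f w * of_int (D * b) = of_int (a * D)" using ab by simp
      then show ?thesis by blast
    next
      case False
      then obtain m :: int where "f w * of_int D = of_int m" using D w by blast
      then have "f w * of_int (D * b) = of_int (m * b)" by (simp add: mult.assoc[symmetric])
      then show ?thesis by blast
    qed
  qed (use D ab in auto)
qed

text \<open>
  Regard the vectors as rational ones. A rational linear relation becomes an integral one when multiplied by
  a common denominator.
\<close>

lemma int_independent_card_le:
  fixes B :: "(int^'d) set"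
  assumes B: "finite B" "int_vec.independent B"
  shows "card B \<le> CARD('d)"
proof -
  define q where "q k = (\<chi> i. rat_of_int (k $ i))" for k :: "int^'d"
  have inj: "inj q" by (auto simp: inj_on_def q_def vec_eq_iff)
  have "vec.independent (q ` B)"
  proof
    assume "vec.dependent (q ` B)"
    then obtain w where w: "(\<Sum>v\<in>q ` B. w v *s v) = 0" "\<exists>v\<in>q ` B. w v \<noteq> 0"
      using B(1) by (auto simp: vec.dependent_finite)
    obtain D :: int where D: "D \<noteq> 0" "\<forall>v\<in>q ` B. \<exists>m::int. w v * of_int D = of_int m"
      using common_denominator[of "q ` B" w] B(1) by auto
    then obtain m :: "rat^'d \<Rightarrow> int" where m: "\<And>v. v \<in> q ` B \<Longrightarrow> w v * of_int D = of_int (m v)" by metis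
    have "(\<Sum>k\<in>B. m (q k) *s k) = 0"
    proof (subst vec_eq_iff, intro allI)
      fix i
      have "rat_of_int ((\<Sum>k\<in>B. m (q k) *s k) $ i) = (\<Sum>k\<in>B. rat_of_int (m (q k)) * q k $ i)"
        by (simp add: q_def)
      also have "\<dots> = (\<Sum>k\<in>B. of_int D * (w (q k) *s q k) $ i)"
        by (rule sum.cong) (simp_all add: m[symmetric] mult_ac)
      also have "\<dots> = of_int D * ((\<Sum>v\<in>q ` B. w v *s v) $ i)"
        using inj by (simp add: sum.reindex inj_on_subset[OF inj] sum_distrib_left)
      also have "\<dots> = 0" unfolding w(1) by simp
      finally have "(\<Sum>k\<in>B. m (q k) *s k) $ i = 0" by (simp only: of_int_eq_0_iff)
      then show "(\<Sum>k\<in>B. m (q k) *s k) $ i = 0 $ i" by simp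
    qed
    moreover have "\<exists>k\<in>B. m (q k) \<noteq> 0"
    proof -
      obtain k where k: "k \<in> B" "w (q k) \<noteq> 0" using w(2) by blast
      have "rat_of_int (m (q k)) \<noteq> 0" using m[of "q k"] k D(1) by (metis imageI mult_eq_0_iff of_int_eq_0_iff)
      then show ?thesis using k(1) by auto
    qed
    ultimately have "int_vec.dependent B"
      unfolding int_vec.dependent_explicit using B(1)
      by (intro exI[of _ B] exI[of _ "\<lambda>k. m (q k)"] conjI) auto
    then show False using B(2) by simp
  qed
  then have "card (q ` B) \<le> vec.dim (UNIV :: (rat^'d) set)"
    by (intro vec.independent_card_le_dim) auto
  then show ?thesis using card_image[OF inj_on_subset[OF inj, of B]] unfolding vec_dim_card by simp
qed

lemma real_independent_imp_int_independent:
  assumes "independent (real_vec ` B)" and B: "finite B"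
  shows "int_vec.independent B"
proof
  assume "int_vec.dependent B"
  then obtain t w where t: "finite t" "t \<subseteq> B" "(\<Sum>v\<in>t. w v *s v) = 0" and w: "\<exists>v\<in>t. w v \<noteq> 0"
    unfolding int_vec.dependent_explicit by blast
  have inj: "inj_on real_vec t" by (simp add: inj_on_def)
  define w' where "w' x = real_of_int (w (inv_into t real_vec x))" for x
  have w': "w' (real_vec v) = real_of_int (w v)" if "v \<in> t" for v
    using that inj by (simp add: w'_def)
  have "(\<Sum>x\<in>real_vec ` t. w' x *\<^sub>R x) = (\<Sum>v\<in>t. real_of_int (w v) *\<^sub>R real_vec v)"
    using inj by (simp add: sum.reindex w' cong: sum.cong)
  also have "\<dots> = real_vec (\<Sum>v\<in>t. w v *s v)" by (simp add: vec_eq_iff)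
  also have "\<dots> = 0" by (simp add: t)
  finally have "(\<Sum>x\<in>real_vec ` t. w' x *\<^sub>R x) = 0" .
  moreover have "\<exists>x\<in>real_vec ` t. w' x \<noteq> 0" using w w' by auto
  moreover have "finite (real_vec ` t)" "real_vec ` t \<subseteq> real_vec ` B" using t by auto
  ultimately have "dependent (real_vec ` B)" unfolding dependent_explicit by blast
  with assms(1) show False by simp
qed

text \<open>
  The cardinalities of independent sets are bounded by the dimension, so the supremum in the definition of
  the rank is attained.
\<close>

lemma int_rank_ge_iff:
  fixes L :: "(int^'d) set"
  assumes "0 < p"
  shows "p \<le> int_rank L \<longleftrightarrow> (\<exists>B. B \<subseteq> L \<and> finite B \<and> int_vec.independent B \<and> p \<le> card B)"
proof -
  let ?S = "{card B | B. B \<subseteq> L \<and> finite B \<and> int_vec.independent B}"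
  have "?S \<subseteq> {..CARD('d)}" using int_independent_card_le by auto
  then have fin: "finite ?S" by (rule finite_subset) simp
  have "0 \<in> ?S" using int_vec.independent_empty by (auto intro!: exI[of _ "{}"])
  then have ne: "?S \<noteq> {}" by blast
  have "int_rank L = Max ?S" unfolding int_rank_def using ne by (simp only: Sup_nat_def if_False)
  then have "p \<le> int_rank L \<longleftrightarrow> (\<exists>n\<in>?S. p \<le> n)" using Max_ge_iff[OF fin ne] by simp
  then show ?thesis by blast
qed

lemma int_rank_le: "int_rank (L :: (int^'d) set) \<le> CARD('d)"
proof (rule ccontr)
  assume "\<not> ?thesis"
  then have "Suc CARD('d) \<le> int_rank L" by simp
  then obtain B :: "(int^'d) set" where "finite B" "int_vec.independent B" "Suc CARD('d) \<le> card B"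
    using int_rank_ge_iff[of "Suc CARD('d)" L] by blast
  then show False using int_independent_card_le[of B] by simp
qed

lemma resonant_union:
  assumes "r \<le> CARD('d)"
  shows "(\<Union>j<r. resonant_vectors j) = {\<xi> :: real^'d. CARD('d) + 1 - r \<le> int_rank (resonance_module \<xi>)}"
proof (intro set_eqI iffI)
  fix \<xi> :: "real^'d" assume "\<xi> \<in> (\<Union>j<r. resonant_vectors j)"
  then show "\<xi> \<in> {\<xi>. CARD('d) + 1 - r \<le> int_rank (resonance_module \<xi>)}" by (auto simp: resonant_vectors_def)
next
  fix \<xi> :: "real^'d" assume "\<xi> \<in> {\<xi>. CARD('d) + 1 - r \<le> int_rank (resonance_module \<xi>)}"
  then have "CARD('d) - int_rank (resonance_module \<xi>) < r"
    using assms int_rank_le[of "resonance_module \<xi>"] by auto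
  moreover have "\<xi> \<in> resonant_vectors (CARD('d) - int_rank (resonance_module \<xi>))"
    using int_rank_le[of "resonance_module \<xi>"] by (simp add: resonant_vectors_def)
  ultimately show "\<xi> \<in> (\<Union>j<r. resonant_vectors j)" by blast
qed

text \<open>
  Being orthogonal to one of countably many finite sets of integer vectors is a countable union of closed
  conditions.
\<close>

lemma resonant_union_measurable:
  assumes "r \<le> CARD('d)"
  shows "(\<Union>j<r. resonant_vectors j :: (real^'d) set) \<in> sets borel"
proof -
  let ?p = "CARD('d) + 1 - r"
  let ?\<B> = "{B :: (int^'d) set. finite B \<and> int_vec.independent B \<and> ?p \<le> card B}"
  have p: "0 < ?p" using assms by simp
  have "(\<Union>j<r. resonant_vectors j) = (\<Union>B\<in>?\<B>. {\<xi> :: real^'d. \<forall>k\<in>B. real_vec k \<bullet> \<xi> = 0})"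
    unfolding resonant_union[OF assms] int_rank_ge_iff[OF p] by (auto simp: resonance_module_def subset_iff)
  also have "\<dots> \<in> sets borel"
  proof (rule sets.countable_UN'')
    show "countable ?\<B>" by (rule countable_subset[OF _ countable_Collect_finite]) auto
    fix B assume "B \<in> ?\<B>"
    have "closed (\<Inter>k\<in>B. {\<xi> :: real^'d. real_vec k \<bullet> \<xi> = 0})"
      by (intro closed_INT ballI closed_Collect_eq continuous_intros)
    also have "(\<Inter>k\<in>B. {\<xi> :: real^'d. real_vec k \<bullet> \<xi> = 0}) = {\<xi> :: real^'d. \<forall>k\<in>B. real_vec k \<bullet> \<xi> = 0}" by auto
    finally have "closed {\<xi> :: real^'d. \<forall>k\<in>B. real_vec k \<bullet> \<xi> = 0}" .
    then show "{\<xi> :: real^'d. \<forall>k\<in>B. real_vec k \<bullet> \<xi> = 0} \<in> sets borel" by (rule borel_closed)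
  qed
  finally show ?thesis .
qed

lemma orthogonal_in_resonant_union:
  fixes B :: "(int^'d) set"
  assumes r: "r \<le> CARD('d)" and B: "finite B" "independent (real_vec ` B)" "CARD('d) + 1 - r \<le> card B"
    and orth: "\<And>k. k \<in> B \<Longrightarrow> real_vec k \<bullet> \<xi> = 0"
  shows "\<xi> \<in> (\<Union>j<r. resonant_vectors j)"
proof -
  have p: "0 < CARD('d) + 1 - r" using r by simp
  show ?thesis
    unfolding resonant_union[OF r] mem_Collect_eq int_rank_ge_iff[OF p]
    using B orth real_independent_imp_int_independent[OF B(2,1)]
    by (intro exI[of _ B]) (auto simp: resonance_module_def)
qed

section \<open>Modes near the resonant vectors\<close>

lemma frequently_subsequence:
  assumes "\<And>j :: nat. \<exists>\<^sub>F n in sequentially. P j n"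
  obtains \<tau> :: "nat \<Rightarrow> nat" where "strict_mono \<tau>" "\<And>j. P j (\<tau> j)"
proof -
  have ex: "\<exists>n>m. P j n" for m j
    using assms[of j] unfolding frequently_sequentially by (meson less_eq_Suc_le)
  have "\<exists>\<tau>. \<forall>j. P j (\<tau> j) \<and> \<tau> j < \<tau> (Suc j)"
    by (rule dependent_nat_choice) (use ex in blast)+
  then show ?thesis using that by (auto simp: strict_mono_Suc_iff)
qed

text \<open>
  The modes \<open>k\<close> for which \<open>h k\<close> lies in the smaller of the two ellipsoids attached to
  \<open>ellipsoid_bump\<close>.
\<close>

definition ellipsoid_modes :: "real \<Rightarrow> real \<Rightarrow> (int^'d) set \<Rightarrow> real \<Rightarrow> (int^'d) set" where
  "ellipsoid_modes R K B h =
     {k. (norm (h *\<^sub>R real_vec k))\<^sup>2 + K * (\<Sum>l\<in>B. ((h *\<^sub>R real_vec k) \<bullet> real_vec l)\<^sup>2) \<le> R\<^sup>2 / 2}"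

lemma ellipsoid_modes_in_ball:
  assumes "0 \<le> K" "0 < R" "k \<in> ellipsoid_modes R K B h"
  shows "norm (h *\<^sub>R real_vec k) \<le> R"
proof -
  have "0 \<le> K * (\<Sum>l\<in>B. ((h *\<^sub>R real_vec k) \<bullet> real_vec l)\<^sup>2)" using assms by (intro mult_nonneg_nonneg sum_nonneg) auto
  then have "(norm (h *\<^sub>R real_vec k))\<^sup>2 \<le> R\<^sup>2 / 2" using assms unfolding ellipsoid_modes_def mem_Collect_eq by linarith
  also have "\<dots> \<le> R\<^sup>2" by simp
  finally show ?thesis using assms by (simp add: power2_le_iff_abs_le abs_le_square_iff[symmetric])
qed

lemma ellipsoid_modes_mono:
  assumes "K \<le> K'"
  shows "ellipsoid_modes R K' B h \<subseteq> ellipsoid_modes R K B h"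
proof
  fix k assume "k \<in> ellipsoid_modes R K' B h"
  moreover have "K * (\<Sum>l\<in>B. ((h *\<^sub>R real_vec k) \<bullet> real_vec l)\<^sup>2) \<le> K' * (\<Sum>l\<in>B. ((h *\<^sub>R real_vec k) \<bullet> real_vec l)\<^sup>2)"
    using assms by (intro mult_right_mono sum_nonneg) auto
  ultimately show "k \<in> ellipsoid_modes R K B h" unfolding ellipsoid_modes_def mem_Collect_eq by linarith
qed

text \<open>
  For a symbol that does not depend on the position only the diagonal terms of the double sum survive.
\<close>

lemma wigner_multiplier:
  fixes u :: "real^'d \<Rightarrow> complex" and \<beta> :: "real^'d \<Rightarrow> real"
  assumes h: "0 < h" and supp: "\<And>\<xi>. R < norm \<xi> \<Longrightarrow> \<beta> \<xi> = 0"
  shows "wigner h u (\<lambda>z. of_real (\<beta> (snd z)))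
    = of_real (\<Sum>k | norm (h *\<^sub>R real_vec k) \<le> R. (cmod (fourier_coeff u k))\<^sup>2 * \<beta> (h *\<^sub>R real_vec k))"
proof -
  let ?F = "{k :: int^'d. norm (h *\<^sub>R real_vec k) \<le> R}"
  have F: "finite ?F" using h by (rule finite_modes_in_ball)
  have const: "fourier_coeff (\<lambda>x :: real^'d. c) l = (if l = 0 then c else 0)" for c l
  proof -
    have "(LINT x|torus. cis (- (real_vec l \<bullet> x))) = (if l = 0 then (2 * pi) ^ CARD('d) else 0)" for l :: "int^'d"
      using torus_integral_character[of "- l"] by (simp add: real_vec_minus)
    then show ?thesis by (simp add: fourier_coeff_def)
  qed
  have "((\<lambda>(k, j). fourier_coeff u k * cnj (fourier_coeff u j) *
        fourier_coeff (\<lambda>x. complex_of_real (\<beta> (snd (x, (h / 2) *\<^sub>R real_vec (k + j))))) (j - k))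
      has_sum (\<Sum>(k, j)\<in>(\<lambda>k. (k, k)) ` ?F. fourier_coeff u k * cnj (fourier_coeff u j) *
        fourier_coeff (\<lambda>x. complex_of_real (\<beta> (snd (x, (h / 2) *\<^sub>R real_vec (k + j))))) (j - k))) UNIV"
  proof (rule has_sum_finite_neutralI)
    fix z assume z: "z \<in> UNIV - (\<lambda>k. (k, k)) ` ?F"
    obtain k j where kj: "z = (k, j)" by fastforce
    have "fourier_coeff (\<lambda>x. complex_of_real (\<beta> (snd (x, (h / 2) *\<^sub>R real_vec (k + j))))) (j - k) = 0"
    proof (cases "j = k")
      case True
      then have "R < norm (h *\<^sub>R real_vec k)" using z kj by auto
      moreover have "(h / 2) *\<^sub>R real_vec (k + j) = h *\<^sub>R real_vec k"
        using True by (simp add: vec_eq_iff)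
      ultimately show ?thesis using supp by (simp add: const)
    qed (simp add: const)
    then show "(case z of (k, j) \<Rightarrow> fourier_coeff u k * cnj (fourier_coeff u j) *
        fourier_coeff (\<lambda>x. complex_of_real (\<beta> (snd (x, (h / 2) *\<^sub>R real_vec (k + j))))) (j - k)) = 0"
      by (simp add: kj)
  qed (use F in auto)
  then have "wigner h u (\<lambda>z. of_real (\<beta> (snd z)))
    = (\<Sum>(k, j)\<in>(\<lambda>k. (k, k)) ` ?F. fourier_coeff u k * cnj (fourier_coeff u j) *
        fourier_coeff (\<lambda>x. complex_of_real (\<beta> (snd (x, (h / 2) *\<^sub>R real_vec (k + j))))) (j - k))"
    unfolding wigner_def by (rule infsumI)
  also have "\<dots> = (\<Sum>k\<in>?F. fourier_coeff u k * cnj (fourier_coeff u k) * of_real (\<beta> (h *\<^sub>R real_vec k)))"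
  proof -
    have "(h / 2) *\<^sub>R real_vec (k + k) = h *\<^sub>R real_vec k" for k :: "int^'d" by (simp add: vec_eq_iff)
    then show ?thesis by (subst sum.reindex) (simp_all add: inj_on_def const)
  qed
  also have "\<dots> = of_real (\<Sum>k\<in>?F. (cmod (fourier_coeff u k))\<^sup>2 * \<beta> (h *\<^sub>R real_vec k))"
    by (simp add: complex_norm_square[symmetric])
  finally show ?thesis .
qed

lemma wigner_accumulation_point_subseq:
  assumes "strict_mono \<tau>" "wigner_accumulation_point (h \<circ> \<tau>) (u \<circ> \<tau>) \<mu>"
  shows "wigner_accumulation_point h u \<mu>"
proof -
  obtain \<sigma> where \<sigma>: "strict_mono \<sigma>" and lim: "\<forall>a\<in>test_functions. (\<lambda>n. wigner ((h \<circ> \<tau>) (\<sigma> n)) ((u \<circ> \<tau>) (\<sigma> n)) a) \<longlonglongrightarrow> (LINT z|\<mu>. a z)"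
    and "phase_space_radon_measure \<mu>"
    using assms(2) unfolding wigner_accumulation_point_def by blast
  then show ?thesis
    unfolding wigner_accumulation_point_def
    by (intro conjI exI[of _ "\<tau> \<circ> \<sigma>"] strict_mono_o[OF assms(1) \<sigma>]) (simp_all add: comp_def)
qed

text \<open>
  Otherwise a mass larger than \<open>e\<close> stays in ever thinner ellipsoids along a subsequence. Take a
  semiclassical measure of this subsequence. Testing against the bumps shows that it gives each ellipsoid a mass bounded
  from below, hence also their intersection, which consists of vectors orthogonal to \<open>B\<close> and so of vectors in the
  null set of the hypothesis.
\<close>

theorem no_concentration_near_resonances:
  fixes u :: "nat \<Rightarrow> real^'d \<Rightarrow> complex" and B :: "(int^'d) set"
  assumes Q: "\<And>n F. finite F \<Longrightarrow> (\<Sum>k\<in>F. (cmod (fourier_coeff (u n) k))\<^sup>2) \<le> Q"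
    and h: "\<And>n. 0 < h n" "h \<longlonglongrightarrow> 0"
    and null: "\<And>\<mu>. wigner_accumulation_point h u \<mu> \<Longrightarrow> emeasure \<mu> (torus_cell \<times> (\<Union>j<r. resonant_vectors j)) = 0"
    and r: "r \<le> CARD('d)"
    and B: "finite B" "independent (real_vec ` B)" "CARD('d) + 1 - r \<le> card B"
    and R: "0 < R" and e: "0 < e"
  obtains K where "0 < K"
    "\<forall>\<^sub>F n in sequentially. (\<Sum>k\<in>ellipsoid_modes R K B (h n). (cmod (fourier_coeff (u n) k))\<^sup>2) \<le> e"
proof (rule ccontr)
  let ?B = "real_vec ` B :: (real^'d) set"
  let ?mass = "\<lambda>n S. \<Sum>k\<in>S. (cmod (fourier_coeff (u n) k))\<^sup>2"
  assume "\<not> thesis"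
  then have "\<exists>\<^sub>F n in sequentially. e < ?mass n (ellipsoid_modes R (real (Suc j)) B (h n))" for j
    using that[of "real (Suc j)"] unfolding frequently_def not_less by force
  then obtain \<tau> where \<tau>: "strict_mono (\<tau> :: nat \<Rightarrow> nat)"
    and big: "\<And>j. e < ?mass (\<tau> j) (ellipsoid_modes R (real (Suc j)) B (h (\<tau> j)))"
    by (rule frequently_subsequence[where P = "\<lambda>j n. e < ?mass n (ellipsoid_modes R (real (Suc j)) B (h n))"]) blast
  obtain \<mu> where acc: "wigner_accumulation_point (h \<circ> \<tau>) (u \<circ> \<tau>) \<mu>"
  proof (rule wigner_accumulation_point_exists[of "u \<circ> \<tau>" Q "h \<circ> \<tau>"])
    show "(h \<circ> \<tau>) \<longlonglongrightarrow> 0" using h(2) \<tau> by (rule LIMSEQ_subseq_LIMSEQ)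
  qed (use Q h in auto)
  have null\<mu>: "emeasure \<mu> (torus_cell \<times> (\<Union>j<r. resonant_vectors j)) = 0"
    by (rule null[OF wigner_accumulation_point_subseq[OF \<tau> acc]])
  have sets\<mu>: "sets \<mu> = sets (torus \<Otimes>\<^sub>M borel)" and fin\<mu>: "\<And>K. compact K \<Longrightarrow> emeasure \<mu> (torus_cell \<times> K) < \<infinity>"
    using acc unfolding wigner_accumulation_point_def phase_space_radon_measure_def by auto
  obtain \<sigma> where \<sigma>: "strict_mono (\<sigma> :: nat \<Rightarrow> nat)"
    and lim: "\<And>a. a \<in> test_functions \<Longrightarrow> (\<lambda>n. wigner ((h \<circ> \<tau>) (\<sigma> n)) ((u \<circ> \<tau>) (\<sigma> n)) a) \<longlonglongrightarrow> (LINT z|\<mu>. a z)"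
    using acc unfolding wigner_accumulation_point_def by blast
  have finB: "finite ?B" using B by simp
  define \<beta> where "\<beta> K = ellipsoid_bump R (real K) ?B" for K :: nat
  define c0 where "c0 = exp (- 2 / R\<^sup>2)"
  have c0: "0 < c0" by (simp add: c0_def)
  have supp: "\<beta> K \<xi> = 0" if "R < norm \<xi>" for K \<xi>
  proof -
    have "R\<^sup>2 \<le> (norm \<xi>)\<^sup>2" using that R by (intro power_mono) auto
    moreover have "0 \<le> real K * (\<Sum>l\<in>?B. (\<xi> \<bullet> l)\<^sup>2)" by (intro mult_nonneg_nonneg sum_nonneg) auto
    ultimately show ?thesis unfolding \<beta>_def by (intro ellipsoid_bump_zero) linarith
  qed
  have test: "(\<lambda>z. complex_of_real (\<beta> K (snd z))) \<in> test_functions" for K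
    unfolding \<beta>_def using R by (intro ellipsoid_bump_test_function[OF finB]) auto
  have cell[measurable]: "torus_cell \<in> sets torus" using sets.top[of torus] by simp
  have low: "c0 * e \<le> (LINT z|\<mu>. \<beta> K (snd z))" for K
  proof -
    have "(\<lambda>n. Re (wigner ((h \<circ> \<tau>) (\<sigma> n)) ((u \<circ> \<tau>) (\<sigma> n)) (\<lambda>z. of_real (\<beta> K (snd z))))) \<longlonglongrightarrow> Re (LINT z|\<mu>. complex_of_real (\<beta> K (snd z)))"
      by (intro tendsto_Re lim test)
    moreover have "eventually (\<lambda>n. c0 * e \<le> Re (wigner ((h \<circ> \<tau>) (\<sigma> n)) ((u \<circ> \<tau>) (\<sigma> n)) (\<lambda>z. of_real (\<beta> K (snd z))))) sequentially"
      unfolding eventually_sequentially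
    proof (intro exI[of _ K] allI impI)
      fix n assume "K \<le> n"
      define m where "m = \<tau> (\<sigma> n)"
      let ?g = "\<lambda>k. (cmod (fourier_coeff (u m) k))\<^sup>2"
      let ?F = "{k :: int^'d. norm (h m *\<^sub>R real_vec k) \<le> R}"
      let ?E = "ellipsoid_modes R (real (Suc (\<sigma> n))) B (h m)"
      have F: "finite ?F" using h(1) by (rule finite_modes_in_ball)
      have sub: "?E \<subseteq> ?F" using ellipsoid_modes_in_ball[of "real (Suc (\<sigma> n))" R] R by auto
      have "K \<le> \<sigma> n" using \<open>K \<le> n\<close> seq_suble[OF \<sigma>, of n] by simp
      then have sub2: "?E \<subseteq> ellipsoid_modes R (real K) B (h m)" by (intro ellipsoid_modes_mono) simp
      have "c0 * e \<le> c0 * sum ?g ?E" using big[of "\<sigma> n"] c0 by (simp add: m_def less_imp_le)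
      also have "\<dots> = (\<Sum>k\<in>?E. ?g k * c0)" by (simp add: sum_distrib_left mult.commute)
      also have "\<dots> \<le> (\<Sum>k\<in>?E. ?g k * \<beta> K (h m *\<^sub>R real_vec k))"
      proof (intro sum_mono mult_left_mono)
        fix k assume "k \<in> ?E"
        then have "k \<in> ellipsoid_modes R (real K) B (h m)" using sub2 by blast
        moreover have "(\<Sum>l\<in>B. ((h m *\<^sub>R real_vec k) \<bullet> real_vec l)\<^sup>2) = (\<Sum>l\<in>?B. ((h m *\<^sub>R real_vec k) \<bullet> l)\<^sup>2)"
          by (subst sum.reindex) (simp_all add: inj_on_def)
        ultimately show "c0 \<le> \<beta> K (h m *\<^sub>R real_vec k)"
          unfolding c0_def \<beta>_def by (intro ellipsoid_bump_ge R) (simp only: ellipsoid_modes_def mem_Collect_eq)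
      qed simp
      also have "\<dots> \<le> (\<Sum>k\<in>?F. ?g k * \<beta> K (h m *\<^sub>R real_vec k))"
        by (rule sum_mono2[OF F sub]) (simp add: \<beta>_def ellipsoid_bump_bounds)
      also have "\<dots> = Re (wigner (h m) (u m) (\<lambda>z. of_real (\<beta> K (snd z))))"
        by (subst wigner_multiplier[OF h(1) supp]) simp_all
      finally show "c0 * e \<le> Re (wigner ((h \<circ> \<tau>) (\<sigma> n)) ((u \<circ> \<tau>) (\<sigma> n)) (\<lambda>z. of_real (\<beta> K (snd z))))"
        by (simp add: m_def)
    qed
    ultimately have "c0 * e \<le> Re (LINT z|\<mu>. complex_of_real (\<beta> K (snd z)))"
      by (rule tendsto_lowerbound) simp
    then show ?thesis by simp
  qed
  have "(\<lambda>K. LINT z|\<mu>. \<beta> K (snd z)) \<longlonglongrightarrow> (LINT z|\<mu>. 0)"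
  proof (rule integral_dominated_convergence[where w = "indicator (torus_cell \<times> cball 0 R)"])
    show "(\<lambda>z. \<beta> K (snd z)) \<in> borel_measurable \<mu>" for K
    proof -
      have "(\<lambda>z. complex_of_real (\<beta> K (snd z))) \<in> borel_measurable \<mu>"
        using test_function_measurable_phase_space[OF test[of K]] measurable_cong_sets[OF sets\<mu> refl] by blast
      then have "(\<lambda>z. Re (complex_of_real (\<beta> K (snd z)))) \<in> borel_measurable \<mu>" by measurable
      then show ?thesis by simp
    qed
    have "torus_cell \<times> cball 0 R \<in> sets \<mu>" unfolding sets\<mu> by (intro pair_measureI cell) auto
    then show "integrable \<mu> (indicator (torus_cell \<times> cball (0 :: real^'d) R) :: _ \<Rightarrow> real)"
      using fin\<mu>[of "cball 0 R"] by (intro integrable_real_indicator) auto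
    show "AE z in \<mu>. norm (\<beta> K (snd z)) \<le> indicator (torus_cell \<times> cball 0 R) z" for K
    proof (rule AE_I2)
      fix z assume "z \<in> space \<mu>"
      then have "fst z \<in> torus_cell" using sets_eq_imp_space_eq[OF sets\<mu>] by (auto simp: space_pair_measure)
      then show "norm (\<beta> K (snd z)) \<le> indicator (torus_cell \<times> cball 0 R) z"
        using supp[of "snd z" K] ellipsoid_bump_bounds[of R "real K" ?B "snd z"]
        by (cases z) (auto simp: indicator_def \<beta>_def not_le[symmetric])
    qed
    have "torus_cell \<times> (\<Union>j<r. resonant_vectors j) \<in> null_sets \<mu>"
      using null\<mu> resonant_union_measurable[OF r] unfolding null_sets_def sets\<mu> by (auto intro!: pair_measureI cell)
    then have "AE z in \<mu>. z \<notin> torus_cell \<times> (\<Union>j<r. resonant_vectors j)" by (rule AE_not_in)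
    then show "AE z in \<mu>. (\<lambda>K. \<beta> K (snd z)) \<longlonglongrightarrow> 0"
      using AE_space
    proof eventually_elim
      case (elim z)
      obtain x \<xi> where z: "z = (x, \<xi>)" by fastforce
      have "x \<in> torus_cell" using elim(2) z sets_eq_imp_space_eq[OF sets\<mu>] by (auto simp: space_pair_measure)
      then have "\<xi> \<notin> (\<Union>j<r. resonant_vectors j)" using elim(1) z by auto
      then obtain k where k: "k \<in> B" "real_vec k \<bullet> \<xi> \<noteq> 0" using orthogonal_in_resonant_union[OF r B] by blast
      define s where "s = (\<Sum>l\<in>?B. (\<xi> \<bullet> l)\<^sup>2)"
      have "0 < s"
        unfolding s_def by (rule sum_pos2[OF finB, of "real_vec k"]) (use k in \<open>auto simp: inner_commute\<close>)
      obtain K0 where K0: "R\<^sup>2 / s \<le> real K0" using real_arch_simple by blast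
      have "\<beta> K \<xi> = 0" if "K0 \<le> K" for K
      proof -
        have "R\<^sup>2 / s \<le> real K" using K0 that by linarith
        then have "R\<^sup>2 \<le> real K * s" using \<open>0 < s\<close> by (simp add: divide_le_eq)
        then show ?thesis unfolding \<beta>_def by (intro ellipsoid_bump_zero) (simp add: s_def add_increasing)
      qed
      then have "\<forall>\<^sub>F K in sequentially. 0 = \<beta> K \<xi>" by (auto simp: eventually_sequentially)
      then show ?case unfolding z snd_conv by (rule Lim_transform_eventually[OF tendsto_const])
    qed
  qed simp
  then have "c0 * e \<le> (LINT z|\<mu>. 0)" using low by (intro LIMSEQ_le_const) auto
  then have "c0 * e \<le> 0" by simp
  moreover have "0 < c0 * e" using c0 e by simp
  ultimately show False by linarith
qed

section \<open>Autocorrelation of the non-resonant modes\<close>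

lemma sum_UN_le:
  fixes g :: "'a \<Rightarrow> real"
  assumes "finite I" "\<And>i. i \<in> I \<Longrightarrow> finite (A i)" "\<And>x. 0 \<le> g x"
  shows "sum g (\<Union>i\<in>I. A i) \<le> (\<Sum>i\<in>I. sum g (A i))"
  using assms(1,2)
proof (induction I rule: finite_induct)
  case (insert i I)
  have "sum g (A i \<union> (\<Union>i\<in>I. A i)) \<le> sum g (A i) + sum g (\<Union>i\<in>I. A i)"
    using insert assms(3) by (subst sum_Un) (auto intro!: sum_nonneg)
  then show ?case using insert by auto
qed simp

text \<open>
  The modes for which a change of \<open>h k \<bullet> l\<close> by at most \<open>w\<close> may carry it across the threshold
  \<open>\<eta>\<close>.
\<close>

definition threshold_modes :: "(int^'d) set \<Rightarrow> real \<Rightarrow> real \<Rightarrow> real \<Rightarrow> (int^'d) set" where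
  "threshold_modes L h w \<eta> = {k. \<exists>l\<in>L. \<eta> - w < \<bar>h * (real_vec k \<bullet> real_vec l)\<bar> \<and> \<bar>h * (real_vec k \<bullet> real_vec l)\<bar> \<le> \<eta>}"

text \<open>
  The critical intervals below the \<open>J\<close> equidistant thresholds are disjoint, so for each \<open>l\<close> their
  masses add up to at most \<open>Q\<close>, and one of the thresholds has at most an average share.
\<close>

lemma good_threshold_exists:
  fixes g :: "int^'d \<Rightarrow> real"
  assumes g: "\<And>k. 0 \<le> g k" and Q: "\<And>F. finite F \<Longrightarrow> sum g F \<le> Q"
    and L: "finite L" and J: "0 < J" and \<delta>: "0 < \<delta>" and w: "w \<le> \<delta> / real J" and F: "finite F"
  obtains j where "1 \<le> j" "j \<le> J" "sum g (F \<inter> threshold_modes L h w (\<delta> * real j / real J)) \<le> real (card L) * Q / real J"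
proof -
  let ?\<eta> = "\<lambda>j. \<delta> * real j / real J"
  let ?A = "\<lambda>l j. {k \<in> F. ?\<eta> j - w < \<bar>h * (real_vec k \<bullet> real_vec l)\<bar> \<and> \<bar>h * (real_vec k \<bullet> real_vec l)\<bar> \<le> ?\<eta> j}"
  let ?T = "\<lambda>j. F \<inter> threshold_modes L h w (?\<eta> j)"
  have one: "(\<Sum>j=1..J. sum g (?A l j)) \<le> Q" for l
  proof -
    have step: "?\<eta> i \<le> ?\<eta> j - w" if "i < j" for i j
    proof -
      have "real i + 1 \<le> real j" using that by linarith
      then have "\<delta> * (real i + 1) / real J \<le> \<delta> * real j / real J"
        using \<delta> J by (intro divide_right_mono mult_left_mono) auto
      then show ?thesis using w by (simp add: algebra_simps add_divide_distrib)
    qed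
    have disj: "?A l i \<inter> ?A l j = {}" if "i \<noteq> j" for i j
    proof (rule ccontr)
      assume "?A l i \<inter> ?A l j \<noteq> {}"
      then obtain k where k: "?\<eta> i - w < \<bar>h * (real_vec k \<bullet> real_vec l)\<bar>" "\<bar>h * (real_vec k \<bullet> real_vec l)\<bar> \<le> ?\<eta> i"
        "?\<eta> j - w < \<bar>h * (real_vec k \<bullet> real_vec l)\<bar>" "\<bar>h * (real_vec k \<bullet> real_vec l)\<bar> \<le> ?\<eta> j" by blast
      show False using step[of i j] step[of j i] k \<open>i \<noteq> j\<close> by linarith
    qed
    have "(\<Sum>j=1..J. sum g (?A l j)) = sum g (\<Union>j\<in>{1..J}. ?A l j)"
      by (rule sum.UNION_disjoint[symmetric]) (use F disj in auto)
    also have "\<dots> \<le> Q" using F by (intro Q) auto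
    finally show ?thesis .
  qed
  have "(\<Sum>j=1..J. sum g (?T j)) \<le> (\<Sum>j=1..J. \<Sum>l\<in>L. sum g (?A l j))"
  proof (rule sum_mono)
    fix j
    have "?T j = (\<Union>l\<in>L. ?A l j)" by (auto simp: threshold_modes_def)
    then show "sum g (?T j) \<le> (\<Sum>l\<in>L. sum g (?A l j))" using sum_UN_le[of L "\<lambda>l. ?A l j" g] L F g by simp
  qed
  also have "\<dots> = (\<Sum>l\<in>L. \<Sum>j=1..J. sum g (?A l j))" by (rule sum.swap)
  also have "\<dots> \<le> (\<Sum>l\<in>L. Q)" by (intro sum_mono one)
  finally have tot: "(\<Sum>j=1..J. sum g (?T j)) \<le> real (card L) * Q" by simp
  have "\<exists>j\<in>{1..J}. sum g (?T j) \<le> real (card L) * Q / real J"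
  proof (rule ccontr)
    assume "\<not> ?thesis"
    then have "(\<Sum>j=1..J. real (card L) * Q / real J) < (\<Sum>j=1..J. sum g (?T j))"
      using J by (intro sum_strict_mono) (auto simp: not_le)
    then show False using tot J by simp
  qed
  then show ?thesis using that by auto
qed

lemma autocorrelation_norm_le:
  fixes u :: "real^'d \<Rightarrow> complex"
  assumes E: "finite E"
  defines "g \<equiv> \<lambda>x. cmod (fourier_coeff u (inv real_vec x))"
  shows "cmod (autocorrelation u E l s) \<le> (\<Sum>x\<in>chords (real_vec ` E) (real_vec l, real_of_int s). g x * g (x - real_vec l))"
proof -
  let ?S = "{k\<in>E. k - l \<in> E \<and> (norm (real_vec (k - l)))\<^sup>2 - (norm (real_vec k))\<^sup>2 = real_of_int s}"
  have inj: "inj (real_vec :: int^'d \<Rightarrow> real^'d)" by (simp add: inj_def)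
  have g: "g (real_vec k) = cmod (fourier_coeff u k)" for k using inj by (simp add: g_def)
  have mem: "real_vec k - real_vec l \<in> real_vec ` E \<longleftrightarrow> k - l \<in> E" for k
    unfolding real_vec_diff[symmetric] using inj by (rule inj_image_mem_iff)
  have chord: "(norm (real_vec (k - l)))\<^sup>2 - (norm (real_vec k))\<^sup>2 = real_of_int s
      \<longleftrightarrow> 2 * (real_vec k \<bullet> real_vec l) = real_vec l \<bullet> real_vec l - real_of_int s" for k
    by (simp add: real_vec_diff power2_norm_eq_inner inner_diff_left inner_diff_right inner_commute) linarith
  have eq: "chords (real_vec ` E) (real_vec l, real_of_int s) = real_vec ` ?S"
    unfolding chords_def using mem chord by auto
  have "cmod (autocorrelation u E l s) \<le> (\<Sum>k\<in>?S. cmod (fourier_coeff u k) * cmod (fourier_coeff u (k - l)))"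
    unfolding autocorrelation_def by (rule sum_norm_le) (simp add: norm_mult)
  also have "\<dots> = (\<Sum>k\<in>?S. g (real_vec k) * g (real_vec k - real_vec l))"
    by (simp add: g real_vec_diff[symmetric])
  also have "\<dots> = (\<Sum>x\<in>chords (real_vec ` E) (real_vec l, real_of_int s). g x * g (x - real_vec l))"
    unfolding eq by (subst sum.reindex) (auto simp: inj_on_def)
  finally show ?thesis .
qed

text \<open>
  Let \<open>V x\<close> be the span of the displacements \<open>l\<close> that are almost orthogonal to \<open>h x\<close>. On the hyperplane
  of \<open>(l, s)\<close> the product \<open>h x \<bullet> l\<close> is of order \<open>h\<close>, so \<open>l\<close> lies in \<open>V x\<close>; and \<open>V\<close> is the same at both
  ends of a pair because the modes near the threshold have been removed. So \<open>autocorrelation_power_sum_le\<close> applies.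
\<close>

lemma autocorrelation_bound:
  fixes u :: "real^'d \<Rightarrow> complex" and M :: "((int^'d) \<times> int) set"
  assumes E: "finite E" and M: "finite M" and p: "1 \<le> p"
    and M0: "\<And>l s. (l, s) \<in> M \<Longrightarrow> l \<noteq> 0 \<and> l \<in> L"
    and Q: "(\<Sum>k\<in>E. (cmod (fourier_coeff u k))\<^sup>2) \<le> Q"
    and h: "0 < h"
    and C1: "\<And>l l'. l \<in> L \<Longrightarrow> l' \<in> L \<Longrightarrow> \<bar>real_vec l \<bullet> real_vec l'\<bar> \<le> C1"
    and C2: "\<And>l s. (l, s) \<in> M \<Longrightarrow> \<bar>real_vec l \<bullet> real_vec l - real_of_int s\<bar> / 2 \<le> C1"
    and \<eta>: "h * C1 \<le> \<eta>"
    and thr: "E \<inter> threshold_modes L h (h * C1) \<eta> = {}"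
    and dim: "\<And>k. k \<in> E \<Longrightarrow> dim (span (real_vec ` {l\<in>L. \<bar>h * (real_vec k \<bullet> real_vec l)\<bar> \<le> \<eta>})) < p"
  shows "(\<Sum>(l, s)\<in>M. cmod (autocorrelation u E l s) ^ p) \<le> (real p - 1) * Q ^ p"
proof -
  define g where "g x = cmod (fourier_coeff u (inv real_vec x))" for x :: "real^'d"
  define V where "V x = span (real_vec ` {l\<in>L. \<bar>h * (x \<bullet> real_vec l)\<bar> \<le> \<eta>})" for x :: "real^'d"
  define \<iota> where "\<iota> = (\<lambda>(l :: int^'d, s :: int). (real_vec l, real_of_int s))"
  have inj: "inj (real_vec :: int^'d \<Rightarrow> real^'d)" by (simp add: inj_def)
  have inj\<iota>: "inj_on \<iota> M" by (auto simp: inj_on_def \<iota>_def)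
  have "(\<Sum>(l, s)\<in>M. cmod (autocorrelation u E l s) ^ p)
      \<le> (\<Sum>m\<in>M. (\<Sum>x\<in>chords (real_vec ` E) (\<iota> m). g x * g (x - fst (\<iota> m))) ^ p)"
  proof (rule sum_mono)
    fix m assume "m \<in> M"
    obtain l s where m: "m = (l, s)" by fastforce
    show "(case m of (l, s) \<Rightarrow> cmod (autocorrelation u E l s) ^ p)
        \<le> (\<Sum>x\<in>chords (real_vec ` E) (\<iota> m). g x * g (x - fst (\<iota> m))) ^ p"
      using autocorrelation_norm_le[OF E, of u l s] by (simp add: m \<iota>_def g_def power_mono)
  qed
  also have "\<dots> = (\<Sum>m\<in>\<iota> ` M. (\<Sum>x\<in>chords (real_vec ` E) m. g x * g (x - fst m)) ^ p)"
    by (simp add: sum.reindex[OF inj\<iota>])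
  also have "\<dots> \<le> (real p - 1) * (\<Sum>x\<in>real_vec ` E. (g x)\<^sup>2) ^ p"
  proof (rule autocorrelation_power_sum_le[where V = V])
    fix m x assume m: "m \<in> \<iota> ` M" and x: "x \<in> chords (real_vec ` E) m"
    obtain l s where ls: "(l, s) \<in> M" "m = (real_vec l, real_of_int s)" using m by (auto simp: \<iota>_def)
    obtain k where k: "k \<in> E" "x = real_vec k" using x by (auto simp: chords_def)
    have "x - real_vec l \<in> real_vec ` E" using x ls by (auto simp: chords_def)
    then have kl: "k - l \<in> E" unfolding k(2) real_vec_diff[symmetric] using inj by (simp add: inj_image_mem_iff)
    have l: "l \<in> L" using M0[OF ls(1)] by simp
    have ch: "2 * (real_vec k \<bullet> real_vec l) = real_vec l \<bullet> real_vec l - real_of_int s"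
      using x by (simp add: chords_def ls k)
    have "\<bar>real_vec k \<bullet> real_vec l\<bar> \<le> C1" using C2[OF ls(1)] unfolding ch[symmetric] by simp
    then have "\<bar>h * (real_vec k \<bullet> real_vec l)\<bar> \<le> h * C1" using h by (simp add: abs_mult mult_left_mono)
    then have "\<bar>h * (real_vec k \<bullet> real_vec l)\<bar> \<le> \<eta>" using \<eta> by linarith
    then have 1: "fst m \<in> V x" unfolding V_def k ls using l by (auto intro!: span_base)
    have iff: "\<bar>h * (real_vec (k - l) \<bullet> real_vec l')\<bar> \<le> \<eta> \<longleftrightarrow> \<bar>h * (real_vec k \<bullet> real_vec l')\<bar> \<le> \<eta>" if l': "l' \<in> L" for l'
    proof -
      have nk: "\<not> (\<eta> - h * C1 < \<bar>h * (real_vec k \<bullet> real_vec l')\<bar> \<and> \<bar>h * (real_vec k \<bullet> real_vec l')\<bar> \<le> \<eta>)"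
        and nkl: "\<not> (\<eta> - h * C1 < \<bar>h * (real_vec (k - l) \<bullet> real_vec l')\<bar> \<and> \<bar>h * (real_vec (k - l) \<bullet> real_vec l')\<bar> \<le> \<eta>)"
        using thr k(1) kl l' unfolding threshold_modes_def by blast+
      have "h * (real_vec (k - l) \<bullet> real_vec l') = h * (real_vec k \<bullet> real_vec l') - h * (real_vec l \<bullet> real_vec l')"
        by (simp add: real_vec_diff inner_diff_left right_diff_distrib)
      moreover have "\<bar>h * (real_vec l \<bullet> real_vec l')\<bar> \<le> h * C1"
        using C1[OF l l'] h by (simp add: abs_mult mult_left_mono)
      ultimately show ?thesis using nk nkl by linarith
    qed
    have "{l'\<in>L. \<bar>h * ((x - fst m) \<bullet> real_vec l')\<bar> \<le> \<eta>} = {l'\<in>L. \<bar>h * (x \<bullet> real_vec l')\<bar> \<le> \<eta>}"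
      using iff by (auto simp: k ls real_vec_diff[symmetric])
    then have "V (x - fst m) = V x" unfolding V_def by simp
    with 1 show "fst m \<in> V x \<and> V (x - fst m) = V x" by simp
  next
    fix m assume "m \<in> \<iota> ` M"
    then show "fst m \<noteq> 0" using M0 by (auto simp: \<iota>_def)
  next
    fix x assume "x \<in> real_vec ` E"
    then show "subspace (V x) \<and> dim (V x) < p" using dim by (auto simp: V_def)
  qed (use E M p in \<open>auto simp: g_def\<close>)
  also have "(\<Sum>x\<in>real_vec ` E. (g x)\<^sup>2) = (\<Sum>k\<in>E. (cmod (fourier_coeff u k))\<^sup>2)"
    using inj by (simp add: sum.reindex inj_on_subset[OF inj] g_def)
  also have "(real p - 1) * (\<Sum>k\<in>E. (cmod (fourier_coeff u k))\<^sup>2) ^ p \<le> (real p - 1) * Q ^ p"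
    using Q p by (intro mult_left_mono power_mono sum_nonneg) auto
  finally show ?thesis .
qed

text \<open>
  Three kinds of modes are discarded, each of mass at most \<open>\<tau> / 3\<close>: those with \<open>|h k| > R\<close>, by the
  tail condition; those near the threshold \<open>\<eta>\<close>; and those in the ellipsoids of the sets of \<open>p\<close> independent displacements, by
  \<open>no_concentration_near_resonances\<close>. For a remaining mode \<open>k\<close>, fewer than \<open>p\<close> independent displacements are
  almost orthogonal to \<open>h k\<close>.
\<close>

theorem truncated_autocorrelation_bound:
  fixes u :: "nat \<Rightarrow> real^'d \<Rightarrow> complex" and M :: "((int^'d) \<times> int) set" and r :: nat
  defines "p \<equiv> CARD('d) + 1 - r"
  assumes Q: "\<And>n F. finite F \<Longrightarrow> (\<Sum>k\<in>F. (cmod (fourier_coeff (u n) k))\<^sup>2) \<le> Q"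
    and h: "\<And>n. 0 < h n" "h \<longlonglongrightarrow> 0"
    and tail: "((\<lambda>R :: real. limsup (\<lambda>n. ereal
          (\<Sum>\<^sub>\<infinity>l\<in>{l. norm (real_vec l) > R / h n}. (cmod (fourier_coeff (u n) l))\<^sup>2))) \<longlongrightarrow> 0) at_top"
    and null: "\<And>\<mu>. wigner_accumulation_point h u \<mu> \<Longrightarrow> emeasure \<mu> (torus_cell \<times> (\<Union>j<r. resonant_vectors j)) = 0"
    and r: "r \<le> CARD('d)" and M: "finite M" "\<And>l s. (l, s) \<in> M \<Longrightarrow> l \<noteq> 0" and \<tau>: "0 < \<tau>"
  shows "\<forall>\<^sub>F n in sequentially. \<exists>E. finite E
     \<and> (\<forall>F. finite F \<longrightarrow> F \<inter> E = {} \<longrightarrow> (\<Sum>k\<in>F. (cmod (fourier_coeff (u n) k))\<^sup>2) \<le> \<tau>)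
     \<and> (\<Sum>(l, s)\<in>M. cmod (autocorrelation (u n) E l s) ^ p) \<le> (real p - 1) * Q ^ p"
proof -
  let ?g = "\<lambda>n k. (cmod (fourier_coeff (u n) k))\<^sup>2"
  have p: "1 \<le> p" using r by (simp add: p_def)
  have Q0: "0 \<le> Q" using Q[of "{}"] by simp
  define L where "L = fst ` M"
  have L: "finite L" using M by (simp add: L_def)
  define \<B> where "\<B> = {B. B \<subseteq> L \<and> independent (real_vec ` B) \<and> card B = p}"
  have \<B>: "finite \<B>" using L by (simp add: \<B>_def)
  define e where "e = \<tau> / (3 * (real (card \<B>) + 1))"
  have e: "0 < e" using \<tau> by (simp add: e_def)
  have \<tau>3: "0 < ereal (\<tau> / 3)" using \<tau> by simp
  have "\<forall>\<^sub>F R :: real in at_top. limsup (\<lambda>n. ereal (\<Sum>\<^sub>\<infinity>l\<in>{l. norm (real_vec l) > R / h n}. ?g n l)) < ereal (\<tau> / 3) \<and> 0 < R"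
    using order_tendstoD(2)[OF tail \<tau>3] eventually_gt_at_top[of 0] by (rule eventually_conj)
  then obtain R where R: "0 < R" "limsup (\<lambda>n. ereal (\<Sum>\<^sub>\<infinity>l\<in>{l. norm (real_vec l) > R / h n}. ?g n l)) < ereal (\<tau> / 3)"
    using eventually_happens'[OF trivial_limit_at_top_linorder] by blast
  have ev_tail: "\<forall>\<^sub>F n in sequentially. (\<Sum>\<^sub>\<infinity>l\<in>{l. norm (real_vec l) > R / h n}. ?g n l) < \<tau> / 3"
    using Limsup_lessD[OF R(2)] by simp
  have "\<exists>K>0. \<forall>\<^sub>F n in sequentially. sum (?g n) (ellipsoid_modes (2 * R) K B (h n)) \<le> e" if "B \<in> \<B>" for B
  proof -
    have "finite B" using that L finite_subset by (auto simp: \<B>_def)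
    then show ?thesis
      using no_concentration_near_resonances[of u Q h r B "2 * R" e] Q h null r that R(1) e unfolding \<B>_def p_def by force
  qed
  then have "\<forall>B\<in>\<B>. \<exists>K. 0 < K \<and> (\<forall>\<^sub>F n in sequentially. sum (?g n) (ellipsoid_modes (2 * R) K B (h n)) \<le> e)"
    by blast
  from bchoice[OF this] obtain K where K: "\<And>B. B \<in> \<B> \<Longrightarrow> 0 < K B"
    and evK: "\<And>B. B \<in> \<B> \<Longrightarrow> \<forall>\<^sub>F n in sequentially. sum (?g n) (ellipsoid_modes (2 * R) (K B) B (h n)) \<le> e"
    by blast
  have ev_ell: "\<forall>\<^sub>F n in sequentially. \<forall>B\<in>\<B>. sum (?g n) (ellipsoid_modes (2 * R) (K B) B (h n)) \<le> e"
    using \<B> evK by (intro eventually_ball_finite ballI)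
  \<comment> \<open>One width \<open>\<delta>\<close> that suits all the ellipsoids: \<open>Km\<close> bounds their eccentricities.\<close>
  define Km where "Km = sum K \<B> + 1"
  have Km: "0 < Km" "\<And>B. B \<in> \<B> \<Longrightarrow> K B \<le> Km"
  proof -
    have "0 \<le> sum K \<B>" using K by (intro sum_nonneg) (simp add: less_imp_le)
    then show "0 < Km" by (simp add: Km_def)
    fix B assume "B \<in> \<B>"
    then have "K B \<le> sum K \<B>" using K \<B> by (intro member_le_sum) (auto simp: less_imp_le)
    then show "K B \<le> Km" by (simp add: Km_def)
  qed
  define \<delta> where "\<delta> = R / sqrt (Km * real p)"
  have Kp: "0 < Km * real p" using Km(1) p by simp
  have \<delta>: "0 < \<delta>" "Km * real p * \<delta>\<^sup>2 = R\<^sup>2"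
  proof -
    show "0 < \<delta>" unfolding \<delta>_def using R(1) Kp by (intro divide_pos_pos real_sqrt_gt_zero)
    have "Km * real p \<noteq> 0" using Kp by linarith
    then show "Km * real p * \<delta>\<^sup>2 = R\<^sup>2"
      unfolding \<delta>_def power_divide real_sqrt_pow2[OF less_imp_le[OF Kp]] times_divide_eq_right
      by (rule nonzero_mult_div_cancel_left)
  qed
  obtain J0 where J0: "3 * (real (card L) * Q) / \<tau> \<le> real J0" using real_arch_simple by blast
  define J where "J = Suc J0"
  have J: "0 < J" "real (card L) * Q / real J \<le> \<tau> / 3"
  proof -
    have "3 * (real (card L) * Q) / \<tau> \<le> real J" using J0 by (simp add: J_def)
    then show "real (card L) * Q / real J \<le> \<tau> / 3" using \<tau> by (simp add: J_def field_simps)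
  qed (simp add: J_def)
  \<comment> \<open>\<open>h C1\<close> bounds the change of \<open>h k \<bullet> l'\<close> along a displacement and the size of \<open>h k \<bullet> l\<close> on the hyperplanes.\<close>
  define C1 where "C1 = (\<Sum>l\<in>L. \<Sum>l'\<in>L. \<bar>real_vec l \<bullet> real_vec l'\<bar>) + (\<Sum>(l, s)\<in>M. \<bar>real_vec l \<bullet> real_vec l - real_of_int s\<bar> / 2)"
  have C1: "\<bar>real_vec l \<bullet> real_vec l'\<bar> \<le> C1" if "l \<in> L" "l' \<in> L" for l l'
  proof -
    have "\<bar>real_vec l \<bullet> real_vec l'\<bar> \<le> (\<Sum>l'\<in>L. \<bar>real_vec l \<bullet> real_vec l'\<bar>)" using L that by (intro member_le_sum) auto
    also have "\<dots> \<le> (\<Sum>l\<in>L. \<Sum>l'\<in>L. \<bar>real_vec l \<bullet> real_vec l'\<bar>)"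
      using L that by (intro member_le_sum[where f = "\<lambda>l. \<Sum>l'\<in>L. \<bar>real_vec l \<bullet> real_vec l'\<bar>"]) (auto intro: sum_nonneg)
    also have "\<dots> \<le> C1" unfolding C1_def by (simp add: sum_nonneg case_prod_beta')
    finally show ?thesis .
  qed
  have C2: "\<bar>real_vec l \<bullet> real_vec l - real_of_int s\<bar> / 2 \<le> C1" if "(l, s) \<in> M" for l s
  proof -
    have "(case (l, s) of (l, s) \<Rightarrow> \<bar>real_vec l \<bullet> real_vec l - real_of_int s\<bar> / 2) \<le> (\<Sum>(l, s)\<in>M. \<bar>real_vec l \<bullet> real_vec l - real_of_int s\<bar> / 2)"
      using M that by (intro member_le_sum) auto
    moreover have "0 \<le> (\<Sum>l\<in>L. \<Sum>l'\<in>L. \<bar>real_vec l \<bullet> real_vec l'\<bar>)" by (intro sum_nonneg) auto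
    ultimately show ?thesis by (simp add: C1_def)
  qed
  have "(\<lambda>n. h n * C1) \<longlonglongrightarrow> 0" using tendsto_mult_left_zero[OF h(2)] .
  moreover have \<delta>J: "0 < \<delta> / real J" using \<delta> J by simp
  ultimately have ev_h: "\<forall>\<^sub>F n in sequentially. h n * C1 < \<delta> / real J" by (rule order_tendstoD(2))
  show ?thesis
    using ev_tail ev_ell ev_h
  proof eventually_elim
    case (elim n)
    let ?ball = "{k :: int^'d. norm (h n *\<^sub>R real_vec k) \<le> R}"
    have ball: "finite ?ball" using h(1) by (rule finite_modes_in_ball)
    obtain j where j: "1 \<le> j" "j \<le> J"
      and thr: "sum (?g n) (?ball \<inter> threshold_modes L (h n) (h n * C1) (\<delta> * real j / real J)) \<le> real (card L) * Q / real J"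
      by (rule good_threshold_exists[of "?g n" Q L J \<delta> "h n * C1" ?ball "h n"])
        (use Q L J \<delta>(1) elim(3) ball in \<open>auto simp: less_imp_le\<close>)
    define \<eta> where "\<eta> = \<delta> * real j / real J"
    have \<eta>J: "\<delta> / real J \<le> \<eta>" using j \<delta>(1) by (simp add: \<eta>_def divide_right_mono)
    have \<eta>\<delta>: "\<eta> \<le> \<delta>" using j \<delta>(1) J(1) by (simp add: \<eta>_def divide_le_eq mult_left_mono)
    have \<eta>0: "0 \<le> \<eta>" using \<eta>J \<delta>J by linarith
    define T where "T = ?ball \<inter> threshold_modes L (h n) (h n * C1) \<eta>"
    define G where "G = (\<Union>B\<in>\<B>. ellipsoid_modes (2 * R) (K B) B (h n))"
    define E where "E = ?ball - T - G"
    have finell: "finite (ellipsoid_modes (2 * R) (K B) B (h n))" if "B \<in> \<B>" for B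
    proof (rule finite_subset[OF _ finite_modes_in_ball[OF h(1)[of n], of "2 * R"]])
      show "ellipsoid_modes (2 * R) (K B) B (h n) \<subseteq> {k. norm (h n *\<^sub>R real_vec k) \<le> 2 * R}"
        using ellipsoid_modes_in_ball[of "K B" "2 * R"] K[OF that] R(1) by (auto simp: less_imp_le)
    qed
    have finG: "finite G" using \<B> finell by (auto simp: G_def)
    have finT: "finite T" using ball by (simp add: T_def)
    have E: "finite E" using ball by (simp add: E_def)
    have sumG: "sum (?g n) G \<le> \<tau> / 3"
    proof -
      have "sum (?g n) G \<le> (\<Sum>B\<in>\<B>. sum (?g n) (ellipsoid_modes (2 * R) (K B) B (h n)))"
        unfolding G_def by (rule sum_UN_le) (use \<B> finell in auto)
      also have "\<dots> \<le> (\<Sum>B\<in>\<B>. e)" by (rule sum_mono) (use elim(2) in auto)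
      also have "\<dots> \<le> \<tau> / 3" using \<tau> by (simp add: e_def field_simps)
      finally show ?thesis .
    qed
    have sumT: "sum (?g n) T \<le> \<tau> / 3" using thr J(2) unfolding T_def \<eta>_def by linarith
    have tails: "sum (?g n) F \<le> \<tau>" if F: "finite F" "F \<inter> E = {}" for F
    proof -
      let ?O = "F - ?ball"
      have summ: "?g n summable_on A" for A
        by (rule nonneg_bdd_above_summable_on) (use Q in \<open>auto intro!: bdd_aboveI2[where M = Q]\<close>)
      have "?O \<subseteq> {l. norm (real_vec l) > R / h n}"
        using h(1)[of n] by (auto simp: divide_less_eq not_le mult.commute)
      then have "sum (?g n) ?O \<le> (\<Sum>\<^sub>\<infinity>l\<in>{l. norm (real_vec l) > R / h n}. ?g n l)"
        using F by (intro finite_sum_le_infsum summ) auto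
      then have O: "sum (?g n) ?O \<le> \<tau> / 3" using elim(1) by linarith
      have "F \<subseteq> ?O \<union> (T \<union> G)" using F(2) by (auto simp: E_def)
      then have "sum (?g n) F \<le> sum (?g n) (?O \<union> (T \<union> G))"
        using F finT finG by (intro sum_mono2) auto
      also have "\<dots> \<le> sum (?g n) ?O + sum (?g n) (T \<union> G)"
        using F finT finG by (subst sum_Un) (auto intro!: sum_nonneg)
      also have "sum (?g n) (T \<union> G) \<le> sum (?g n) T + sum (?g n) G"
        using finT finG by (subst sum_Un) (auto intro!: sum_nonneg)
      finally show ?thesis using O sumT sumG by linarith
    qed
    have dims: "dim (span (real_vec ` {l\<in>L. \<bar>h n * (real_vec k \<bullet> real_vec l)\<bar> \<le> \<eta>})) < p" if k: "k \<in> E" for k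
    proof (rule ccontr)
      let ?S = "{l\<in>L. \<bar>h n * (real_vec k \<bullet> real_vec l)\<bar> \<le> \<eta>}"
      assume "\<not> dim (span (real_vec ` ?S)) < p"
      then have dimS: "p \<le> dim (real_vec ` ?S)" by simp
      obtain B0 where B0: "B0 \<subseteq> real_vec ` ?S" "independent B0" "card B0 = dim (real_vec ` ?S)"
        by (rule basis_exists[of "real_vec ` ?S"])
      obtain B1 where B1: "B1 \<subseteq> B0" "card B1 = p" "finite B1"
        by (rule obtain_subset_with_card_n[of p B0]) (use dimS B0(3) in simp)
      have "B1 \<subseteq> real_vec ` ?S" using B1 B0 by blast
      then obtain B where B: "B \<subseteq> ?S" "B1 = real_vec ` B" by (meson subset_imageE)
      have card: "card B = p" using B1(2) unfolding B(2) by (subst (asm) card_image) (auto simp: inj_on_def)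
      have "independent (real_vec ` B)" using B0(2) B1(1) B(2) independent_mono by blast
      then have B\<B>: "B \<in> \<B>" using B(1) card by (auto simp: \<B>_def)
      have "(\<Sum>l\<in>B. ((h n *\<^sub>R real_vec k) \<bullet> real_vec l)\<^sup>2) \<le> (\<Sum>l\<in>B. \<delta>\<^sup>2)"
      proof (rule sum_mono)
        fix l assume "l \<in> B"
        then have "\<bar>h n * (real_vec k \<bullet> real_vec l)\<bar> \<le> \<delta>" using B(1) \<eta>\<delta> by auto
        then have "\<bar>h n * (real_vec k \<bullet> real_vec l)\<bar>\<^sup>2 \<le> \<delta>\<^sup>2" by (intro power_mono) auto
        then show "((h n *\<^sub>R real_vec k) \<bullet> real_vec l)\<^sup>2 \<le> \<delta>\<^sup>2" by simp
      qed
      also have "\<dots> = real p * \<delta>\<^sup>2" using card by simp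
      finally have "K B * (\<Sum>l\<in>B. ((h n *\<^sub>R real_vec k) \<bullet> real_vec l)\<^sup>2) \<le> Km * (real p * \<delta>\<^sup>2)"
        using Km(1) Km(2)[OF B\<B>] by (intro mult_mono sum_nonneg) auto
      also have "\<dots> = R\<^sup>2" using \<delta>(2) by (simp add: mult.assoc)
      finally have 1: "K B * (\<Sum>l\<in>B. ((h n *\<^sub>R real_vec k) \<bullet> real_vec l)\<^sup>2) \<le> R\<^sup>2" .
      have "norm (h n *\<^sub>R real_vec k) \<le> R" using k by (simp add: E_def)
      then have "(norm (h n *\<^sub>R real_vec k))\<^sup>2 \<le> R\<^sup>2" by (intro power_mono) auto
      with 1 have "k \<in> ellipsoid_modes (2 * R) (K B) B (h n)" by (simp add: ellipsoid_modes_def)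
      then have "k \<in> G" using B\<B> by (auto simp: G_def)
      then show False using k by (simp add: E_def)
    qed
    have "(\<Sum>(l, s)\<in>M. cmod (autocorrelation (u n) E l s) ^ p) \<le> (real p - 1) * Q ^ p"
    proof (rule autocorrelation_bound[where L = L and h = "h n" and ?C1.0 = C1 and \<eta> = \<eta>])
      show "h n * C1 \<le> \<eta>" using elim(3) \<eta>J by linarith
      show "E \<inter> threshold_modes L (h n) (h n * C1) \<eta> = {}" by (auto simp: E_def T_def)
      show "l \<noteq> 0 \<and> l \<in> L" if "(l, s) \<in> M" for l s using M(2)[OF that] that by (force simp: L_def)
    qed (use E M p Q h C1 C2 dims in auto)
    then show ?case using E tails by blast
  qed
qed

section \<open>Summability of the limit coefficients\<close>

lemma spacetime_fourier_coeff_alt: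
  fixes f :: "real \<Rightarrow> real^'d \<Rightarrow> real"
  shows "spacetime_fourier_coeff f l s =
    (LINT (t, x)|(circle \<Otimes>\<^sub>M torus). cis (- (real_of_int s * t)) * cis (- (real_vec l \<bullet> x)) * of_real (f t x))
      / complex_of_real ((2 * pi) ^ (CARD('d) + 1))"
proof -
  have "(LINT (t, x)|(circle \<Otimes>\<^sub>M torus). complex_of_real (f t x) * cis (- (real_vec l \<bullet> x + real_of_int s * t)))
      = (LINT (t, x)|(circle \<Otimes>\<^sub>M torus). cis (- (real_of_int s * t)) * cis (- (real_vec l \<bullet> x)) * of_real (f t x))"
    by (intro Bochner_Integration.integral_cong) (auto simp: cis_mult algebra_simps)
  then show ?thesis by (simp add: spacetime_fourier_coeff_def)
qed

text \<open>
  The measure with density \<open>ennreal (\<nu> t x)\<close> only sees the positive part of \<open>\<nu> t\<close>, which agrees with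
  \<open>\<nu> t\<close> almost everywhere.
\<close>

lemma spacetime_coefficient_density:
  fixes \<nu> :: "real \<Rightarrow> real^'d \<Rightarrow> real"
  assumes L1: "Linfty_L1 \<nu>" and pos: "AE t in circle. AE x in torus. 0 \<le> \<nu> t x"
  shows "(LINT t|circle. cis (- (real_of_int s * t)) * (LINT x|density torus (\<lambda>x. ennreal (\<nu> t x)). cis (- (real_vec l \<bullet> x))))
    = (LINT (t, x)|(circle \<Otimes>\<^sub>M torus). cis (- (real_of_int s * t)) * cis (- (real_vec l \<bullet> x)) * of_real (\<nu> t x))"
proof -
  let ?e = "\<lambda>t. cis (- (real_of_int s * t))" and ?f = "\<lambda>x :: real^'d. cis (- (real_vec l \<bullet> x))"
  define \<nu>' where "\<nu>' t x = max 0 (\<nu> t x)" for t x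
  have m[measurable]: "(\<lambda>(t, x). \<nu> t x) \<in> borel_measurable (circle \<Otimes>\<^sub>M torus)"
    and "\<exists>C. AE t in circle. integrable torus (\<nu> t) \<and> (LINT x|torus. \<bar>\<nu> t x\<bar>) \<le> C"
    using L1 by (auto simp: Linfty_L1_def)
  then obtain C where C: "AE t in circle. integrable torus (\<nu> t) \<and> (LINT x|torus. \<bar>\<nu> t x\<bar>) \<le> C" by blast
  have m'[measurable]: "(\<lambda>(t, x). \<nu>' t x) \<in> borel_measurable (circle \<Otimes>\<^sub>M torus)" unfolding \<nu>'_def by measurable
  have fm[measurable]: "?f \<in> borel_measurable torus" by (intro measurable_torus borel_character_minus)
  have em[measurable]: "?e \<in> borel_measurable circle"
    by (intro measurable_circle borel_measurable_continuous_onI continuous_intros)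
  have dens: "(LINT x|density torus (\<lambda>x. ennreal (\<nu> t x)). ?f x) = (LINT x|torus. ?f x * of_real (\<nu>' t x))"
    if t: "t \<in> space circle" for t
  proof -
    have nn: "0 \<le> \<nu>' t x" for x by (simp add: \<nu>'_def)
    have [measurable]: "\<nu>' t \<in> borel_measurable torus"
      using measurable_compose[OF measurable_Pair1'[OF t] m'] by simp
    have "(\<lambda>x. ennreal (\<nu> t x)) = (\<lambda>x. ennreal (\<nu>' t x))"
      by (auto simp: \<nu>'_def max_def ennreal_neg fun_eq_iff)
    then have "(LINT x|density torus (\<lambda>x. ennreal (\<nu> t x)). ?f x) = (LINT x|density torus (\<lambda>x. ennreal (\<nu>' t x)). ?f x)" by simp
    also have "\<dots> = (LINT x|torus. \<nu>' t x *\<^sub>R ?f x)"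
      by (rule integral_density) (auto simp: nn)
    finally show ?thesis by (simp add: scaleR_conv_of_real mult.commute)
  qed
  have "(LINT t|circle. ?e t * (LINT x|density torus (\<lambda>x. ennreal (\<nu> t x)). ?f x))
      = (LINT t|circle. ?e t * (LINT x|torus. ?f x * of_real (\<nu>' t x)))"
    by (intro Bochner_Integration.integral_cong) (simp_all only: dens)
  also have "\<dots> = (LINT t|circle. ?e t * (LINT x|torus. ?f x * of_real (\<nu> t x)))"
  proof (rule integral_cong_AE)
    show "AE t in circle. ?e t * (LINT x|torus. ?f x * of_real (\<nu>' t x)) = ?e t * (LINT x|torus. ?f x * of_real (\<nu> t x))"
      using pos AE_space
    proof eventually_elim
      case (elim t)
      have [measurable]: "\<nu>' t \<in> borel_measurable torus" "\<nu> t \<in> borel_measurable torus"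
        using measurable_compose[OF measurable_Pair1'[OF elim(2)] m'] measurable_compose[OF measurable_Pair1'[OF elim(2)] m] by simp_all
      have "(LINT x|torus. ?f x * of_real (\<nu>' t x)) = (LINT x|torus. ?f x * of_real (\<nu> t x))"
      proof (rule integral_cong_AE)
        show "AE x in torus. ?f x * of_real (\<nu>' t x) = ?f x * of_real (\<nu> t x)"
          using elim(1) by eventually_elim (simp add: \<nu>'_def)
      qed measurable
      then show ?case by simp
    qed
  qed measurable
  also have "\<dots> = (LINT (t, x)|(circle \<Otimes>\<^sub>M torus). ?e t * ?f x * of_real (\<nu> t x))"
    using spacetime.integral_fst'[OF spacetime_integrable[OF m C, of s l]] by (simp add: mult.assoc)
  finally show ?thesis .
qed

lemma flow_coefficients_converge:
  fixes u :: "nat \<Rightarrow> real^'d \<Rightarrow> complex" and \<nu> :: "real \<Rightarrow> real^'d \<Rightarrow> real"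
  assumes L1: "Linfty_L1 \<nu>" and pos: "AE t in circle. AE x in torus. 0 \<le> \<nu> t x"
    and acc: "weak_star_accumulation_point u (\<lambda>t. density torus (\<lambda>x. ennreal (\<nu> t x)))"
  obtains \<sigma> \<psi> where "strict_mono (\<sigma> :: nat \<Rightarrow> nat)" "\<And>n. schroedinger_flow (u n) (\<psi> n)"
    "\<And>l s. (\<lambda>n. spacetime_fourier_coeff (\<lambda>t x. (cmod (\<psi> (\<sigma> n) t x))\<^sup>2) l s) \<longlonglongrightarrow> spacetime_fourier_coeff \<nu> l s"
proof -
  obtain \<sigma> \<psi> where \<sigma>: "strict_mono (\<sigma> :: nat \<Rightarrow> nat)" and \<psi>: "\<And>n. schroedinger_flow (u n) (\<psi> n)"
    and lim: "\<And>(\<phi> :: real \<Rightarrow> complex) (a :: real^'d \<Rightarrow> complex).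
          integrable circle \<phi> \<Longrightarrow> continuous_on UNIV a \<Longrightarrow> torus_periodic a \<Longrightarrow>
          (\<lambda>n. LINT (t, x)|(circle \<Otimes>\<^sub>M torus). \<phi> t * a x * complex_of_real ((cmod (\<psi> (\<sigma> n) t x))\<^sup>2))
            \<longlonglongrightarrow> (LINT t|circle. \<phi> t * (LINT x|density torus (\<lambda>x. ennreal (\<nu> t x)). a x))"
    using acc unfolding weak_star_accumulation_point_def by blast
  have "(\<lambda>n. spacetime_fourier_coeff (\<lambda>t x. (cmod (\<psi> (\<sigma> n) t x))\<^sup>2) l s) \<longlonglongrightarrow> spacetime_fourier_coeff \<nu> l s" for l s
  proof -
    have "integrable circle (\<lambda>t. cis (- (real_of_int s * t)))"
      using circle_character_integrable[of "- real_of_int s"] by simp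
    moreover have "continuous_on UNIV (\<lambda>x :: real^'d. cis (- (real_vec l \<bullet> x)))" by (intro continuous_intros)
    moreover have "torus_periodic (\<lambda>x :: real^'d. cis (- (real_vec l \<bullet> x)))"
      using torus_periodic_character[of "- l"] by (simp add: real_vec_minus)
    ultimately have "(\<lambda>n. LINT (t, x)|(circle \<Otimes>\<^sub>M torus). cis (- (real_of_int s * t)) * cis (- (real_vec l \<bullet> x)) * complex_of_real ((cmod (\<psi> (\<sigma> n) t x))\<^sup>2))
        \<longlonglongrightarrow> (LINT t|circle. cis (- (real_of_int s * t)) * (LINT x|density torus (\<lambda>x. ennreal (\<nu> t x)). cis (- (real_vec l \<bullet> x))))"
      by (rule lim)
    then show ?thesis
      unfolding spacetime_fourier_coeff_alt spacetime_coefficient_density[OF L1 pos]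
      by (intro tendsto_divide tendsto_const) auto
  qed
  then show ?thesis using that \<sigma> \<psi> by blast
qed

lemma autocorrelation_zero_shift:
  assumes "s \<noteq> 0"
  shows "autocorrelation u E 0 s = 0"
  unfolding autocorrelation_def using assms by simp

lemma truncation_error_tendsto:
  "(\<lambda>i. (1 + 1 / (1 / real (Suc i))) * (2 * (1 / real (Suc i))\<^sup>2) + (1 / real (Suc i)) * Q) \<longlonglongrightarrow> 0"
proof -
  have lim: "(\<lambda>i. 1 / real (Suc i)) \<longlonglongrightarrow> 0" by (rule LIMSEQ_Suc[OF lim_1_over_n])
  have "(\<lambda>i. 2 * (1 / real (Suc i))\<^sup>2 + 2 * (1 / real (Suc i)) + (1 / real (Suc i)) * Q) \<longlonglongrightarrow> 2 * 0\<^sup>2 + 2 * 0 + 0 * Q"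
    by (intro tendsto_intros lim)
  moreover have "(1 + 1 / (1 / real (Suc i))) * (2 * (1 / real (Suc i))\<^sup>2) + (1 / real (Suc i)) * Q
      = 2 * (1 / real (Suc i))\<^sup>2 + 2 * (1 / real (Suc i)) + (1 / real (Suc i)) * Q" for i
  proof -
    have "(1 + 1 / x) * (2 * x\<^sup>2) + x * Q = 2 * x\<^sup>2 + 2 * x + x * Q" if "x \<noteq> 0" for x :: real
      using that by (simp add: power2_eq_square algebra_simps)
    from this[of "1 / real (Suc i)"] show ?thesis by simp
  qed
  ultimately show ?thesis by simp
qed

theorem theorem3p1:
  fixes u :: "nat \<Rightarrow> real^'d \<Rightarrow> complex"
    and r :: nat
    and \<nu> :: "real \<Rightarrow> real^'d \<Rightarrow> real"
  assumes u_L2: "\<And>n. u n \<in> L2_torus"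
    and u_bounded: "\<exists>C. \<forall>n. L2_norm (u n) \<le> C"
    and r: "1 \<le> r" "r < CARD('d)"
    and condition: "\<exists>h :: nat \<Rightarrow> real. (\<forall>n. 0 < h n) \<and> h \<longlonglongrightarrow> 0 \<and>
      ((\<lambda>R :: real. limsup (\<lambda>n. ereal
          (\<Sum>\<^sub>\<infinity>l\<in>{l. norm (real_vec l) > R / h n}. (cmod (fourier_coeff (u n) l))\<^sup>2)))
        \<longlongrightarrow> 0) at_top \<and>
      (\<forall>\<mu>. wigner_accumulation_point h u \<mu> \<longrightarrow>
        emeasure \<mu> (torus_cell \<times> (\<Union>j<r. resonant_vectors j)) = 0)"
    and \<nu>_L1: "Linfty_L1 \<nu>"
    and \<nu>_pos: "AE t in circle. AE x in torus. 0 \<le> \<nu> t x"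
    and \<nu>_acc: "weak_star_accumulation_point u (\<lambda>t. density torus (\<lambda>x. ennreal (\<nu> t x)))"
  shows "(\<lambda>(l, s). cmod (spacetime_fourier_coeff \<nu> l s) ^ (CARD('d) + 1 - r)) summable_on UNIV"
proof -
  define p where "p = CARD('d) + 1 - r"
  have p: "1 \<le> p" using r by (simp add: p_def)
  obtain C where C: "\<And>n. L2_norm (u n) \<le> C" using u_bounded by blast
  define Q where "Q = C\<^sup>2 / (2 * pi) ^ CARD('d)"
  have Q: "(\<Sum>k\<in>F. (cmod (fourier_coeff (u n) k))\<^sup>2) \<le> Q" if "finite F" for n F
  proof -
    have "(2 * pi) ^ CARD('d) * (\<Sum>k\<in>F. (cmod (fourier_coeff (u n) k))\<^sup>2) \<le> (L2_norm (u n))\<^sup>2"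
      by (rule bessel_inequality[OF u_L2 that])
    also have "\<dots> \<le> C\<^sup>2" using C by (intro power_mono) (auto simp: L2_norm_def)
    finally show ?thesis by (simp add: Q_def pos_le_divide_eq mult.commute)
  qed
  have Q0: "0 \<le> Q" using Q[of "{}"] by simp
  obtain h where h: "\<And>n. 0 < h n" "h \<longlonglongrightarrow> 0"
    and tail: "((\<lambda>R :: real. limsup (\<lambda>n. ereal
          (\<Sum>\<^sub>\<infinity>l\<in>{l. norm (real_vec l) > R / h n}. (cmod (fourier_coeff (u n) l))\<^sup>2))) \<longlongrightarrow> 0) at_top"
    and null: "\<And>\<mu>. wigner_accumulation_point h u \<mu> \<Longrightarrow> emeasure \<mu> (torus_cell \<times> (\<Union>j<r. resonant_vectors j)) = 0"
    using condition by blast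
  obtain \<sigma> \<psi> where \<sigma>: "strict_mono (\<sigma> :: nat \<Rightarrow> nat)" and \<psi>: "\<And>n. schroedinger_flow (u n) (\<psi> n)"
    and lim: "\<And>l s. (\<lambda>n. spacetime_fourier_coeff (\<lambda>t x. (cmod (\<psi> (\<sigma> n) t x))\<^sup>2) l s) \<longlonglongrightarrow> spacetime_fourier_coeff \<nu> l s"
    using flow_coefficients_converge[OF \<nu>_L1 \<nu>_pos \<nu>_acc] by blast
  let ?F = "\<lambda>n l s. spacetime_fourier_coeff (\<lambda>t x. (cmod (\<psi> n t x))\<^sup>2) l s"
  let ?N = "\<lambda>l s. spacetime_fourier_coeff \<nu> l s"
  define \<beta> where "\<beta> i = (1 + 1 / (1 / real (Suc i))) * (2 * (1 / real (Suc i))\<^sup>2) + (1 / real (Suc i)) * Q" for i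
  have \<beta>0: "\<beta> \<longlonglongrightarrow> 0" unfolding \<beta>_def by (rule truncation_error_tendsto)
  have approx: "\<forall>\<^sub>F n in sequentially. \<exists>E. (\<forall>l s. cmod (?F n l s - autocorrelation (u n) E l s) \<le> \<beta> i)
      \<and> (\<Sum>(l, s)\<in>M. cmod (autocorrelation (u n) E l s) ^ p) \<le> (real p - 1) * Q ^ p"
    if M: "finite M" "0 \<notin> fst ` M" for M i
  proof -
    let ?\<eta> = "1 / real (Suc i)"
    have M2: "l \<noteq> 0" if "(l, s) \<in> M" for l s using M(2) that by force
    have "0 < ?\<eta>\<^sup>2" by simp
    from truncated_autocorrelation_bound[OF Q h tail null _ M(1) M2 this] r
    have "\<forall>\<^sub>F n in sequentially. \<exists>E. finite E
       \<and> (\<forall>F. finite F \<longrightarrow> F \<inter> E = {} \<longrightarrow> (\<Sum>k\<in>F. (cmod (fourier_coeff (u n) k))\<^sup>2) \<le> ?\<eta>\<^sup>2)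
       \<and> (\<Sum>(l, s)\<in>M. cmod (autocorrelation (u n) E l s) ^ p) \<le> (real p - 1) * Q ^ p"
      unfolding p_def by simp
    then show ?thesis
    proof eventually_elim
      case (elim n)
      then obtain E where E: "finite E" "\<And>F. finite F \<Longrightarrow> F \<inter> E = {} \<Longrightarrow> (\<Sum>k\<in>F. (cmod (fourier_coeff (u n) k))\<^sup>2) \<le> ?\<eta>\<^sup>2"
        "(\<Sum>(l, s)\<in>M. cmod (autocorrelation (u n) E l s) ^ p) \<le> (real p - 1) * Q ^ p" by blast
      have "cmod (?F n l s - autocorrelation (u n) E l s) \<le> \<beta> i" for l s
        unfolding \<beta>_def by (rule flow_density_coefficient_approx[OF \<psi> E(1) _ E(2) Q[OF E(1)]]) auto
      with E(3) show ?case by blast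
    qed
  qed
  \<comment> \<open>A vanishing displacement does not change the energy, so no pairs have frequency \<open>(0, s)\<close>.\<close>
  have zero: "?N 0 s = 0" if "s \<noteq> 0" for s
  proof -
    have "cmod (?N 0 s) \<le> \<beta> i" for i
    proof (rule tendsto_upperbound)
      show "(\<lambda>n. cmod (?F (\<sigma> n) 0 s)) \<longlonglongrightarrow> cmod (?N 0 s)" by (intro tendsto_norm lim)
      have "\<forall>\<^sub>F n in sequentially. cmod (?F n 0 s) \<le> \<beta> i"
        using approx[of "{}" i, simplified]
      proof eventually_elim
        case (elim n)
        then obtain E where "cmod (?F n 0 s - autocorrelation (u n) E 0 s) \<le> \<beta> i" by blast
        then show ?case by (simp add: autocorrelation_zero_shift[OF that])
      qed
      then show "\<forall>\<^sub>F n in sequentially. cmod (?F (\<sigma> n) 0 s) \<le> \<beta> i" by (rule eventually_subseq[OF \<sigma>])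
    qed simp
    then have "cmod (?N 0 s) \<le> 0" by (intro LIMSEQ_le_const[OF \<beta>0]) auto
    then show ?thesis by simp
  qed
  have main: "(\<Sum>(l, s)\<in>M. cmod (?N l s) ^ p) \<le> (real p - 1) * Q ^ p"
    if M: "finite M" "0 \<notin> fst ` M" for M
  proof -
    have bd: "(\<Sum>(l, s)\<in>M. max 0 (cmod (?N l s) - \<beta> i) ^ p) \<le> (real p - 1) * Q ^ p" for i
    proof (rule tendsto_upperbound)
      show "(\<lambda>n. \<Sum>(l, s)\<in>M. max 0 (cmod (?F (\<sigma> n) l s) - \<beta> i) ^ p) \<longlonglongrightarrow> (\<Sum>(l, s)\<in>M. max 0 (cmod (?N l s) - \<beta> i) ^ p)"
        unfolding case_prod_beta' by (intro tendsto_sum tendsto_power tendsto_max tendsto_diff tendsto_const tendsto_norm lim)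
      have "\<forall>\<^sub>F n in sequentially. (\<Sum>(l, s)\<in>M. max 0 (cmod (?F n l s) - \<beta> i) ^ p) \<le> (real p - 1) * Q ^ p"
        using approx[OF M, of i]
      proof eventually_elim
        case (elim n)
        then obtain E where E: "\<And>l s. cmod (?F n l s - autocorrelation (u n) E l s) \<le> \<beta> i"
          "(\<Sum>(l, s)\<in>M. cmod (autocorrelation (u n) E l s) ^ p) \<le> (real p - 1) * Q ^ p" by blast
        have "max 0 (cmod (?F n l s) - \<beta> i) \<le> cmod (autocorrelation (u n) E l s)" for l s
          using E(1)[of l s] norm_triangle_ineq2[of "?F n l s" "autocorrelation (u n) E l s"] by simp
        then have "(\<Sum>(l, s)\<in>M. max 0 (cmod (?F n l s) - \<beta> i) ^ p) \<le> (\<Sum>(l, s)\<in>M. cmod (autocorrelation (u n) E l s) ^ p)"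
          unfolding case_prod_beta' by (intro sum_mono power_mono) auto
        with E(2) show ?case by linarith
      qed
      then show "\<forall>\<^sub>F n in sequentially. (\<Sum>(l, s)\<in>M. max 0 (cmod (?F (\<sigma> n) l s) - \<beta> i) ^ p) \<le> (real p - 1) * Q ^ p"
        by (rule eventually_subseq[OF \<sigma>])
    qed simp
    have "(\<lambda>i. \<Sum>(l, s)\<in>M. max 0 (cmod (?N l s) - \<beta> i) ^ p) \<longlonglongrightarrow> (\<Sum>(l, s)\<in>M. max 0 (cmod (?N l s) - 0) ^ p)"
      unfolding case_prod_beta' by (intro tendsto_sum tendsto_power tendsto_max tendsto_diff tendsto_const \<beta>0)
    then have "(\<Sum>(l, s)\<in>M. max 0 (cmod (?N l s) - 0) ^ p) \<le> (real p - 1) * Q ^ p"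
      by (rule LIMSEQ_le_const2) (use bd in blast)
    then show ?thesis by simp
  qed
  have fin: "(\<Sum>(l, s)\<in>M. cmod (?N l s) ^ p) \<le> cmod (?N 0 0) ^ p + (real p - 1) * Q ^ p" if M: "finite M" for M
  proof -
    let ?g = "\<lambda>(l, s). cmod (?N l s) ^ p"
    let ?M1 = "{m\<in>M. fst m \<noteq> 0}"
    have "sum ?g M \<le> sum ?g (insert (0, 0) M)" using M by (intro sum_mono2) auto
    also have "\<dots> = sum ?g (insert (0, 0) ?M1)"
    proof (rule sum.mono_neutral_right)
      show "\<forall>m\<in>insert (0, 0) M - insert (0, 0) ?M1. ?g m = 0"
        using p zero by (auto simp: power_0_left)
    qed (use M in auto)
    also have "\<dots> = cmod (?N 0 0) ^ p + sum ?g ?M1" using M by (subst sum.insert) auto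
    also have "sum ?g ?M1 \<le> (real p - 1) * Q ^ p" using M by (intro main) auto
    finally show ?thesis by simp
  qed
  show ?thesis
    unfolding p_def[symmetric]
    by (rule nonneg_bdd_above_summable_on)
      (use fin in \<open>auto intro!: bdd_aboveI2[where M = "cmod (?N 0 0) ^ p + (real p - 1) * Q ^ p"]\<close>)
qed

end
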